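(* Let $G$ be a connected graph with diameter at least $4$ and $\beta'(G)\ge 3$, and let $\lambda$ be a nonzero eigenvalue of $G$. Then $m_\lambda(G)=\beta'(G)+c(G)-1$ if and only if there exists a vertex $w$ of $G$ such that, with $s=\beta'(G)\ge 3$ and $c(G)\le s$, $$G-w=H_1\cup\dots\cup H_{c(G)}\cup\dots\cup H_s\cup I,$$ where $I$ induces a null graph and $H_1,\dots,H_s$ are the connected components of $G-w$ of order at least $2$, such that all of the following hold: (i) for some integer $a\ge 0$, each $H_i$ with $1\le i\le c(G)$ is isomorphic to $C_3(a,a,a)$ and $m_\lambda(H_i)=2$; (ii) each $H_j$ with $c(G)+1\le j\le s$ is a tree with diameter at most $3$ and $m_\lambda(H_j)=1$; (iii) either $\operatorname{diam}(H_i+w)=2$ for some $i\in\{1,\dots,s\}$, or $I=\emptyset$ and $\operatorname{diam}(H_i+w)=3$ for all $i\in\{1,\dots,s\}$.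
   Context: All graphs are finite, simple and undirected. The eigenvalues of a graph $G$ are the eigenvalues of its adjacency matrix $A(G)$, and $m_\lambda(G)$ denotes the multiplicity of $\lambda$ as an eigenvalue of $A(G)$ (it is $0$ if $\lambda$ is not an eigenvalue). The cyclomatic number is $c(G)=|E(G)|-|V(G)|+\omega(G)$, where $\omega(G)$ is the number of connected components of $G$. A matching is a set of pairwise non-adjacent edges; a matching $M$ of $G$ is induced if no edge of $G$ connects endpoints of two distinct edges of $M$. The induced matching number $\beta'(G)$ is the number of edges in a maximum induced matching of $G$. $\operatorname{diam}$ denotes the diameter. $G-w$ is the graph obtained by deleting the vertex $w$ and its incident edges; for a subgraph $H$ of $G$ and a vertex $w\notin V(H)$, $H+w$ is the subgraph of $G$ induced by $V(H)\cup\{w\}$. A null graph is a graph without edges; $I$ is the (possibly empty) set of isolated vertices of $G-w$. For an integer $a\ge 0$, $C_3(a,a,a)$ is the graph obtained from the triangle $C_3$ by attaching $a$ pendant vertices to each of its three vertices. *)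

theory Defs
  imports
    "Jordan_Normal_Form.Char_Poly"
    "Graph_Theory.Graph_Theory"
begin

text \<open>
  A finite simple undirected graph is a digraph satisfying the locale predicate \<open>graph\<close> of
  \<open>Graph_Theory\<close> (finite, loop-free, without parallel arcs, symmetric): an undirected edge
  \<open>{u, v}\<close> is represented by the two arcs from \<open>u\<close> to \<open>v\<close> and from \<open>v\<close> to \<open>u\<close>. For such graphs
  \<open>pre_digraph.sccs\<close> is the set of connected components, each as an induced subgraph.
\<close>

definition edges :: "('a, 'b) pre_digraph \<Rightarrow> 'a set set" where
  "edges G = {{u, v} |u v. u \<rightarrow>\<^bsub>G\<^esub> v}"

definition cyclomatic :: "('a, 'b) pre_digraph \<Rightarrow> int" where
  "cyclomatic G = int (card (edges G)) - int (card (verts G)) + int (card (pre_digraph.sccs G))"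

definition matching :: "('a, 'b) pre_digraph \<Rightarrow> 'a set set \<Rightarrow> bool" where
  "matching G M \<longleftrightarrow> M \<subseteq> edges G \<and> (\<forall>e\<in>M. \<forall>f\<in>M. e \<noteq> f \<longrightarrow> e \<inter> f = {})"

definition induced_matching :: "('a, 'b) pre_digraph \<Rightarrow> 'a set set \<Rightarrow> bool" where
  "induced_matching G M \<longleftrightarrow> matching G M \<and>
     (\<forall>e\<in>M. \<forall>f\<in>M. e \<noteq> f \<longrightarrow> (\<forall>u\<in>e. \<forall>v\<in>f. \<not> u \<rightarrow>\<^bsub>G\<^esub> v))"

definition induced_matching_number :: "('a, 'b) pre_digraph \<Rightarrow> nat" where
  "induced_matching_number G = Max (card ` {M. induced_matching G M})"

text \<open>The distance of two vertices is the cost of a shortest walk with unit arc weights.\<close>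

definition graph_diameter :: "('a, 'b) pre_digraph \<Rightarrow> ereal" where
  "graph_diameter G = (SUP u\<in>verts G. SUP v\<in>verts G. wf_digraph.\<mu> G (\<lambda>_. 1) u v)"

text \<open>
  \<open>Digraph_Component.tree\<close> is not suitable here: going back and forth along one edge is a
  \<open>cycle\<close> of length 2 in the symmetric digraph. The cycles of the undirected graph are those of
  length at least 3.
\<close>

definition undirected_tree :: "('a, 'b) pre_digraph \<Rightarrow> bool" where
  "undirected_tree G \<longleftrightarrow>
     Digraph_Component.connected G \<and> \<not> (\<exists>p. pre_digraph.cycle G p \<and> 3 \<le> length p)"

definition isolated_verts :: "('a, 'b) pre_digraph \<Rightarrow> 'a set" where
  "isolated_verts G = {v \<in> verts G. \<not> (\<exists>u. v \<rightarrow>\<^bsub>G\<^esub> u)}"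

text \<open>
  The adjacency matrix depends on the enumeration of the vertices only up to simultaneous
  permutation of rows and columns, so its characteristic polynomial does not depend on it.
\<close>

definition vertex_list :: "('a, 'b) pre_digraph \<Rightarrow> 'a list" where
  "vertex_list G = (SOME vs. distinct vs \<and> set vs = verts G)"

definition adjacency_matrix :: "('a, 'b) pre_digraph \<Rightarrow> real mat" where
  "adjacency_matrix G = mat (card (verts G)) (card (verts G))
     (\<lambda>(i, j). if vertex_list G ! i \<rightarrow>\<^bsub>G\<^esub> vertex_list G ! j then 1 else 0)"

definition eigenvalue_mult :: "('a, 'b) pre_digraph \<Rightarrow> real \<Rightarrow> nat" where
  "eigenvalue_mult G \<theta> = Polynomial.order \<theta> (char_poly (adjacency_matrix G))"

text \<open>
  The graph \<open>C\<^sub>3(a,a,a)\<close>: the triangle vertices are \<open>(i, 0)\<close> with \<open>i < 3\<close>, and the pendant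
  vertices attached to \<open>(i, 0)\<close> are \<open>(i, k)\<close> with \<open>1 \<le> k \<le> a\<close>.
\<close>

definition C3_pendant :: "nat \<Rightarrow> (nat \<times> nat) pair_pre_digraph" where
  "C3_pendant a = \<lparr>
     pverts = {..<3} \<times> {..a},
     parcs = {((i, 0), (j, 0)) |i j. i < 3 \<and> j < 3 \<and> i \<noteq> j}
           \<union> {((i, 0), (i, k)) |i k. i < 3 \<and> 1 \<le> k \<and> k \<le> a}
           \<union> {((i, k), (i, 0)) |i k. i < 3 \<and> 1 \<le> k \<and> k \<le> a} \<rparr>"

end

theory Submission
  imports
    Defs
    "Jordan_Normal_Form.Jordan_Normal_Form_Existence"
    "Jordan_Normal_Form.Jordan_Normal_Form_Uniqueness"
begin

text \<open>
  A vertex \<open>w\<close> is a Parter vertex if some eigenvector of \<open>G - w\<close> has a nonzero sum over the neighbours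
  of \<open>w\<close>; then every eigenvector of \<open>G\<close> vanishes at \<open>w\<close>, and the multiplicity of \<open>G - w\<close> exceeds that
  of \<open>G\<close>. In a connected graph without Parter vertices the zeros of an eigenvector cross bridges, and
  building the graph from a single vertex by bridges and ears shows that \<open>c(G) + 1\<close> suitable
  zeros force an eigenvector to vanish, so \<open>m(G) \<le> c(G) + 1\<close>. Deleting Parter vertices one by one gives
  \<open>m(G) \<le> \<beta>'(G) + c(G)\<close>, with equality for a connected graph only if it has no Parter vertex and \<open>\<beta>'(G) \<le> 1\<close>.

  Hence if \<open>m(G) = \<beta>'(G) + c(G) - 1\<close> and \<open>\<beta>'(G) \<ge> 3\<close>, there is a Parter vertex \<open>w\<close>, neither \<open>\<beta>'\<close> nor
  \<open>c\<close> changes when it is deleted, and every component \<open>K\<close> of \<open>G - w\<close> attains \<open>m(K) = \<beta>'(K) + c(K)\<close>. Since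
  \<open>\<beta>'(K) = 1\<close> and no cycle of \<open>K\<close> has a chord, the nontrivial components with a cycle contain a shortest
  one of length 3, 4 or 5; these are \<open>C\<^sub>3(a,a,a)\<close>, impossible, and \<open>C\<^sub>5\<close>. The last case and the diameter
  condition are settled by the induced matchings through an edge at \<open>w\<close>.
  Conversely, deleting one vertex changes \<open>m\<close> by at most one, so the multiplicities of the components
  give \<open>m(G) \<ge> \<beta>'(G) + c(G) - 1\<close>, and equality in the upper bound is excluded by \<open>\<beta>'(G) \<ge> 2\<close>.
\<close>

section \<open>Components, cyclomatic number and induced matchings\<close>

text \<open>Any set of zeros that forces an eigenvector to vanish bounds the dimension of the
  eigenspace by its size; this links multiplicity to forcing. Without Parter vertices zeros cross
  bridges for free, so only cycles cost further zeros. In a component attaining the bound, two zeros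
  force a cycle with a chord although it has more edges than vertices, which would push the count
  below \<open>c + 1\<close>; so chords cannot occur. In a triangle with pendants, an eigenvector
  vanishing at one corner shows that each corner carries \<open>lam\<^sup>2 + lam\<close> pendants,
  which is why one \<open>a\<close> serves all corners and all components. For the five-cycle the
  same quantity is \<open>1\<close>. There the edge from \<open>w\<close> to the cycle yields
  another component that is a star, in which \<open>lam\<^sup>2\<close> is an integer; then so is
  \<open>lam = 1 - lam\<^sup>2\<close>, but no integer satisfies this equation. Four-cycles, the
  longest case, are excluded by choosing opposite vertices with as many common neighbours as
  possible: two zeros then determine every eigenvector, while the component contains two independent
  cycles.\<close>

locale simple_adj =
  fixes adj :: "'a \<Rightarrow> 'a \<Rightarrow> bool"
  assumes adj_sym: "adj u v \<Longrightarrow> adj v u"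
    and adj_irrefl: "\<not> adj u u"
begin

definition nb :: "'a set \<Rightarrow> 'a \<Rightarrow> 'a set" where
  "nb W v = {u \<in> W. adj v u}"

definition rel :: "'a set \<Rightarrow> ('a \<times> 'a) set" where
  "rel W = {(u, v). u \<in> W \<and> v \<in> W \<and> adj u v}"

definition edg :: "'a set \<Rightarrow> 'a set set" where
  "edg W = {{u, v} |u v. u \<in> W \<and> v \<in> W \<and> adj u v}"

definition conn :: "'a set \<Rightarrow> bool" where
  "conn W \<longleftrightarrow> W \<noteq> {} \<and> (\<forall>u\<in>W. \<forall>v\<in>W. (u, v) \<in> (rel W)\<^sup>*)"

definition comp_of :: "'a set \<Rightarrow> 'a \<Rightarrow> 'a set" where
  "comp_of W v = {u \<in> W. (v, u) \<in> (rel W)\<^sup>*}"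

definition comps :: "'a set \<Rightarrow> 'a set set" where
  "comps W = comp_of W ` W"

definition cyc :: "'a set \<Rightarrow> int" where
  "cyc W = int (card (edg W)) - int (card W) + int (card (comps W))"

definition imatch :: "'a set \<Rightarrow> 'a set set \<Rightarrow> bool" where
  "imatch W M \<longleftrightarrow> M \<subseteq> edg W \<and>
     (\<forall>e\<in>M. \<forall>f\<in>M. e \<noteq> f \<longrightarrow> (\<forall>u\<in>e. \<forall>v\<in>f. u \<noteq> v \<and> \<not> adj u v))"

definition imn :: "'a set \<Rightarrow> nat" where
  "imn W = Max (card ` {M. imatch W M})"

lemma adj_comm: "adj u v \<longleftrightarrow> adj v u"
  using adj_sym by blast

lemma adj_neq: "adj u v \<Longrightarrow> u \<noteq> v"
  using adj_irrefl by blast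

lemma edg_iff: "{u, v} \<in> edg W \<longleftrightarrow> u \<in> W \<and> v \<in> W \<and> adj u v"
  unfolding edg_def by (auto simp: doubleton_eq_iff adj_comm)

lemma edgE: 
  assumes "e \<in> edg W"
  obtains u v where "e = {u, v}" "u \<in> W" "v \<in> W" "adj u v"
  using assms unfolding edg_def by blast

lemma edg_mono: "A \<subseteq> B \<Longrightarrow> edg A \<subseteq> edg B"
  unfolding edg_def by blast

lemma edg_subset_Pow: "edg W \<subseteq> Pow W"
  unfolding edg_def by blast

lemma finite_edg: "finite W \<Longrightarrow> finite (edg W)"
  using edg_subset_Pow finite_subset by blast

lemma finite_nb [simp]: "finite W \<Longrightarrow> finite (nb W v)"
  unfolding nb_def by simp

lemma rel_iff: "(u, v) \<in> rel W \<longleftrightarrow> u \<in> W \<and> v \<in> W \<and> adj u v"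
  unfolding rel_def by simp

lemma sym_rel: "sym (rel W)"
  by (rule symI) (auto simp: rel_iff adj_sym)

lemma rel_mono: "A \<subseteq> B \<Longrightarrow> rel A \<subseteq> rel B"
  unfolding rel_def by blast

lemma rtrancl_rel_in: "(u, v) \<in> (rel W)\<^sup>* \<Longrightarrow> u \<in> W \<Longrightarrow> v \<in> W"
  by (induction rule: rtrancl_induct) (auto simp: rel_iff)

lemma rtrancl_rel_sym: "(u, v) \<in> (rel W)\<^sup>* \<Longrightarrow> (v, u) \<in> (rel W)\<^sup>*"
  by (meson sym_rel sym_rtrancl symD)

lemma comp_of_self: "v \<in> W \<Longrightarrow> v \<in> comp_of W v"
  unfolding comp_of_def by simp

lemma comp_of_subset: "comp_of W v \<subseteq> W"
  unfolding comp_of_def by blast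

lemma comp_of_eq: "u \<in> comp_of W v \<Longrightarrow> comp_of W u = comp_of W v"
  unfolding comp_of_def using rtrancl_rel_sym rtrancl_trans by fast

lemma comp_of_step: "u \<in> comp_of W v \<Longrightarrow> x \<in> W \<Longrightarrow> adj u x \<Longrightarrow> x \<in> comp_of W v"
  unfolding comp_of_def by (auto simp: rel_iff intro: rtrancl_into_rtrancl)

lemma rtrancl_rel_comp_of:
  assumes "(u, v) \<in> (rel W)\<^sup>*" "u \<in> comp_of W x"
  shows "(u, v) \<in> (rel (comp_of W x))\<^sup>*"
  using assms
proof (induction rule: rtrancl_induct)
  case (step y z)
  have "y \<in> comp_of W x"
    using step.IH[OF step.prems] step.prems rtrancl_rel_in by blast
  moreover have "z \<in> comp_of W x"
    using comp_of_step[OF \<open>y \<in> comp_of W x\<close>] step.hyps by (auto simp: rel_iff)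
  ultimately show ?case
    using step by (auto simp: rel_iff intro: rtrancl_into_rtrancl)
qed simp

lemma conn_comp_of: "v \<in> W \<Longrightarrow> conn (comp_of W v)"
  unfolding conn_def
proof (intro conjI ballI)
  fix x y assume v: "v \<in> W" and x: "x \<in> comp_of W v" and y: "y \<in> comp_of W v"
  then have "(x, y) \<in> (rel W)\<^sup>*"
    unfolding comp_of_def using rtrancl_rel_sym rtrancl_trans by fast
  then show "(x, y) \<in> (rel (comp_of W v))\<^sup>*"
    using rtrancl_rel_comp_of x by blast
qed (use comp_of_self in blast)

lemma compsE:
  assumes "K \<in> comps W"
  obtains v where "v \<in> W" "K = comp_of W v"
  using assms unfolding comps_def by blast

lemma comps_subset: "K \<in> comps W \<Longrightarrow> K \<subseteq> W"
  using compsE comp_of_subset by metis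

lemma comps_conn: "K \<in> comps W \<Longrightarrow> conn K"
  using compsE conn_comp_of by metis

lemma Union_comps: "\<Union> (comps W) = W"
  unfolding comps_def using comp_of_self comp_of_subset by fast

lemma finite_comps: "finite W \<Longrightarrow> finite (comps W)"
  unfolding comps_def by simp

lemma comps_step: "K \<in> comps W \<Longrightarrow> u \<in> K \<Longrightarrow> v \<in> W \<Longrightarrow> adj u v \<Longrightarrow> v \<in> K"
  using compsE comp_of_step by metis

lemma comps_eq: "K \<in> comps W \<Longrightarrow> L \<in> comps W \<Longrightarrow> x \<in> K \<Longrightarrow> x \<in> L \<Longrightarrow> K = L"
  using compsE comp_of_eq by metis

lemma comps_nonadj:
  "K \<in> comps W \<Longrightarrow> L \<in> comps W \<Longrightarrow> K \<noteq> L \<Longrightarrow> u \<in> K \<Longrightarrow> v \<in> L \<Longrightarrow> u \<noteq> v \<and> \<not> adj u v"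
  using comps_eq comps_step comps_subset by (metis subsetD)

lemma conn_comp_of_eq: "conn W \<Longrightarrow> v \<in> W \<Longrightarrow> comp_of W v = W"
  unfolding conn_def comp_of_def by blast

lemma conn_comps: "conn W \<Longrightarrow> comps W = {W}"
  unfolding comps_def using conn_comp_of_eq by (auto simp: conn_def)

lemma conn_cyc: "conn W \<Longrightarrow> cyc W = int (card (edg W)) - int (card W) + 1"
  unfolding cyc_def by (simp add: conn_comps)

text \<open>Its use is for closure arguments: a nonempty subset of a connected set that no edge
  leaves is the whole set.\<close>

lemma conn_boundary:
  assumes "conn V" "W \<subseteq> V" "W \<noteq> {}" "W \<noteq> V"
  obtains u v where "u \<in> W" "v \<in> V - W" "adj u v"
proof -
  obtain a b where a: "a \<in> W" and b: "b \<in> V" "b \<notin> W" using assms by blast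
  have "(a, b) \<in> (rel V)\<^sup>*" using assms(1,2) a b unfolding conn_def by blast
  then have "b \<notin> W \<longrightarrow> (\<exists>u\<in>W. \<exists>v\<in>V - W. adj u v)"
    by (induction rule: rtrancl_induct) (use a in \<open>auto simp: rel_iff\<close>)
  then show ?thesis using b that by blast
qed

definition separated :: "'a set \<Rightarrow> 'a set \<Rightarrow> bool" where
  "separated A B \<longleftrightarrow> A \<inter> B = {} \<and> (\<forall>u\<in>A. \<forall>v\<in>B. \<not> adj u v)"

lemma separated_sym: "separated A B \<Longrightarrow> separated B A"
  unfolding separated_def using adj_sym by blast

text \<open>Components are joined one at a time, each separated from the union of the previous ones.
  Edge excess, \<open>imn\<close> and \<open>mult\<close> thus need additivity for two separated
  sets only.\<close>

lemma additive_over_comps: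
  fixes \<Phi> :: "'a set \<Rightarrow> int"
  assumes fin: "finite W" and empty: "\<Phi> {} = 0"
    and add: "\<And>A B. finite A \<Longrightarrow> finite B \<Longrightarrow> separated A B \<Longrightarrow> \<Phi> (A \<union> B) = \<Phi> A + \<Phi> B"
  shows "\<Phi> W = (\<Sum>K\<in>comps W. \<Phi> K)"
proof -
  have "\<Phi> (\<Union> \<K>) = (\<Sum>K\<in>\<K>. \<Phi> K)" if "finite \<K>" "\<K> \<subseteq> comps W" for \<K>
    using that
  proof (induction rule: finite_induct)
    case (insert K \<K>)
    have "separated K (\<Union> \<K>)"
      unfolding separated_def
      using comps_nonadj[of K W] insert.hyps insert.prems by blast
    moreover have "finite K" "finite (\<Union> \<K>)"
      using insert.prems fin comps_subset by (auto intro!: finite_subset[OF _ fin])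
    ultimately show ?case using add insert by simp
  qed (simp add: empty)
  from this[OF finite_comps[OF fin] subset_refl] show ?thesis by (simp only: Union_comps)
qed

lemma edg_union: "separated A B \<Longrightarrow> edg (A \<union> B) = edg A \<union> edg B"
  unfolding separated_def edg_def using adj_sym by blast

lemma edg_disjoint: "A \<inter> B = {} \<Longrightarrow> edg A \<inter> edg B = {}"
  unfolding edg_def by (auto simp: doubleton_eq_iff)

lemma cyc_sum: "finite W \<Longrightarrow> cyc W = (\<Sum>K\<in>comps W. cyc K)"
proof -
  assume fin: "finite W"
  \<comment> \<open>Additivity is applied to edges minus vertices; the number of components then
    enters as one \<open>1\<close> for each component.\<close>
  have "int (card (edg W)) - int (card W)
      = (\<Sum>K\<in>comps W. int (card (edg K)) - int (card K))"
  proof (rule additive_over_comps[OF fin])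
    fix A B assume "finite A" "finite B" and s: "separated A B"
    then show "int (card (edg (A \<union> B))) - int (card (A \<union> B))
       = int (card (edg A)) - int (card A) + (int (card (edg B)) - int (card B))"
      using edg_disjoint[of A B]
      by (simp add: edg_union card_Un_disjoint finite_edg separated_def)
  qed (simp add: edg_def)
  then have "cyc W = (\<Sum>K\<in>comps W. int (card (edg K)) - int (card K) + 1)"
    unfolding cyc_def by (simp add: sum.distrib)
  also have "\<dots> = (\<Sum>K\<in>comps W. cyc K)"
    by (rule sum.cong) (simp_all add: conn_cyc comps_conn)
  finally show ?thesis .
qed

lemma edg_insert_vertex:
  assumes "w \<in> W"
  shows "edg W = edg (W - {w}) \<union> (\<lambda>u. {w, u}) ` nb W w"
proof
  show "edg W \<subseteq> edg (W - {w}) \<union> (\<lambda>u. {w, u}) ` nb W w"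
  proof
    fix e assume "e \<in> edg W"
    then obtain u v where e: "e = {u, v}" "u \<in> W" "v \<in> W" "adj u v" by (rule edgE)
    show "e \<in> edg (W - {w}) \<union> (\<lambda>u. {w, u}) ` nb W w"
    proof (cases "u = w \<or> v = w")
      case True
      then show ?thesis
      proof
        assume "u = w" then show ?thesis using e by (auto simp: nb_def)
      next
        assume "v = w"
        then have "e = {w, u}" "u \<in> nb W w" using e by (auto simp: nb_def adj_sym)
        then show ?thesis by blast
      qed
    next
      case False then show ?thesis using e by (simp add: edg_iff)
    qed
  qed
next
  show "edg (W - {w}) \<union> (\<lambda>u. {w, u}) ` nb W w \<subseteq> edg W"
    using assms edg_mono[of "W - {w}" W] by (auto simp: nb_def edg_iff)
qed

lemma card_edg_delete:
  assumes "finite W" "w \<in> W"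
  shows "card (edg W) = card (edg (W - {w})) + card (nb W w)"
proof -
  have "inj_on (\<lambda>u. {w, u}) (nb W w)" by (auto simp: inj_on_def doubleton_eq_iff)
  moreover have "edg (W - {w}) \<inter> (\<lambda>u. {w, u}) ` nb W w = {}"
    using edg_subset_Pow[of "W - {w}"] by blast
  ultimately show ?thesis
    unfolding edg_insert_vertex[OF assms(2)]
    using assms(1) by (simp add: card_Un_disjoint finite_edg card_image)
qed

text \<open>A component without a neighbour of \<open>w\<close> would be closed under adjacency in
  all of \<open>W\<close>.\<close>

lemma comps_delete_has_nb:
  assumes "conn W" "w \<in> W" "K \<in> comps (W - {w})"
  shows "K \<inter> nb W w \<noteq> {}"
proof -
  have K: "K \<subseteq> W - {w}" "K \<noteq> {}" 
    using comps_subset comps_conn assms(3) by (auto simp: conn_def)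
  then have "K \<subseteq> W" "K \<noteq> W" using assms(2) by blast+
  then obtain u v where uv: "u \<in> K" "v \<in> W - K" "adj u v"
    using conn_boundary[OF assms(1)] K by metis
  have "v = w" using comps_step[OF assms(3) uv(1) _ uv(3)] uv(2) by blast
  then show ?thesis using uv K by (auto simp: nb_def adj_sym)
qed

lemma comps_delete_image:
  assumes "conn W" "w \<in> W"
  shows "comps (W - {w}) = comp_of (W - {w}) ` nb W w"
proof
  show "comps (W - {w}) \<subseteq> comp_of (W - {w}) ` nb W w"
  proof
    fix K assume K: "K \<in> comps (W - {w})"
    then obtain u where "u \<in> K" "u \<in> nb W w" using comps_delete_has_nb[OF assms K] by blast
    moreover have "K = comp_of (W - {w}) u"
      using K \<open>u \<in> K\<close> by (metis compsE comp_of_eq)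
    ultimately show "K \<in> comp_of (W - {w}) ` nb W w" by blast
  qed
  show "comp_of (W - {w}) ` nb W w \<subseteq> comps (W - {w})"
    unfolding comps_def nb_def using adj_neq by fastforce
qed

text \<open>Passing to \<open>W - {w}\<close> loses one vertex and the edges at \<open>w\<close>,
  while the single component of \<open>W\<close> breaks up into those of
  \<open>W - {w}\<close>.\<close>

lemma cyc_delete:
  assumes "finite W" "conn W" "w \<in> W"
  shows "cyc W = cyc (W - {w}) + int (card (nb W w)) - int (card (comps (W - {w})))"
  using card_edg_delete[OF assms(1,3)] card_Suc_Diff1[OF assms(1,3)]
  unfolding conn_cyc[OF assms(2)] cyc_def[of "W - {w}"] by linarith

lemma cyc_delete_le:
  assumes "finite W" "conn W" "w \<in> W"
  shows "cyc (W - {w}) \<le> cyc W"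
  using cyc_delete[OF assms] card_image_le[of "nb W w" "comp_of (W - {w})"] assms
  by (simp add: comps_delete_image)

text \<open>Equality means that there are as many components as neighbours of \<open>w\<close>, so
  the surjection from neighbours to components is injective.\<close>

lemma cyc_delete_eq:
  assumes "finite W" "conn W" "w \<in> W" "cyc (W - {w}) = cyc W" "K \<in> comps (W - {w})"
  shows "\<exists>u. K \<inter> nb W w = {u}"
proof -
  have "card (comp_of (W - {w}) ` nb W w) = card (nb W w)"
    using cyc_delete[OF assms(1-3)] assms comps_delete_image by simp
  then have inj: "inj_on (comp_of (W - {w})) (nb W w)"
    using eq_card_imp_inj_on[OF finite_nb[OF assms(1)]] by blast
  obtain u where u: "u \<in> K" "u \<in> nb W w" using comps_delete_has_nb assms by blast
  moreover have "v = u" if "v \<in> K" "v \<in> nb W w" for v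
  proof -
    have "comp_of (W - {w}) v = comp_of (W - {w}) u"
      using assms(5) u that by (metis compsE comp_of_eq)
    then show ?thesis using inj u that by (auto dest: inj_onD)
  qed
  ultimately show ?thesis by blast
qed

section \<open>Induced matchings\<close>

lemma imatch_mono:
  assumes "imatch W M" "W \<subseteq> V"
  shows "imatch V M"
  using assms(1) subset_trans[OF _ edg_mono[OF assms(2)], of M] unfolding imatch_def by simp

lemma finite_imatchs: "finite W \<Longrightarrow> finite {M. imatch W M}"
  by (rule finite_subset[of _ "Pow (edg W)"]) (auto simp: imatch_def finite_edg)

lemma imatch_empty: "imatch W {}"
  unfolding imatch_def by simp

lemma imn_ge: "finite W \<Longrightarrow> imatch W M \<Longrightarrow> card M \<le> imn W"
  unfolding imn_def by (rule Max_ge) (auto simp: finite_imatchs)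

lemma imn_ex: "finite W \<Longrightarrow> \<exists>M. imatch W M \<and> card M = imn W"
proof -
  assume "finite W"
  then have "imn W \<in> card ` {M. imatch W M}"
    unfolding imn_def using imatch_empty by (intro Max_in) (auto simp: finite_imatchs)
  then show ?thesis by (metis imageE mem_Collect_eq)
qed

lemma imn_mono:
  assumes "finite V" "W \<subseteq> V"
  shows "imn W \<le> imn V"
proof -
  obtain M where "imatch W M" "card M = imn W"
    using imn_ex finite_subset[OF assms(2,1)] by blast
  then show ?thesis using imn_ge[OF assms(1)] imatch_mono[OF _ assms(2)] by metis
qed

lemma imn_pos:
  assumes "finite W" "u \<in> W" "v \<in> W" "adj u v"
  shows "1 \<le> imn W"
proof -
  have "imatch W {{u, v}}" unfolding imatch_def using assms by (simp add: edg_iff)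
  from imn_ge[OF assms(1) this] show ?thesis by simp
qed

lemma imn_two:
  assumes "finite W" "{a, b, c, d} \<subseteq> W" "adj a b" "adj c d"
    "a \<noteq> c" "a \<noteq> d" "b \<noteq> c" "b \<noteq> d" "\<not> adj a c" "\<not> adj a d" "\<not> adj b c" "\<not> adj b d"
  shows "2 \<le> imn W"
proof -
  have "imatch W {{a, b}, {c, d}}"
    unfolding imatch_def using assms adj_sym by (auto simp: edg_iff)
  moreover have "{a, b} \<noteq> {c, d}" using assms by (simp add: doubleton_eq_iff)
  then have "card {{a, b}, {c, d}} = 2" by simp
  ultimately show ?thesis using imn_ge assms(1) by metis
qed

lemma imn_union:
  assumes "finite A" "finite B" "separated A B"
  shows "imn (A \<union> B) = imn A + imn B"
proof (rule antisym)
  obtain M where M: "imatch (A \<union> B) M" "card M = imn (A \<union> B)" using imn_ex assms by blast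
  have "imatch A (M \<inter> edg A)" "imatch B (M \<inter> edg B)"
    using M unfolding imatch_def by blast+
  then have "card (M \<inter> edg A) + card (M \<inter> edg B) \<le> imn A + imn B"
    using imn_ge assms by (meson add_mono)
  moreover have "M = (M \<inter> edg A) \<union> (M \<inter> edg B)"
    using M edg_union[OF assms(3)] unfolding imatch_def by blast
  then have "card M \<le> card (M \<inter> edg A) + card (M \<inter> edg B)"
    by (metis card_Un_le)
  ultimately show "imn (A \<union> B) \<le> imn A + imn B" using M by simp
next
  obtain M where M: "imatch A M" "card M = imn A" using imn_ex assms by blast
  obtain N where N: "imatch B N" "card N = imn B" using imn_ex assms by blast
  have sub: "M \<subseteq> edg A" "N \<subseteq> edg B" using M N unfolding imatch_def by auto
  have MN: "u \<noteq> v \<and> \<not> adj u v \<and> v \<noteq> u \<and> \<not> adj v u" 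
    if "e \<in> M" "f \<in> N" "u \<in> e" "v \<in> f" for e f u v
  proof -
    have "u \<in> A" "v \<in> B" using that sub edg_subset_Pow by blast+
    then show ?thesis using assms(3) adj_comm unfolding separated_def by blast
  qed
  have "imatch (A \<union> B) (M \<union> N)"
    unfolding imatch_def edg_union[OF assms(3)]
  proof (intro conjI ballI impI)
    fix e f u v assume ef: "e \<in> M \<union> N" "f \<in> M \<union> N" "e \<noteq> f" "u \<in> e" "v \<in> f"
    have "u \<noteq> v \<and> \<not> adj u v" if "e \<in> M" "f \<in> M"
      using M(1) ef that unfolding imatch_def by metis
    moreover have "u \<noteq> v \<and> \<not> adj u v" if "e \<in> N" "f \<in> N"
      using N(1) ef that unfolding imatch_def by metis
    ultimately have "u \<noteq> v \<and> \<not> adj u v" 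
      using ef MN[of e f u v] MN[of f e v u] by (elim UnE) simp_all
    then show "u \<noteq> v" "\<not> adj u v" by simp_all
  qed (use sub in blast)
  then have "card (M \<union> N) \<le> imn (A \<union> B)" using imn_ge assms by simp
  moreover have "card (M \<union> N) = card M + card N"
    using sub edg_disjoint[of A B] assms finite_edg finite_subset
    by (intro card_Un_disjoint) (auto simp: separated_def intro: finite_subset)
  ultimately show "imn A + imn B \<le> imn (A \<union> B)" using M N by simp
qed

lemma imn_no_edge: "edg W = {} \<Longrightarrow> imn W = 0"
proof -
  assume "edg W = {}"
  then have "{M. imatch W M} = {{}}" using imatch_empty by (auto simp: imatch_def)
  then show ?thesis unfolding imn_def by simp
qed

lemma imn_sum:
  assumes "finite W"
  shows "int (imn W) = (\<Sum>K\<in>comps W. int (imn K))"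
proof (rule additive_over_comps[where \<Phi> = "\<lambda>W. int (imn W)", OF assms])
  have "edg {} = {}" by (simp add: edg_def)
  from imn_no_edge[OF this] show "int (imn {}) = 0" by simp
next
  fix A B assume "finite A" "finite B" "separated A B"
  from imn_union[OF this] show "int (imn (A \<union> B)) = int (imn A) + int (imn B)" by simp
qed

end

section \<open>Eigenvectors and Parter vertices\<close>

context simple_adj
begin

text \<open>Comparing unordered pairs removes both orientations of the edge, so the relation stays
  symmetric.\<close>

definition avoid :: "'a set \<Rightarrow> 'a \<Rightarrow> 'a \<Rightarrow> ('a \<times> 'a) set" where
  "avoid W u v = {(x, y) \<in> rel W. {x, y} \<noteq> {u, v}}"

definition bridge :: "'a set \<Rightarrow> 'a \<Rightarrow> 'a \<Rightarrow> bool" where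
  "bridge W u v \<longleftrightarrow> (u, v) \<in> rel W \<and> (u, v) \<notin> (avoid W u v)\<^sup>*"

lemma sym_avoid: "sym (avoid W u v)"
  unfolding avoid_def using sym_rel by (auto intro!: symI simp: insert_commute dest: symD)

lemma avoid_commute: "avoid W u v = avoid W v u"
  unfolding avoid_def by (simp add: insert_commute)

lemma bridge_sym:
  assumes "bridge W u v"
  shows "bridge W v u"
proof -
  have "(v, u) \<notin> (avoid W u v)\<^sup>*"
    using assms sym_rtrancl[OF sym_avoid[of W u v]] unfolding bridge_def by (blast dest: symD)
  then show ?thesis
    using assms adj_sym unfolding bridge_def avoid_commute[of W v u] rel_iff by blast
qed

end

text \<open>Scalars are complex so that characteristic polynomials split, as the passage to Jordan
  blocks requires.\<close>

locale spectral_adj = simple_adj adj for adj :: "'a \<Rightarrow> 'a \<Rightarrow> bool" +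
  fixes lam :: complex
  assumes lam_nz: "lam \<noteq> 0"
begin

definition nsum :: "'a set \<Rightarrow> ('a \<Rightarrow> complex) \<Rightarrow> 'a \<Rightarrow> complex" where
  "nsum W f v = (\<Sum>u\<in>nb W v. f u)"

text \<open>Since vanishing outside \<open>W\<close> is built in, one and the same function can be
  an eigenvector of both \<open>W\<close> and \<open>W - {w}\<close>, without restriction or
  extension maps.\<close>

definition eig :: "'a set \<Rightarrow> ('a \<Rightarrow> complex) set" where
  "eig W = {f. (\<forall>v. v \<notin> W \<longrightarrow> f v = 0) \<and> (\<forall>v\<in>W. nsum W f v = lam * f v)}"

definition determining :: "'a set \<Rightarrow> 'a set \<Rightarrow> bool" where
  "determining W Z \<longleftrightarrow> (\<forall>f\<in>eig W. (\<forall>z\<in>Z. f z = 0) \<longrightarrow> f = (\<lambda>_. 0))"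

text \<open>The least size of a determining set is the dimension of the eigenspace, and determining sets
  replace bases throughout.\<close>

definition mult :: "'a set \<Rightarrow> nat" where
  "mult W = (LEAST k. \<exists>Z\<subseteq>W. determining W Z \<and> card Z = k)"

text \<open>Equivalently, the deletion of \<open>w\<close> raises the multiplicity.\<close>

definition parter :: "'a set \<Rightarrow> 'a \<Rightarrow> bool" where
  "parter W w \<longleftrightarrow> w \<in> W \<and> (\<exists>f\<in>eig (W - {w}). nsum W f w \<noteq> 0)"

lemma eig_outside: "f \<in> eig W \<Longrightarrow> v \<notin> W \<Longrightarrow> f v = 0"
  unfolding eig_def by blast

lemma eig_eq: "f \<in> eig W \<Longrightarrow> v \<in> W \<Longrightarrow> nsum W f v = lam * f v"
  unfolding eig_def by blast

lemma eigI:
  "(\<And>v. v \<notin> W \<Longrightarrow> f v = 0) \<Longrightarrow> (\<And>v. v \<in> W \<Longrightarrow> nsum W f v = lam * f v) \<Longrightarrow> f \<in> eig W"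
  unfolding eig_def by blast

lemma nsum_lincomb: "nsum W (\<lambda>v. a * f v + b * g v) w = a * nsum W f w + b * nsum W g w"
  unfolding nsum_def by (simp add: sum.distrib sum_distrib_left)

lemma nsum_sum: "nsum W (\<lambda>v. \<Sum>z\<in>Z. c z * g z v) w = (\<Sum>z\<in>Z. c z * nsum W (g z) w)"
  unfolding nsum_def by (subst sum.swap) (simp add: sum_distrib_left)

lemma eig_lincomb:
  assumes "f \<in> eig W" "g \<in> eig W"
  shows "(\<lambda>v. a * f v + b * g v) \<in> eig W"
  using assms by (intro eigI) (simp_all add: nsum_lincomb eig_eq eig_outside algebra_simps)

lemma eig_diff: "f \<in> eig W \<Longrightarrow> g \<in> eig W \<Longrightarrow> (\<lambda>v. f v - b * g v) \<in> eig W"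
  using eig_lincomb[of f W g 1 "-b"] by simp

lemma eig_sum: "(\<And>z. z \<in> Z \<Longrightarrow> g z \<in> eig W) \<Longrightarrow> (\<lambda>v. \<Sum>z\<in>Z. c z * g z v) \<in> eig W"
  by (intro eigI sum.neutral) (auto simp: nsum_sum eig_eq sum_distrib_left mult.left_commute dest: eig_outside)

lemma determining_self: "determining W W"
  unfolding determining_def using eig_outside by blast

lemma determiningD: "determining W Z \<Longrightarrow> f \<in> eig W \<Longrightarrow> (\<And>z. z \<in> Z \<Longrightarrow> f z = 0) \<Longrightarrow> f v = 0"
  unfolding determining_def by (metis (full_types))

lemma mult_ex: "\<exists>Z\<subseteq>W. determining W Z \<and> card Z = mult W"
  unfolding mult_def by (rule LeastI_ex) (use determining_self in blast)

text \<open>Eigenvectors vanish outside \<open>W\<close>, so intersecting \<open>Z\<close> with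
  \<open>W\<close> preserves the determining property.\<close>

lemma mult_le:
  assumes "finite Z" "determining W Z"
  shows "mult W \<le> card Z"
proof -
  have "determining W (Z \<inter> W)"
    unfolding determining_def
  proof (intro ballI impI)
    fix f assume f: "f \<in> eig W" "\<forall>z\<in>Z \<inter> W. f z = 0"
    then have "\<forall>z\<in>Z. f z = 0" using eig_outside by blast
    then show "f = (\<lambda>_. 0)" using assms(2) f(1) unfolding determining_def by blast
  qed
  then have "mult W \<le> card (Z \<inter> W)" unfolding mult_def by (intro Least_le) blast
  also have "\<dots> \<le> card Z" using assms(1) by (simp add: card_mono)
  finally show ?thesis .
qed

text \<open>By minimality \<open>Z - {z}\<close> is not determining, so some eigenvector vanishes on
  \<open>Z - {z}\<close> but not at \<open>z\<close>; scaled to \<open>1\<close> at \<open>z\<close>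
  it is \<open>b z\<close>. The expansion holds because both sides agree on
  \<open>Z\<close>.\<close>

lemma dual_basis:
  assumes "finite W" "Z \<subseteq> W" "determining W Z" "card Z = mult W"
  obtains b where "\<And>z. z \<in> Z \<Longrightarrow> b z \<in> eig W"
    and "\<And>z y. z \<in> Z \<Longrightarrow> y \<in> Z \<Longrightarrow> b z y = (if y = z then 1 else 0)"
    and "\<And>f. f \<in> eig W \<Longrightarrow> f = (\<lambda>v. \<Sum>z\<in>Z. f z * b z v)"
proof -
  have finZ: "finite Z" using assms(1,2) finite_subset by blast
  have "\<exists>f. f \<in> eig W \<and> (\<forall>y\<in>Z. f y = (if y = z then 1 else 0))" if z: "z \<in> Z" for z
  proof -
    have "\<not> determining W (Z - {z})"
      using mult_le[of "Z - {z}" W] finZ z assms(4) card_Diff1_less[OF finZ z] by auto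
    then obtain f where f: "f \<in> eig W" "\<forall>y\<in>Z - {z}. f y = 0" "f \<noteq> (\<lambda>_. 0)"
      unfolding determining_def by blast
    have nz: "f z \<noteq> 0"
    proof
      assume "f z = 0"
      then have "\<forall>y\<in>Z. f y = 0" using f(2) by blast
      then show False using assms(3) f(1,3) unfolding determining_def by blast
    qed
    have "(\<lambda>v. (1 / f z) * f v + 0 * f v) \<in> eig W" by (rule eig_lincomb) (rule f)+
    then show ?thesis using nz f(2) by (intro exI[of _ "\<lambda>v. (1 / f z) * f v + 0 * f v"]) auto
  qed
  then obtain b where b: "\<And>z. z \<in> Z \<Longrightarrow> b z \<in> eig W \<and> (\<forall>y\<in>Z. b z y = (if y = z then 1 else 0))"
    by metis
  have "f = (\<lambda>v. \<Sum>z\<in>Z. f z * b z v)" if f: "f \<in> eig W" for f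
  proof -
    define g where "g = (\<lambda>v. \<Sum>z\<in>Z. f z * b z v)"
    have g: "g \<in> eig W" unfolding g_def by (rule eig_sum) (use b in blast)
    have "f y - 1 * g y = 0" if "y \<in> Z" for y
    proof -
      have "g y = (\<Sum>z\<in>Z. if y = z then f z else 0)"
        unfolding g_def by (rule sum.cong) (use b that in auto)
      then show ?thesis using that finZ by simp
    qed
    then have "f v - 1 * g v = 0" for v
      using determiningD[OF assms(3) eig_diff[OF f g, of 1]] by blast
    then have "f v = g v" for v by (metis eq_iff_diff_eq_0 mult_1)
    then have "f = g" by (rule ext)
    then show ?thesis unfolding g_def .
  qed
  then show ?thesis using that b by blast
qed

lemma nb_delete: "nb (W - {w}) v = nb W v - {w}"
  unfolding nb_def by blast

lemma nsum_delete:
  assumes "finite W"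
  shows "nsum W f v = nsum (W - {w}) f v + (if w \<in> nb W v then f w else 0)"
proof (cases "w \<in> nb W v")
  case True
  then show ?thesis unfolding nsum_def nb_delete
    using sum.remove[of "nb W v" w f] assms by simp
qed (simp add: nsum_def nb_delete)

lemma nsum_delete_zero: "finite W \<Longrightarrow> f w = 0 \<Longrightarrow> nsum (W - {w}) f v = nsum W f v"
  using nsum_delete[of W f v w] by simp

lemma eig_delete:
  assumes "finite W" "f \<in> eig W" "f w = 0"
  shows "f \<in> eig (W - {w})"
  using assms by (intro eigI) (auto simp: nsum_delete_zero eig_eq eig_outside)

lemma eig_delete_nsum:
  assumes "f \<in> eig W" "w \<in> W" "f w = 0"
  shows "nsum W f w = 0"
  using assms by (simp add: eig_eq)

lemma eig_extend:
  assumes "finite W" "f \<in> eig (W - {w})" "nsum W f w = 0"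
  shows "f \<in> eig W"
proof (rule eigI)
  have w: "f w = 0" using assms(2) eig_outside by blast
  fix v assume "v \<in> W"
  then show "nsum W f v = lam * f v"
    using assms w eig_eq[OF assms(2), of v] nsum_delete_zero[OF assms(1), of f w v] by (cases "v = w") auto
qed (use eig_outside[OF assms(2)] in blast)

text \<open>The adjacency operator is self-adjoint, so an eigenvector of \<open>W - {w}\<close> that violates the
  eigenvalue equation at \<open>w\<close> forces every eigenvector of \<open>W\<close> to vanish at \<open>w\<close>.\<close>

lemma sum_nsum_swap:
  assumes "finite W"
  shows "(\<Sum>v\<in>W. f v * nsum W g v) = (\<Sum>v\<in>W. nsum W f v * g v)"
proof -
  have ns: "nsum W h v = (\<Sum>u\<in>W. if adj v u then h u else 0)" for h v
    unfolding nsum_def nb_def by (rule sum.inter_filter[OF assms])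
  have 1: "f v * nsum W g v = (\<Sum>u\<in>W. if adj v u then f v * g u else 0)" for v
    unfolding ns sum_distrib_left by (rule sum.cong) auto
  have 2: "nsum W f v * g v = (\<Sum>u\<in>W. if adj u v then f u * g v else 0)" for v
    unfolding ns sum_distrib_right by (rule sum.cong) (auto dest: adj_sym)
  show ?thesis unfolding 1 2 by (rule sum.swap)
qed

lemma parter_vanish:
  assumes "finite W" "parter W w" "g \<in> eig W"
  shows "g w = 0"
proof -
  obtain f where w: "w \<in> W" and f: "f \<in> eig (W - {w})" "nsum W f w \<noteq> 0"
    using assms(2) unfolding parter_def by blast
  have fw: "f w = 0" using f eig_outside by blast
  \<comment> \<open>In \<open>W\<close> the function \<open>f\<close> satisfies the eigenvalue
    equation up to a defect at \<open>w\<close>. Pairing with \<open>g\<close> leaves the defect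
    times \<open>g w\<close>, which must therefore be zero.\<close>
  have "nsum W f v = lam * f v + (if v = w then nsum W f w else 0)" if "v \<in> W" for v
    using that fw eig_eq[OF f(1), of v] nsum_delete_zero[OF assms(1), of f w v] by (cases "v = w") auto
  then have "(\<Sum>v\<in>W. nsum W f v * g v)
      = (\<Sum>v\<in>W. lam * f v * g v + (if v = w then nsum W f w * g w else 0))"
    by (intro sum.cong refl) (auto simp: algebra_simps)
  also have "\<dots> = (\<Sum>v\<in>W. lam * f v * g v) + nsum W f w * g w"
    using w assms(1) by (simp add: sum.distrib)
  finally have "(\<Sum>v\<in>W. f v * nsum W g v) = (\<Sum>v\<in>W. lam * f v * g v) + nsum W f w * g w"
    using sum_nsum_swap[OF assms(1), of f g] by simp
  moreover have "(\<Sum>v\<in>W. f v * nsum W g v) = (\<Sum>v\<in>W. lam * f v * g v)"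
    by (intro sum.cong refl) (simp add: eig_eq[OF assms(3)])
  ultimately show ?thesis using f(2) by simp
qed

lemma parter_mult:
  assumes "finite W" "parter W w"
  shows "mult W + 1 \<le> mult (W - {w})"
proof -
  have w: "w \<in> W" using assms(2) unfolding parter_def by blast
  obtain f where f: "f \<in> eig (W - {w})" "nsum W f w \<noteq> 0"
    using assms(2) unfolding parter_def by blast
  obtain Z where Z: "Z \<subseteq> W - {w}" "determining (W - {w}) Z" "card Z = mult (W - {w})"
    using mult_ex by blast
  have fin: "finite (W - {w})" and finZ: "finite Z" using assms(1) Z(1) finite_subset by auto
  obtain b where b: "\<And>z. z \<in> Z \<Longrightarrow> b z \<in> eig (W - {w})"
    "\<And>z y. z \<in> Z \<Longrightarrow> y \<in> Z \<Longrightarrow> b z y = (if y = z then 1 else 0)"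
    "\<And>f. f \<in> eig (W - {w}) \<Longrightarrow> f = (\<lambda>v. \<Sum>z\<in>Z. f z * b z v)"
    using dual_basis[OF fin Z] by blast
  have "nsum W f w = nsum W (\<lambda>v. \<Sum>z\<in>Z. f z * b z v) w"
    by (rule arg_cong[OF b(3)[OF f(1)], of "\<lambda>h. nsum W h w"])
  also have "\<dots> = (\<Sum>z\<in>Z. f z * nsum W (b z) w)" by (rule nsum_sum)
  finally have sum_nz: "(\<Sum>z\<in>Z. f z * nsum W (b z) w) \<noteq> 0" using f(2) by metis
  have "\<exists>z\<in>Z. nsum W (b z) w \<noteq> 0"
  proof (rule ccontr)
    assume "\<not> (\<exists>z\<in>Z. nsum W (b z) w \<noteq> 0)"
    then have "(\<Sum>z\<in>Z. f z * nsum W (b z) w) = 0" by (intro sum.neutral) simp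
    then show False using sum_nz by blast
  qed
  then obtain z where z: "z \<in> Z" "nsum W (b z) w \<noteq> 0" by blast
  have "determining W (Z - {z})"
    unfolding determining_def
  proof (intro ballI impI)
    fix g assume g: "g \<in> eig W" and zero: "\<forall>y\<in>Z - {z}. g y = 0"
    have gw: "g w = 0" using parter_vanish[OF assms g] .
    then have g': "g \<in> eig (W - {w})" using eig_delete assms(1) g by blast
    have H: "(\<lambda>v. g v - g z * b z v) \<in> eig (W - {w})" using eig_diff[OF g' b(1)[OF z(1)]] .
    have "g y - g z * b z y = 0" if "y \<in> Z" for y
      using that b(2)[OF z(1) that] zero by auto
    then have "g v - g z * b z v = 0" for v
      using determiningD[OF Z(2) H, of v] by blast
    then have gb: "g v = g z * b z v" for v by (metis eq_iff_diff_eq_0)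
    then have "nsum W g w = (\<Sum>u\<in>nb W w. g z * b z u)"
      unfolding nsum_def by (intro sum.cong refl)
    then have "nsum W g w = g z * nsum W (b z) w"
      unfolding nsum_def by (simp only: sum_distrib_left)
    moreover have "nsum W g w = 0" using eig_delete_nsum[OF g w gw] .
    ultimately have "g z = 0" using z(2) by simp
    then show "g = (\<lambda>_. 0)" using gb by (metis mult_zero_left)
  qed
  then have "mult W \<le> card (Z - {z})" using mult_le finZ by blast
  then show ?thesis using Z(3) card_Suc_Diff1[OF finZ z(1)] by linarith
qed

text \<open>If a minimal determining set \<open>Z\<close> of \<open>W\<close> fails for
  \<open>W - {w}\<close>, it does so for some \<open>f\<close>. A point \<open>v\<close> with
  \<open>f v\<close> nonzero is enough to repair it: any other eigenvector vanishing on
  \<open>Z\<close> combines with \<open>f\<close> to one with neighbour sum zero at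
  \<open>w\<close>, which extends to \<open>W\<close>.\<close>

lemma mult_delete_le:
  assumes "finite W" "w \<in> W"
  shows "mult (W - {w}) \<le> mult W + 1"
proof -
  obtain Z where Z: "Z \<subseteq> W" "determining W Z" "card Z = mult W" using mult_ex by blast
  have finZ: "finite Z" using assms(1) Z(1) finite_subset by auto
  show ?thesis
  proof (cases "determining (W - {w}) Z")
    case True
    then show ?thesis using mult_le[OF finZ True] Z(3) by simp
  next
    case False
    then obtain f where f: "f \<in> eig (W - {w})" "\<forall>z\<in>Z. f z = 0" "f \<noteq> (\<lambda>_. 0)"
      unfolding determining_def by blast
    obtain v where v: "f v \<noteq> 0" using f(3) by (metis ext)
    have ns: "nsum W f w \<noteq> 0"
    proof
      assume "nsum W f w = 0"
      then have "f \<in> eig W" using eig_extend assms(1) f(1) by blast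
      then show False using Z(2) f unfolding determining_def by blast
    qed
    have "determining (W - {w}) (insert v Z)"
      unfolding determining_def
    proof (intro ballI impI)
      fix g assume g: "g \<in> eig (W - {w})" and zero: "\<forall>y\<in>insert v Z. g y = 0"
      let ?h = "\<lambda>u. nsum W f w * g u + (- nsum W g w) * f u"
      have "?h \<in> eig (W - {w})" using eig_lincomb[OF g f(1)] .
      moreover have "nsum W ?h w = 0" unfolding nsum_lincomb by simp
      ultimately have h: "?h \<in> eig W" using eig_extend[OF assms(1)] by blast
      have "?h y = 0" if "y \<in> Z" for y using that zero f(2) by simp
      then have h0: "?h u = 0" for u using determiningD[OF Z(2) h] by blast
      from h0[of v] have "nsum W g w = 0" using zero v by simp
      then show "g = (\<lambda>_. 0)" using h0 ns by (simp add: fun_eq_iff)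
    qed
    then have "mult (W - {w}) \<le> card (insert v Z)" using mult_le finZ by blast
    also have "\<dots> \<le> mult W + 1" using Z(3) finZ by (simp add: card_insert_if)
    finally show ?thesis .
  qed
qed

lemma nsum_union:
  assumes "separated A B" "v \<in> A"
  shows "nsum (A \<union> B) f v = nsum A f v"
proof -
  have "nb (A \<union> B) v = nb A v" using assms unfolding separated_def nb_def by blast
  then show ?thesis unfolding nsum_def by simp
qed

lemma eig_union_left:
  assumes "separated A B" "f \<in> eig (A \<union> B)"
  shows "(\<lambda>v. if v \<in> A then f v else 0) \<in> eig A"
proof (rule eigI)
  fix v assume v: "v \<in> A"
  have "nsum A (\<lambda>v. if v \<in> A then f v else 0) v = nsum A f v"
    unfolding nsum_def by (rule sum.cong) (auto simp: nb_def)
  then show "nsum A (\<lambda>v. if v \<in> A then f v else 0) v = lam * (if v \<in> A then f v else 0)"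
    using v nsum_union[OF assms(1) v, of f] eig_eq[OF assms(2), of v] by simp
qed simp

lemma eig_mono_left:
  assumes "separated A B" "f \<in> eig A"
  shows "f \<in> eig (A \<union> B)"
proof (rule eigI)
  fix v assume v: "v \<in> A \<union> B"
  show "nsum (A \<union> B) f v = lam * f v"
  proof (cases "v \<in> A")
    case True
    then show ?thesis using nsum_union[OF assms(1)] eig_eq[OF assms(2)] by simp
  next
    case False
    then have "nb (A \<union> B) v \<inter> A = {}" using v assms(1) adj_sym unfolding separated_def nb_def by blast
    then have "nsum (A \<union> B) f v = 0"
      unfolding nsum_def using eig_outside[OF assms(2)] by (intro sum.neutral) blast
    then show ?thesis using False eig_outside[OF assms(2)] by simp
  qed
qed (use assms eig_outside in blast)

lemma mult_union:
  assumes "finite A" "finite B" "separated A B"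
  shows "mult (A \<union> B) = mult A + mult B"
proof (rule antisym)
  obtain Y where Y: "Y \<subseteq> A" "determining A Y" "card Y = mult A" using mult_ex by blast
  obtain Z where Z: "Z \<subseteq> B" "determining B Z" "card Z = mult B" using mult_ex by blast
  have dj: "A \<inter> B = {}" using assms(3) unfolding separated_def by blast
  have "determining (A \<union> B) (Y \<union> Z)"
    unfolding determining_def
  proof (intro ballI impI)
    fix f assume f: "f \<in> eig (A \<union> B)" and zero: "\<forall>z\<in>Y \<union> Z. f z = 0"
    have "(if v \<in> A then f v else 0) = 0" for v
      using determiningD[OF Y(2) eig_union_left[OF assms(3) f]] zero by simp
    moreover have "f \<in> eig (B \<union> A)" using f by (simp add: Un_commute)
    then have "(if v \<in> B then f v else 0) = 0" for v
      using determiningD[OF Z(2) eig_union_left[OF separated_sym[OF assms(3)]]] zero by simp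
    ultimately show "f = (\<lambda>_. 0)" using eig_outside[OF f] by (metis UnE ext)
  qed
  then have "mult (A \<union> B) \<le> card (Y \<union> Z)"
    using mult_le Y(1) Z(1) assms finite_subset by (metis finite_Un)
  then show "mult (A \<union> B) \<le> mult A + mult B" using Y(3) Z(3) card_Un_le[of Y Z] by linarith
next
  obtain Z where Z: "Z \<subseteq> A \<union> B" "determining (A \<union> B) Z" "card Z = mult (A \<union> B)"
    using mult_ex by blast
  have fin: "finite Z" using Z(1) assms finite_subset by (metis finite_Un)
  have dj: "A \<inter> B = {}" using assms(3) unfolding separated_def by blast
  have "determining A (Z \<inter> A)"
    unfolding determining_def
  proof (intro ballI impI)
    fix f assume f: "f \<in> eig A" "\<forall>z\<in>Z \<inter> A. f z = 0"
    then have "\<forall>z\<in>Z. f z = 0" using eig_outside by blast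
    then show "f = (\<lambda>_. 0)"
      using eig_mono_left[OF assms(3) f(1)] Z(2) unfolding determining_def by blast
  qed
  then have 1: "mult A \<le> card (Z \<inter> A)" using mult_le fin by blast
  have "determining B (Z \<inter> B)"
    unfolding determining_def
  proof (intro ballI impI)
    fix f assume f: "f \<in> eig B" "\<forall>z\<in>Z \<inter> B. f z = 0"
    then have "\<forall>z\<in>Z. f z = 0" using eig_outside by blast
    moreover have "f \<in> eig (A \<union> B)"
      using eig_mono_left[OF separated_sym[OF assms(3)] f(1)] by (simp add: Un_commute)
    ultimately show "f = (\<lambda>_. 0)" using Z(2) unfolding determining_def by blast
  qed
  then have 2: "mult B \<le> card (Z \<inter> B)" using mult_le fin by blast
  have "card (Z \<inter> A) + card (Z \<inter> B) = card ((Z \<inter> A) \<union> (Z \<inter> B))"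
    using fin dj by (subst card_Un_disjoint) auto
  also have "(Z \<inter> A) \<union> (Z \<inter> B) = Z" using Z(1) by blast
  finally show "mult A + mult B \<le> mult (A \<union> B)" using 1 2 Z(3) by linarith
qed

lemma mult_sum:
  assumes "finite W"
  shows "int (mult W) = (\<Sum>K\<in>comps W. int (mult K))"
proof (rule additive_over_comps[where \<Phi> = "\<lambda>W. int (mult W)", OF assms])
  have "mult {} \<le> 0" using mult_le[OF _ determining_self, of "{}"] by simp
  then show "int (mult {}) = 0" by simp
next
  fix A B assume "finite A" "finite B" "separated A B"
  from mult_union[OF this] show "int (mult (A \<union> B)) = int (mult A) + int (mult B)" by simp
qed

text \<open>At a vertex without neighbours the equation reads \<open>0 = lam * f v\<close>, and
  \<open>lam\<close> is nonzero.\<close>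

lemma mult_no_edge:
  assumes "edg W = {}"
  shows "mult W = 0"
proof -
  have "determining W {}"
    unfolding determining_def
  proof (intro ballI impI ext)
    fix f v assume f: "f \<in> eig W"
    show "f v = 0"
    proof (cases "v \<in> W")
      case True
      have "nb W v = {}" using assms edg_iff[of v] True unfolding nb_def by blast
      then show ?thesis using eig_eq[OF f True] lam_nz by (simp add: nsum_def)
    qed (use f eig_outside in blast)
  qed
  then show ?thesis using mult_le[of "{}" W] by simp
qed

text \<open>Restricting an eigenvector that vanishes at \<open>u\<close> to the far side of a bridge \<open>u v\<close> gives an
  eigenvector of \<open>W - {u}\<close> whose neighbour sum at \<open>u\<close> is its value at \<open>v\<close>.\<close>

lemma bridge_forces_zero:
  assumes "finite W" "bridge W u v" "\<not> parter W u" "x \<in> eig W" "x u = 0"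
  shows "x v = 0"
proof -
  define K where "K = {y. (v, y) \<in> (avoid W u v)\<^sup>*}"
  have uv: "u \<in> W" "v \<in> W" "adj u v" using assms(2) unfolding bridge_def rel_iff by auto
  have uK: "u \<notin> K"
    using assms(2) sym_rtrancl[OF sym_avoid[of W u v]] unfolding K_def bridge_def by (blast dest: symD)
  have vK: "v \<in> K" unfolding K_def by simp
  have KW: "K \<subseteq> W"
  proof
    fix y assume "y \<in> K"
    then have "(v, y) \<in> (avoid W u v)\<^sup>*" unfolding K_def by simp
    then show "y \<in> W" by (induction rule: rtrancl_induct) (use uv in \<open>auto simp: avoid_def rel_iff\<close>)
  qed
  have step: "z \<in> K" if "y \<in> K" "z \<in> W" "adj y z" "{y, z} \<noteq> {u, v}" for y z
  proof -
    have "(y, z) \<in> avoid W u v" using that KW unfolding avoid_def rel_iff by blast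
    then show ?thesis using that(1) unfolding K_def by (auto intro: rtrancl_into_rtrancl)
  qed
  define f where "f = (\<lambda>y. if y \<in> K then x y else 0)"
  have f: "f \<in> eig (W - {u})"
  proof (rule eigI)
    fix y assume y: "y \<in> W - {u}"
    have fu: "f u = 0" using uK unfolding f_def by simp
    show "nsum (W - {u}) f y = lam * f y"
    proof (cases "y \<in> K")
      case True
      \<comment> \<open>The only edge leaving \<open>K\<close> is \<open>v u\<close>, and both
        \<open>f\<close> and \<open>x\<close> vanish at \<open>u\<close>; so truncating
        \<open>x\<close> does not change neighbour sums on \<open>K\<close>.\<close>
      have "f z = x z" if "z \<in> nb W y" for z
      proof (cases "z = u")
        case False
        then have "{y, z} \<noteq> {u, v}" using y by (auto simp: doubleton_eq_iff)
        then have "z \<in> K" using step[OF True] that unfolding nb_def by blast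
        then show ?thesis unfolding f_def by simp
      qed (use fu assms(5) in simp)
      then have "nsum W f y = nsum W x y" unfolding nsum_def by (intro sum.cong) auto
      then show ?thesis
        using nsum_delete_zero[of W f u y] fu assms(1) eig_eq[OF assms(4), of y] y True
        unfolding f_def by simp
    next
      case False
      have "f z = 0" if "z \<in> nb W y" for z
      proof -
        have "{z, y} \<noteq> {u, v}" using y False vK by (auto simp: doubleton_eq_iff)
        then have "z \<notin> K" using step[of z y] that False y adj_sym unfolding nb_def by blast
        then show ?thesis unfolding f_def by simp
      qed
      then have "nsum W f y = 0" unfolding nsum_def by (intro sum.neutral) auto
      then show ?thesis using nsum_delete_zero[of W f u y] fu assms(1) False unfolding f_def by simp
    qed
  qed (use KW uK in \<open>auto simp: f_def\<close>)
  have "nsum W f u = (\<Sum>z\<in>{v}. f z)"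
    unfolding nsum_def
  proof (rule sum.mono_neutral_right)
    show "\<forall>z\<in>nb W u - {v}. f z = 0"
    proof
      fix z assume z: "z \<in> nb W u - {v}"
      have "{z, u} \<noteq> {u, v}" using z by (auto simp: doubleton_eq_iff)
      then have "z \<notin> K" using step[of z u] z uK uv adj_sym unfolding nb_def by blast
      then show "f z = 0" unfolding f_def by simp
    qed
  qed (use uv assms(1) in \<open>auto simp: nb_def\<close>)
  then have "nsum W f u = x v" using vK unfolding f_def by simp
  then show ?thesis using f assms(3) uv unfolding parter_def by metis
qed

end

section \<open>Zero forcing along bridges and ears\<close>

context simple_adj
begin

text \<open>Zeros of eigenvectors propagate along the edges in \<open>F\<close>: if \<open>u\<close> and all but one of its
  \<open>F\<close>-neighbours are zeros, then so is the last one; and zeros cross the bridges of \<open>V\<close> (the latter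
  holds in the absence of Parter vertices only).\<close>

inductive_set forced :: "'a set \<Rightarrow> 'a set set \<Rightarrow> 'a set \<Rightarrow> 'a set" for V F Z where
  base: "z \<in> Z \<Longrightarrow> z \<in> forced V F Z"
| force: "u \<in> forced V F Z \<Longrightarrow> {u, v} \<in> F \<Longrightarrow>
    (\<And>x. {u, x} \<in> F \<Longrightarrow> x \<noteq> v \<Longrightarrow> x \<in> forced V F Z) \<Longrightarrow> v \<in> forced V F Z"
| bridge: "u \<in> forced V F Z \<Longrightarrow> {u, v} \<in> F \<Longrightarrow> bridge V u v \<Longrightarrow> v \<in> forced V F Z"

text \<open>A larger edge set also adds premises to \<open>force\<close>, so monotonicity in
  \<open>F\<close> is not automatic. The last hypothesis supplies exactly the new neighbours of
  forced vertices.\<close>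

lemma forced_extend:
  assumes "F \<subseteq> F'" "Z \<subseteq> forced V F' Z'"
    and "\<And>u x. u \<in> forced V F' Z' \<Longrightarrow> {u, x} \<in> F' \<Longrightarrow> {u, x} \<notin> F \<Longrightarrow> x \<in> forced V F' Z'"
  shows "forced V F Z \<subseteq> forced V F' Z'"
proof
  fix x assume "x \<in> forced V F Z"
  then show "x \<in> forced V F' Z'"
  proof (induction rule: forced.induct)
    case (base z)
    then show ?case using assms(2) by blast
  next
    case (force u v)
    show ?case
    proof (rule forced.force[OF force.IH(1)])
      show "{u, v} \<in> F'" using assms(1) force.hyps by blast
      show "x \<in> forced V F' Z'" if "{u, x} \<in> F'" "x \<noteq> v" for x
        using force.IH(2)[of x] assms(3)[OF force.IH(1)] that by blast
    qed
  next
    case (bridge u v)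
    then show ?case using assms(1) forced.bridge by blast
  qed
qed

lemma forced_mono: "Z \<subseteq> Z' \<Longrightarrow> forced V F Z \<subseteq> forced V F Z'"
  by (rule forced_extend) (auto intro: forced.base)

text \<open>The added edge affects \<open>force\<close> only at its two ends, and the bridge rule
  forces each end from the other.\<close>

lemma forced_add_bridge:
  assumes "W \<subseteq> forced V F Z" "u \<in> W" "bridge V u v" 
  shows "insert v W \<subseteq> forced V (insert {u, v} F) Z"
proof -
  let ?C = "forced V (insert {u, v} F) Z"
  have "{v, u} \<in> insert {u, v} F" by (simp add: insert_commute)
  then have uv: "u \<in> ?C \<longleftrightarrow> v \<in> ?C"
    using forced.bridge[OF _ _ assms(3)] forced.bridge[OF _ _ bridge_sym[OF assms(3)]] by blast
  have "forced V F Z \<subseteq> ?C"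
  proof (rule forced_extend)
    show "Z \<subseteq> ?C" by (auto intro: forced.base)
    fix y x assume "y \<in> ?C" "{y, x} \<in> insert {u, v} F" "{y, x} \<notin> F"
    then show "x \<in> ?C" using uv by (auto simp: doubleton_eq_iff)
  qed blast
  then show ?thesis using uv assms by blast
qed

text \<open>These are the edges of a path with inner vertices \<open>qs\<close>. The ends may
  coincide, so ears returning to their start and cycles are covered.\<close>

fun wedges :: "'a \<Rightarrow> 'a list \<Rightarrow> 'a \<Rightarrow> 'a set set" where
  "wedges u [] b = {{u, b}}"
| "wedges u (q # qs) b = insert {u, q} (wedges q qs b)"

lemma wedges_snoc: "wedges u (qs @ [q]) b = insert {q, b} (wedges u qs q)"
  by (induction qs arbitrary: u) auto

lemma wedges_rev: "wedges u qs b = wedges b (rev qs) u"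
  by (induction qs arbitrary: u) (auto simp: wedges_snoc insert_commute)

lemma wedges_subset: "e \<in> wedges u qs b \<Longrightarrow> e \<subseteq> insert u (insert b (set qs))"
  by (induction qs arbitrary: u) auto

lemma finite_wedges: "finite (wedges u qs b)"
  by (induction qs arbitrary: u) auto

lemma wedges_meet: "e \<in> wedges u (q # qs) b \<Longrightarrow> e \<inter> set (q # qs) \<noteq> {}"
  by (induction qs arbitrary: u q) auto

lemma wedges_suffix: "wedges x ys b \<subseteq> wedges u (xs @ x # ys) b"
  by (induction xs arbitrary: u) auto

lemma wedges_start:
  "{u, x} \<in> wedges u qs b \<Longrightarrow> u \<notin> set qs \<Longrightarrow> u \<noteq> b \<Longrightarrow> x = hd (qs @ [b])"
  by (cases qs) (auto simp: doubleton_eq_iff dest: wedges_subset)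

lemma card_wedges:
  "distinct (u # qs) \<Longrightarrow> b \<notin> set (u # qs) \<Longrightarrow> card (wedges u qs b) = length qs + 1"
proof (induction qs arbitrary: u)
  case (Cons q qs)
  have "{u, q} \<notin> wedges q qs b"
    using wedges_subset[of "{u, q}" q qs b] Cons.prems by auto
  then show ?case using Cons finite_wedges by simp
qed simp

text \<open>Inner vertices have no \<open>F\<close>-edges off the ear. Two consecutive zeros at its
  start therefore leave one unknown neighbour at a time, and the zeros run through to the other
  end.\<close>

lemma forced_ear:
  assumes "wedges u qs b \<subseteq> F" "u \<in> forced V F Z" "hd (qs @ [b]) \<in> forced V F Z"
    "distinct qs" "u \<notin> set qs" "b \<notin> set qs"
    "\<And>q x. q \<in> set qs \<Longrightarrow> {q, x} \<in> F \<Longrightarrow> {q, x} \<in> wedges u qs b"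
  shows "insert b (set qs) \<subseteq> forced V F Z"
  using assms
proof (induction qs arbitrary: u)
  case (Cons q qs)
  have q: "q \<in> forced V F Z" using Cons.prems(3) by simp
  have "hd (qs @ [b]) \<in> forced V F Z"
  proof (rule forced.force[OF q])
    show "{q, hd (qs @ [b])} \<in> F" using Cons.prems(1) by (cases qs) auto
    fix x assume x: "{q, x} \<in> F" "x \<noteq> hd (qs @ [b])"
    have "{q, x} \<in> wedges u (q # qs) b" using Cons.prems(7)[OF _ x(1)] by simp
    then have "{q, x} = {u, q} \<or> {q, x} \<in> wedges q qs b" by simp
    moreover have "{q, x} \<notin> wedges q qs b"
      using wedges_start x(2) Cons.prems by (metis distinct.simps(2) list.set_intros(1))
    ultimately show "x \<in> forced V F Z" using Cons.prems(2,5) by (auto simp: doubleton_eq_iff)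
  qed
  moreover have "{p, x} \<in> wedges q qs b" if "p \<in> set qs" "{p, x} \<in> F" for p x
  proof -
    have "{p, x} \<in> wedges u (q # qs) b" using Cons.prems(7)[OF _ that(2)] that(1) by simp
    then show ?thesis using that Cons.prems by (auto simp: doubleton_eq_iff)
  qed
  ultimately have "insert b (set qs) \<subseteq> forced V F Z"
    using Cons.prems q by (intro Cons.IH[of q]) auto
  then show ?case using q by simp
qed simp

text \<open>The extra zero \<open>hd (qs @ [b])\<close> is the neighbour of \<open>u\<close> on the
  ear, which is \<open>b\<close> itself if the ear is a single edge. Once the whole ear is forced,
  its edges no longer hinder the old forcing process.\<close>

lemma forced_add_ear_aux:
  assumes "F \<subseteq> Pow W" "W \<subseteq> forced V F Z" 
    "u \<in> W" "b \<in> W" "distinct qs" "set qs \<inter> W = {}"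
    "u \<in> forced V (F \<union> wedges u qs b) Z"
  shows "W \<union> set qs \<subseteq> forced V (F \<union> wedges u qs b) (insert (hd (qs @ [b])) Z)"
proof -
  let ?z = "hd (qs @ [b])" and ?F = "F \<union> wedges u qs b"
  let ?C = "forced V ?F (insert ?z Z)"
  have u: "u \<in> ?C" using assms(7) forced_mono[of Z "insert ?z Z"] by blast
  have "?z \<in> ?C" by (auto intro: forced.base)
  then have ear: "insert b (set qs) \<subseteq> ?C"
    using assms by (intro forced_ear[OF _ u]) blast+
  have "forced V F Z \<subseteq> ?C"
  proof (rule forced_extend)
    show "Z \<subseteq> ?C" by (auto intro: forced.base)
    fix y x assume "{y, x} \<in> ?F" "{y, x} \<notin> F"
    then have "x \<in> insert u (insert b (set qs))" using wedges_subset by blast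
    then show "x \<in> ?C" using u ear by blast
  qed blast
  then show ?thesis using assms(2) ear by blast
qed

text \<open>If neither end of the ear is forced in the larger graph, then the ear does not influence the
  forcing process, which therefore reaches both ends as before. Hence some end is forced, and it
  suffices to add its neighbour on the ear to the zeros.\<close>

lemma forced_add_ear:
  assumes "F \<subseteq> Pow W" "Z \<subseteq> W" "W \<subseteq> forced V F Z" 
    "u \<in> W" "b \<in> W" "distinct qs" "set qs \<inter> W = {}"
  shows "\<exists>z\<in>W \<union> set qs. W \<union> set qs \<subseteq> forced V (F \<union> wedges u qs b) (insert z Z)"
proof -
  let ?F = "F \<union> wedges u qs b"
  let ?S = "forced V ?F Z"
  have "u \<in> ?S \<or> b \<in> ?S"
  proof (rule ccontr)
    assume no: "\<not> (u \<in> ?S \<or> b \<in> ?S)"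
    \<comment> \<open>Only \<open>u\<close> and \<open>b\<close> connect \<open>W\<close> with the
      ear, and neither is forced; so no edge leads from a forced vertex off the ear into the
      ear.\<close>
    have edge: "y \<in> set qs \<or> x \<notin> set qs" if "{y, x} \<in> ?F" "y \<in> ?S" for x y
    proof -
      have "{y, x} \<subseteq> W \<or> {y, x} \<subseteq> insert u (insert b (set qs))"
        using that(1) assms(1) wedges_subset by blast
      then show ?thesis using no that(2) assms(7) by blast
    qed
    have dj: "x \<notin> set qs" if "x \<in> ?S" for x
      using that
    proof (induction rule: forced.induct)
      case (base z)
      then show ?case using assms(2,7) by blast
    next
      case (force y x)
      then show ?case using edge by blast
    next
      case (bridge y x)
      then show ?case using edge by blast
    qed
    have "forced V F Z \<subseteq> ?S"
    proof (rule forced_extend)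
      show "Z \<subseteq> ?S" by (auto intro: forced.base)
      fix y x assume y: "y \<in> ?S" "{y, x} \<in> ?F" "{y, x} \<notin> F"
      then have "y \<in> insert u (insert b (set qs))" using wedges_subset by blast
      then show "x \<in> ?S" using y(1) no dj by blast
    qed blast
    then show False using no assms(3,4) by blast
  qed
  then show ?thesis
  proof
    assume "u \<in> ?S"
    from forced_add_ear_aux[OF assms(1,3-7) this] 
    have "W \<union> set qs \<subseteq> forced V ?F (insert (hd (qs @ [b])) Z)" .
    moreover have "hd (qs @ [b]) \<in> W \<union> set qs" using assms(5) by (cases qs) auto
    ultimately show ?thesis by blast
  next
    assume "b \<in> ?S"
    then have "b \<in> forced V (F \<union> wedges b (rev qs) u) Z" by (simp add: wedges_rev[of u])
    from forced_add_ear_aux[OF assms(1,3,5,4) _ _ this] assms(6,7)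
    have "W \<union> set qs \<subseteq> forced V ?F (insert (hd (rev qs @ [u])) Z)"
      by (simp add: wedges_rev[of u])
    moreover have "hd (rev qs @ [u]) \<in> W \<union> set qs" using assms(4) by (cases qs rule: rev_cases) auto
    ultimately show ?thesis by blast
  qed
qed

text \<open>The ear is the walk up to its first vertex in \<open>W\<close>; where a vertex repeats,
  the loop is cut out by keeping only the part after its later occurrence.\<close>

lemma ear_exists:
  assumes "(x, u) \<in> (avoid V u v)\<^sup>*" "u \<in> W" "x \<in> V - W"
  shows "\<exists>qs b. b \<in> W \<and> distinct (x # qs) \<and> set (x # qs) \<subseteq> V - W \<and>
    wedges x qs b \<subseteq> edg V - {{u, v}}"
  using assms(1,3)
proof (induction rule: converse_rtrancl_induct)
  case base
  then show ?case using assms(2) by blast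
next
  case (step x y)
  have xy: "{x, y} \<in> edg V - {{u, v}}" "y \<in> V" "x \<noteq> y"
    using step.hyps(1) adj_neq unfolding avoid_def rel_iff by (auto simp: edg_iff)
  show ?case
  proof (cases "y \<in> W")
    case True
    then show ?thesis using xy step.prems by (intro exI[of _ "[]"] exI[of _ y]) auto
  next
    case False
    then obtain qs b where qs: "b \<in> W" "distinct (y # qs)" "set (y # qs) \<subseteq> V - W"
      "wedges y qs b \<subseteq> edg V - {{u, v}}"
      using step.IH xy by blast
    show ?thesis
    proof (cases "x \<in> set qs")
      case True
      then obtain as bs where "qs = as @ x # bs" by (meson split_list)
      then show ?thesis using qs wedges_suffix[of x bs b y as]
        by (intro exI[of _ bs] exI[of _ b]) auto
    next
      case False
      then show ?thesis using qs xy step.prems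
        by (intro exI[of _ "y # qs"] exI[of _ b]) auto
    qed
  qed
qed

text \<open>A bridge leaving \<open>W\<close> is added at no cost. Any other new edge starts an ear, which costs one
  zero and raises the edge excess by one.\<close>

theorem forcing_growth:
  assumes "finite V" "conn V" "W \<subseteq> V" "W \<noteq> {}" "F \<subseteq> edg W" "Z \<subseteq> W" "W \<subseteq> forced V F Z"
  shows "\<exists>Z'. Z \<subseteq> Z' \<and> Z' \<subseteq> V \<and> V \<subseteq> forced V (edg V) Z' \<and>
    int (card Z') - int (card Z) \<le>
      (int (card (edg V)) - int (card V)) - (int (card F) - int (card W))"
  using assms(3-7)
proof (induction "card (edg V - F)" arbitrary: W F Z rule: less_induct)
  case less
  note W = less.prems
  have fin: "finite W" "finite F" "finite Z" "finite (edg V)"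
    using W assms(1) finite_edg by (meson finite_subset)+
  have FV: "F \<subseteq> edg V" using W edg_mono by blast
  show ?case
  proof (cases "F = edg V")
    case True
    have "W = V"
    proof (rule ccontr)
      assume "W \<noteq> V"
      then obtain u v where "u \<in> W" "v \<in> V - W" "adj u v"
        using conn_boundary[OF assms(2) W(1,2)] by blast
      then have "{u, v} \<in> edg W" using W(1,3) True edg_iff by blast
      then show False using \<open>v \<in> V - W\<close> edg_iff by blast
    qed
    then show ?thesis using W True by (intro exI[of _ Z]) auto
  next
    case False
    have decr: "card (edg V - F') < card (edg V - F)" if "F \<subset> F'" "F' \<subseteq> edg V" for F'
      using that fin by (intro psubset_card_mono) auto
    show ?thesis
    proof (cases "W = V")
      case True
      obtain u v where uv: "{u, v} \<in> edg V" "{u, v} \<notin> F" "u \<in> V" "v \<in> V"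
        using FV False edgE by (metis psubsetI psubset_imp_ex_mem DiffD1 DiffD2)
      \<comment> \<open>With no vertex left to add, a missing edge is an ear with
        \<open>qs = []\<close>.\<close>
      obtain z where z: "z \<in> W" "W \<subseteq> forced V (insert {u, v} F) (insert z Z)"
        using forced_add_ear[of F W Z V u v "[]"] W subset_trans[OF W(3) edg_subset_Pow] uv True
        by auto
      have "\<exists>Z'. insert z Z \<subseteq> Z' \<and> Z' \<subseteq> V \<and> V \<subseteq> forced V (edg V) Z' \<and>
        int (card Z') - int (card (insert z Z)) \<le>
          (int (card (edg V)) - int (card V)) - (int (card (insert {u, v} F)) - int (card W))"
        using decr[of "insert {u, v} F"] uv W FV z True by (intro less.hyps) auto
      then obtain Z' where Z': "insert z Z \<subseteq> Z'" "Z' \<subseteq> V" "V \<subseteq> forced V (edg V) Z'"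
        "int (card Z') - int (card (insert z Z)) \<le>
          (int (card (edg V)) - int (card V)) - (int (card (insert {u, v} F)) - int (card W))"
        by blast
      have "card (insert z Z) \<le> card Z + 1" using fin by (simp add: card_insert_if)
      then show ?thesis using Z' uv fin by (intro exI[of _ Z']) auto
    next
      case False
      obtain u v where uv: "u \<in> W" "v \<in> V - W" "adj u v"
        using conn_boundary[OF assms(2) W(1,2) False] by blast
      have uvE: "{u, v} \<in> edg V" "{u, v} \<notin> F" using uv W edg_iff by blast+
      show ?thesis
      proof (cases "bridge V u v")
        case True
        let ?F = "insert {u, v} F" and ?W = "insert v W"
        have "\<exists>Z'. Z \<subseteq> Z' \<and> Z' \<subseteq> V \<and> V \<subseteq> forced V (edg V) Z' \<and>
          int (card Z') - int (card Z) \<le>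
            (int (card (edg V)) - int (card V)) - (int (card ?F) - int (card ?W))"
        proof (rule less.hyps)
          show "card (edg V - ?F) < card (edg V - F)" using decr[of ?F] uvE FV by auto
          show "?F \<subseteq> edg ?W" using W uv edg_mono[of W ?W] edg_iff[of u v ?W] by auto
          show "?W \<subseteq> forced V ?F Z" using forced_add_bridge[OF W(5) uv(1) True] .
        qed (use W uv in auto)
        then show ?thesis using uv uvE fin by auto
      next
        case False
        have "(u, v) \<in> (avoid V u v)\<^sup>*" using False uv W unfolding bridge_def rel_iff by blast
        then have "(v, u) \<in> (avoid V u v)\<^sup>*" using sym_rtrancl[OF sym_avoid] symD by metis
        then obtain qs b where qs: "b \<in> W" "distinct (v # qs)" "set (v # qs) \<subseteq> V - W"
          "wedges v qs b \<subseteq> edg V - {{u, v}}"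
          using ear_exists[OF _ uv(1,2)] by blast
        let ?P = "wedges u (v # qs) b"
        let ?F = "F \<union> ?P" and ?W = "W \<union> set (v # qs)"
        have "?F \<subseteq> edg V" using FV qs(4) uvE by auto
        moreover have PW: "e \<subseteq> ?W" if "e \<in> ?P" for e using wedges_subset[OF that] uv qs(1) by auto
        have "?P \<subseteq> edg ?W"
        proof
          fix e assume e: "e \<in> ?P"
          then have "e \<in> edg V" using qs(4) uvE by auto
          then obtain x y where "e = {x, y}" "adj x y" using edgE by metis
          then show "e \<in> edg ?W" using PW[OF e] edg_iff by blast
        qed
        then have FW: "?F \<subseteq> edg ?W" using W(3) edg_mono[of W ?W] by blast
        have dj: "F \<inter> ?P = {}"
        proof -
          have "e \<notin> F" if "e \<in> ?P" for e
          proof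
            assume "e \<in> F"
            then have "e \<subseteq> W" using W(3) edg_subset_Pow by blast
            then show False using wedges_meet[OF that] qs(3) by blast
          qed
          then show ?thesis by blast
        qed
        have "b \<notin> set (v # qs)" using qs(1,3) by blast
        then have "card ?P = length qs + 2"
          using card_wedges[OF qs(2)] qs(4) finite_wedges by (simp add: card_insert_if subset_Diff_insert)
        then have cF: "card ?F = card F + length qs + 2"
          using card_Un_disjoint[OF fin(2) finite_wedges dj] by linarith
        have "card ?W = card W + card (set (v # qs))"
          using fin qs(3) by (intro card_Un_disjoint) auto
        \<comment> \<open>The ear brings \<open>length qs + 1\<close> vertices but
          \<open>length qs + 2\<close> edges; the difference of one pays for
          \<open>z\<close>.\<close>
        then have cW: "card ?W = card W + length qs + 1" using distinct_card[OF qs(2)] by simp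
        obtain z where z: "z \<in> ?W" "?W \<subseteq> forced V ?F (insert z Z)"
          using forced_add_ear[of F W Z V u b "v # qs"] W edg_subset_Pow uv qs by blast
        have "\<exists>Z'. insert z Z \<subseteq> Z' \<and> Z' \<subseteq> V \<and> V \<subseteq> forced V (edg V) Z' \<and>
          int (card Z') - int (card (insert z Z)) \<le>
            (int (card (edg V)) - int (card V)) - (int (card ?F) - int (card ?W))"
        proof (rule less.hyps)
          have "{u, v} \<in> ?F" by simp
          then have "F \<subset> ?F" using uvE(2) by blast
          then show "card (edg V - ?F) < card (edg V - F)" using decr \<open>?F \<subseteq> edg V\<close> by blast
        qed (use W qs z FW in auto)
        then obtain Z' where Z': "insert z Z \<subseteq> Z'" "Z' \<subseteq> V" "V \<subseteq> forced V (edg V) Z'"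
          "int (card Z') - int (card (insert z Z)) \<le>
            (int (card (edg V)) - int (card V)) - (int (card ?F) - int (card ?W))"
          by blast
        have "card (insert z Z) \<le> card Z + 1" using fin by (simp add: card_insert_if)
        then show ?thesis using Z' cF cW by (intro exI[of _ Z']) auto
      qed
    qed
  qed
qed

text \<open>With all of \<open>W\<close> as zeros there is nothing to force at the start, and
  \<open>forcing_growth\<close> only enlarges the zero set. What remains of its bound is
  monotonicity of edges minus vertices.\<close>

corollary subgraph_edge_excess:
  assumes "finite V" "conn V" "W \<subseteq> V" "W \<noteq> {}" "F \<subseteq> edg W"
  shows "int (card F) - int (card W) \<le> int (card (edg V)) - int (card V)"
proof -
  have "W \<subseteq> forced V F W" by (auto intro: forced.base)
  then obtain Z where "W \<subseteq> Z" "Z \<subseteq> V" "int (card Z) - int (card W) \<le>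
      (int (card (edg V)) - int (card V)) - (int (card F) - int (card W))"
    using forcing_growth[OF assms subset_refl] by blast
  moreover have "card W \<le> card Z"
    using \<open>W \<subseteq> Z\<close> \<open>Z \<subseteq> V\<close> assms(1) by (meson card_mono finite_subset)
  ultimately show ?thesis by linarith
qed

end

context spectral_adj
begin

text \<open>Soundness of the rules: \<open>force\<close> is the eigenvalue equation at
  \<open>u\<close> with one unknown term, and \<open>bridge\<close> is
  \<open>bridge_forces_zero\<close>.\<close>

lemma forced_zero:
  assumes "finite V" "\<And>w. \<not> parter V w" "f \<in> eig V" "\<And>z. z \<in> Z \<Longrightarrow> f z = 0"
    and "v \<in> forced V (edg V) Z"
  shows "f v = 0"
  using assms(5)
proof (induction rule: forced.induct)
  case (base z)
  then show ?case using assms(4) by blast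
next
  case (force u v)
  have uv: "u \<in> V" "v \<in> nb V u" using force.hyps edg_iff[of u v V] unfolding nb_def by auto
  have "nsum V f u = (\<Sum>x\<in>{v}. f x)"
    unfolding nsum_def
  proof (rule sum.mono_neutral_right)
    show "\<forall>x\<in>nb V u - {v}. f x = 0"
    proof
      fix x assume "x \<in> nb V u - {v}"
      then show "f x = 0" using force.IH(2)[of x] uv(1) by (simp add: nb_def edg_iff)
    qed
  qed (use uv assms(1) in auto)
  then show ?case using eig_eq[OF assms(3) uv(1)] force.IH(1) by simp
next
  case (bridge u v)
  then show ?case using bridge_forces_zero[OF assms(1) _ assms(2,3)] by blast
qed

text \<open>Zeros beyond \<open>Z\<close> are paid for by the edge excess gained after the start. A
  start forced by few zeros in relation to its own excess improves on \<open>mult_le_cyc\<close>,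
  whose start is a single vertex.\<close>

theorem mult_le_forcing:
  assumes "finite V" "conn V" "\<And>w. \<not> parter V w"
    "W \<subseteq> V" "W \<noteq> {}" "F \<subseteq> edg W" "Z \<subseteq> W" "W \<subseteq> forced V F Z"
  shows "int (mult V) \<le> int (card Z) + cyc V - 1 - (int (card F) - int (card W))"
proof -
  obtain Z' where Z': "Z' \<subseteq> V" "V \<subseteq> forced V (edg V) Z'"
    "int (card Z') - int (card Z) \<le>
      (int (card (edg V)) - int (card V)) - (int (card F) - int (card W))"
    using forcing_growth[OF assms(1,2,4-8)] by blast
  have "determining V Z'"
    unfolding determining_def
  proof (intro ballI impI ext)
    fix f v assume f: "f \<in> eig V" "\<forall>z\<in>Z'. f z = 0"
    show "f v = 0"
      using forced_zero[OF assms(1,3) f(1), of Z' v] f Z'(2) eig_outside by blast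
  qed
  then have "mult V \<le> card Z'" using mult_le finite_subset[OF Z'(1) assms(1)] by blast
  then show ?thesis using Z'(3) conn_cyc[OF assms(2)] by linarith
qed

corollary mult_le_cyc:
  assumes "finite V" "conn V" "\<And>w. \<not> parter V w"
  shows "int (mult V) \<le> cyc V + 1"
proof -
  obtain v where v: "v \<in> V" using assms(2) unfolding conn_def by blast
  show ?thesis
    using mult_le_forcing[OF assms, of "{v}" "{}" "{v}"] v by (auto intro: forced.base)
qed

theorem mult_le_imn_cyc:
  assumes "finite V"
  shows "int (mult V) \<le> int (imn V) + cyc V"
  using assms
proof (induction "card V" arbitrary: V rule: less_induct)
  case less
  have connected_case: "int (mult K) \<le> int (imn K) + cyc K" if K: "conn K" "K \<subseteq> V" for K
  proof (cases "edg K = {}")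
    case True
    have fK: "finite K" using K less.prems finite_subset by blast
    obtain v where "v \<in> K" using K(1) unfolding conn_def by blast
    \<comment> \<open>Comparison with a single vertex shows that \<open>cyc K\<close> is
      nonnegative.\<close>
    then have "int (card {}) - int (card {v}) \<le> int (card (edg K)) - int (card K)"
      using subgraph_edge_excess[OF fK K(1), of "{v}" "{}"] by simp
    then show ?thesis using conn_cyc[OF K(1)] mult_no_edge[OF True] by simp
  next
    case False
    have fK: "finite K" using K less.prems finite_subset by blast
    have imn: "1 \<le> imn K" using False imn_pos[OF fK] by (metis edgE ex_in_conv)
    show ?thesis
    proof (cases "\<exists>w. parter K w")
      case True
      then obtain w where w: "parter K w" "w \<in> K" unfolding parter_def by blast
      have "card (K - {w}) < card V"
        using w(2) K(2) less.prems fK by (metis card_Diff1_less card_mono order_less_le_trans)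
      then have "int (mult (K - {w})) \<le> int (imn (K - {w})) + cyc (K - {w})"
        using less.hyps fK by blast
      then show ?thesis
        using parter_mult[OF fK w(1)] cyc_delete_le[OF fK K(1) w(2)] imn_mono[OF fK, of "K - {w}"]
        by fastforce
    next
      case False
      then show ?thesis using mult_le_cyc[OF fK K(1)] imn by fastforce
    qed
  qed
  have "int (mult V) \<le> (\<Sum>K\<in>comps V. int (imn K) + cyc K)"
    unfolding mult_sum[OF less.prems]
    by (rule sum_mono) (use connected_case comps_conn comps_subset in blast)
  then show ?case using imn_sum[OF less.prems] cyc_sum[OF less.prems] by (simp add: sum.distrib)
qed

end

section \<open>Graphs attaining the bound\<close>

context simple_adj
begin

text \<open>On a shortest walk \<open>x, a, b, c, d, ...\<close> an adjacency between
  \<open>{x, a}\<close> and \<open>{c, d}\<close> would be a shortcut, so \<open>x a\<close> and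
  \<open>c d\<close> form an induced matching. The relation \<open>R\<close> may lack the edge
  \<open>x y\<close>; length at least five then keeps \<open>y\<close> away from \<open>c\<close>
  and \<open>d\<close>.\<close>

lemma shortest_walk_imn:
  assumes "finite K" "R \<subseteq> rel K" "(x, y) \<in> R ^^ n" "\<And>k. k < n \<Longrightarrow> (x, y) \<notin> R ^^ k" "4 \<le> n"
    and chord: "\<And>a b. a \<in> K \<Longrightarrow> b \<in> K \<Longrightarrow> adj a b \<Longrightarrow> (a, b) \<in> R \<or> 5 \<le> n \<and> {a, b} = {x, y}"
  shows "2 \<le> imn K"
proof -
  obtain j where n: "n = Suc (Suc (Suc (Suc j)))"
    using assms(5) le_Suc_ex[of 4 n] by (auto simp: numeral_eq_Suc)
  obtain a b c d where w: "(x, a) \<in> R" "(a, b) \<in> R" "(b, c) \<in> R" "(c, d) \<in> R" "(d, y) \<in> R ^^ j"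
    using assms(3) unfolding n by (meson relpow_Suc_E2)
  have "(x, a) \<in> rel K" "(c, d) \<in> rel K" using w assms(2) by blast+
  then have K: "{x, a, c, d} \<subseteq> K" "adj x a" "adj c d" by (auto simp: rel_iff)
  have cy: "(c, y) \<in> R ^^ Suc j" using w relpow_Suc_I2 by metis
  have xc: "(x, c) \<notin> R ^^ k" if "k < 3" for k
  proof
    assume "(x, c) \<in> R ^^ k"
    then have "(x, y) \<in> R ^^ (k + Suc j)" using cy by (metis relcomp.relcompI relpow_add)
    then show False using assms(4)[of "k + Suc j"] that n by simp
  qed
  have xd: "(x, d) \<notin> R ^^ k" if "k < 4" for k
  proof
    assume "(x, d) \<in> R ^^ k"
    then have "(x, y) \<in> R ^^ (k + j)" using w by (metis relcomp.relcompI relpow_add)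
    then show False using assms(4)[of "k + j"] that n by simp
  qed
  have R2: "(x, z) \<in> R ^^ 2" if "(a, z) \<in> R" for z
    using w that by (auto simp: numeral_2_eq_2)
  have ne: "x \<noteq> c" "a \<noteq> c" "x \<noteq> d" "a \<noteq> d"
    using xc[of 0] xc[of 1] xd[of 0] xd[of 1] w(1) by auto
  have nR: "(x, c) \<notin> R" "(a, c) \<notin> R" "(x, d) \<notin> R" "(a, d) \<notin> R"
    using xc[of 1] xd[of 1] xc[of 2] xd[of 2] R2 by auto
  have y: "y \<noteq> x" "y \<noteq> a" using assms(4)[of 0] assms(4)[of 1] w(1) n by auto
  have yc: "y \<noteq> c"
  proof
    assume "y = c"
    have "(x, c) \<in> R ^^ 3" using w by (auto simp: numeral_3_eq_3)
    then show False using assms(4)[of 3] n \<open>y = c\<close> by simp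
  qed
  have yd: "y \<noteq> d" if "5 \<le> n"
  proof
    assume "y = d"
    have "(x, d) \<in> R ^^ Suc (Suc (Suc (Suc 0)))" using w by auto
    then show False using assms(4)[of "Suc (Suc (Suc (Suc 0)))"] n \<open>y = d\<close> that by simp
  qed
  have no: "\<not> adj p q" if "p \<in> {x, a}" "q \<in> {c, d}" for p q
  proof
    assume "adj p q"
    then have "(p, q) \<in> R \<or> 5 \<le> n \<and> {p, q} = {x, y}" using chord that K by blast
    then show False using that nR ne y yc yd by (auto simp: doubleton_eq_iff)
  qed
  show ?thesis using imn_two[OF assms(1) K] ne no by blast
qed

lemma imn_one_diameter:
  assumes "finite K" "conn K" "imn K < 2" "x \<in> K" "y \<in> K"
  shows "\<exists>n\<le>3. (x, y) \<in> rel K ^^ n"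
proof -
  have "(x, y) \<in> (rel K)\<^sup>*" using assms unfolding conn_def by blast
  then have ex: "\<exists>n. (x, y) \<in> rel K ^^ n" by (simp add: rtrancl_power)
  define n where "n = (LEAST n. (x, y) \<in> rel K ^^ n)"
  have n: "(x, y) \<in> rel K ^^ n" unfolding n_def by (rule LeastI_ex[OF ex])
  have min: "(x, y) \<notin> rel K ^^ k" if "k < n" for k using that not_less_Least unfolding n_def by blast
  have "n \<le> 3"
  proof (rule ccontr)
    assume "\<not> n \<le> 3"
    then have "2 \<le> imn K"
      using shortest_walk_imn[OF assms(1) subset_refl n min] by (simp add: rel_iff)
    then show False using assms(3) by simp
  qed
  then show ?thesis using n by blast
qed

text \<open>Each vertex other than \<open>r\<close> picks a neighbour closer to \<open>r\<close>. If
  \<open>cyc V\<close> is positive, these fewer than \<open>card V\<close> edges miss some edge of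
  \<open>V\<close>; as they already lead every vertex to \<open>r\<close>, the missed edge is no
  bridge.\<close>

lemma cyclic_nonbridge:
  assumes "finite V" "conn V" "1 \<le> cyc V"
  obtains u v where "u \<in> V" "v \<in> V" "adj u v" "\<not> bridge V u v"
proof -
  obtain r where r: "r \<in> V" using assms(2) unfolding conn_def by blast
  define d where "d v = (LEAST n. (v, r) \<in> rel V ^^ n)" for v
  have "\<exists>u. u \<in> V \<and> adj v u \<and> d u < d v" if v: "v \<in> V - {r}" for v
  proof -
    have "(v, r) \<in> (rel V)\<^sup>*" using assms(2) v r unfolding conn_def by blast
    then have "\<exists>n. (v, r) \<in> rel V ^^ n" by (simp add: rtrancl_power)
    then have dv: "(v, r) \<in> rel V ^^ d v" unfolding d_def by (rule LeastI_ex)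
    have "d v \<noteq> 0" using dv v by (metis DiffE insertI1 relpow_0_E)
    then obtain k where k: "d v = Suc k" using not0_implies_Suc by blast
    then obtain u where u: "(v, u) \<in> rel V" "(u, r) \<in> rel V ^^ k"
      using dv by (metis relpow_Suc_E2)
    have "d u \<le> k" unfolding d_def by (rule Least_le) (rule u(2))
    then show ?thesis using u(1) k rel_iff by auto
  qed
  then obtain par where par: "\<And>v. v \<in> V - {r} \<Longrightarrow> par v \<in> V \<and> adj v (par v) \<and> d (par v) < d v"
    by metis
  let ?F = "(\<lambda>v. {v, par v}) ` (V - {r})"
  have "card ?F < card V"
    using card_image_le[of "V - {r}" "\<lambda>v. {v, par v}"] assms(1) r card_Diff1_less[OF assms(1) r] by simp
  then have "card ?F < card (edg V)" using assms(3) conn_cyc[OF assms(2)] by linarith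
  then have "\<not> edg V \<subseteq> ?F" using card_mono[of ?F "edg V"] assms(1) by auto
  then obtain e where e: "e \<in> edg V" "e \<notin> ?F" by blast
  obtain x y where xy: "e = {x, y}" "x \<in> V" "y \<in> V" "adj x y" using e(1) by (rule edgE)
  have reach: "(v, r) \<in> (avoid V x y)\<^sup>*" if "v \<in> V" for v
    using that
  proof (induction "d v" arbitrary: v rule: less_induct)
    case less
    show ?case
    proof (cases "v = r")
      case False
      then have p: "par v \<in> V" "adj v (par v)" "d (par v) < d v" using par less.prems by auto
      have "{v, par v} \<noteq> {x, y}" using e(2) xy(1) False less.prems by blast
      then have "(v, par v) \<in> avoid V x y" using p less.prems unfolding avoid_def rel_iff by simp
      then show ?thesis using less.hyps[OF p(3,1)] by (rule converse_rtrancl_into_rtrancl)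
    qed simp
  qed
  have "(r, y) \<in> (avoid V x y)\<^sup>*"
    using reach[OF xy(3)] sym_rtrancl[OF sym_avoid] by (metis symD)
  then have "(x, y) \<in> (avoid V x y)\<^sup>*" using reach[OF xy(2)] by (meson rtrancl_trans)
  then have "\<not> bridge V x y" unfolding bridge_def by blast
  then show ?thesis using that xy by blast
qed

text \<open>A shortest detour around a non-bridge closes to a cycle. A detour of length five or more
  contradicts \<open>shortest_walk_imn\<close>, so its length is two, three or four.\<close>

lemma short_cycle:
  assumes "finite K" "conn K" "1 \<le> cyc K" "imn K < 2"
  obtains (three) a b c where "{a, b, c} \<subseteq> K" "adj a b" "adj b c" "adj c a"
  | (four) a b c d where "{a, b, c, d} \<subseteq> K" "adj a b" "adj b c" "adj c d" "adj d a" "a \<noteq> c" "b \<noteq> d"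
  | (five) a b c d e where "{a, b, c, d, e} \<subseteq> K" "adj a b" "adj b c" "adj c d" "adj d e" "adj e a"
      "distinct [a, b, c, d, e]"
proof -
  obtain u v where uv: "u \<in> K" "v \<in> K" "adj u v" "\<not> bridge K u v"
    using cyclic_nonbridge[OF assms(1-3)] by blast
  let ?R = "avoid K u v"
  have "(u, v) \<in> ?R\<^sup>*" using uv unfolding bridge_def rel_iff by blast
  then have ex: "\<exists>n. (u, v) \<in> ?R ^^ n" by (simp add: rtrancl_power)
  define n where "n = (LEAST n. (u, v) \<in> ?R ^^ n)"
  have n: "(u, v) \<in> ?R ^^ n" unfolding n_def by (rule LeastI_ex[OF ex])
  have min: "(u, v) \<notin> ?R ^^ k" if "k < n" for k using that not_less_Least unfolding n_def by blast
  have RK: "?R \<subseteq> rel K" unfolding avoid_def by blast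
  have "n < 5"
  proof (rule ccontr)
    assume "\<not> n < 5"
    then have "2 \<le> imn K"
      using shortest_walk_imn[OF assms(1) RK n min] unfolding avoid_def rel_iff by auto
    then show False using assms(4) by simp
  qed
  moreover have "n \<noteq> 0" using n uv adj_neq by (metis relpow_0_E)
  moreover have "n \<noteq> 1" using n by (auto simp: avoid_def)
  ultimately consider "n = 2" | "n = 3" | "n = 4" by linarith
  then show ?thesis
  proof cases
    case 1
    then obtain p where "(u, p) \<in> ?R" "(p, v) \<in> ?R" using n by (auto simp: numeral_2_eq_2)
    then show ?thesis using three[of u p v] uv adj_sym unfolding avoid_def rel_iff by blast
  next
    case 2
    then obtain p q where pq: "(u, p) \<in> ?R" "(p, q) \<in> ?R" "(q, v) \<in> ?R"
      using n by (auto simp: numeral_3_eq_3)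
    have "u \<noteq> q" using pq(3) unfolding avoid_def by auto
    moreover have "p \<noteq> v" using pq(1) unfolding avoid_def by auto
    ultimately show ?thesis using four[of u p q v] pq uv adj_sym unfolding avoid_def rel_iff by blast
  next
    case 3
    then have "n = Suc (Suc (Suc (Suc 0)))" by simp
    then obtain p q r where pq: "(u, p) \<in> ?R" "(p, q) \<in> ?R" "(q, r) \<in> ?R" "(r, v) \<in> ?R"
      using n by auto
    have R1: "(u, v) \<notin> ?R" using min[of 1] 3 by simp
    have R2: "\<not> ((u, z) \<in> ?R \<and> (z, v) \<in> ?R)" for z using min[of 2] 3 by (auto simp: numeral_2_eq_2)
    have "u \<noteq> q" "u \<noteq> r" "p \<noteq> r" "p \<noteq> v" "q \<noteq> v" using R1 R2 pq by blast+
    moreover have "adj u p" "adj p q" "adj q r" "adj r v" "{u, p, q, r, v} \<subseteq> K"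
      using pq uv unfolding avoid_def rel_iff by auto
    ultimately show ?thesis using five[of u p q r v] uv adj_sym adj_neq by auto
  qed
qed

lemma conn_cyc_nonneg:
  assumes "finite V" "conn V"
  shows "0 \<le> cyc V"
proof -
  obtain v where "v \<in> V" using assms(2) unfolding conn_def by blast
  then have "int (card {}) - int (card {v}) \<le> int (card (edg V)) - int (card V)"
    using subgraph_edge_excess[OF assms, of "{v}" "{}"] by simp
  then show ?thesis using conn_cyc[OF assms(2)] by simp
qed

end

context spectral_adj
begin

text \<open>The number of pendants is prescribed through \<open>lam\<close>, hence is the same for
  every such component.\<close>

definition pendant_triangle :: "'a set \<Rightarrow> (nat \<Rightarrow> 'a) \<Rightarrow> bool" where
  "pendant_triangle K t \<longleftrightarrow> t ` {..<3} \<subseteq> K \<and> inj_on t {..<3} \<and>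
     (\<forall>i<3. \<forall>j<3. i \<noteq> j \<longrightarrow> adj (t i) (t j)) \<and>
     (\<forall>z\<in>K - t ` {..<3}. \<exists>i<3. nb K z = {t i}) \<and>
     (\<forall>i<3. of_nat (card (nb K (t i) - t ` {..<3})) = lam\<^sup>2 + lam)"

text \<open>The index \<open>(i + 4) mod 5\<close> is the predecessor of \<open>i\<close>, free of
  natural-number subtraction.\<close>

definition five_cycle :: "'a set \<Rightarrow> 'a list \<Rightarrow> bool" where
  "five_cycle K vs \<longleftrightarrow> length vs = 5 \<and> distinct vs \<and> set vs = K \<and>
     (\<forall>i<5. nb K (vs ! i) = {vs ! ((i + 1) mod 5), vs ! ((i + 4) mod 5)})"

end

text \<open>This is what is known of a component of \<open>G - w\<close> with a cycle when
  \<open>G\<close> is extremal. In particular its multiplicity is at least two.\<close>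

locale tight = spectral_adj +
  fixes K :: "'a set"
  assumes fin: "finite K" and con: "conn K" and noparter: "\<not> parter K w"
    and mult_cyc: "int (mult K) = cyc K + 1" and imn_lt: "imn K < 2" and cyclic: "1 \<le> cyc K"
begin

lemma two_edges_meet:
  "a \<in> K \<Longrightarrow> b \<in> K \<Longrightarrow> c \<in> K \<Longrightarrow> d \<in> K \<Longrightarrow> adj a b \<Longrightarrow> adj c d \<Longrightarrow>
    a = c \<or> a = d \<or> b = c \<or> b = d \<or> adj a c \<or> adj a d \<or> adj b c \<or> adj b d"
  using imn_two[of K a b c d] fin imn_lt by auto

text \<open>A cycle with a chord is forced by two zeros, one fewer than the general bound allows.\<close>

lemma no_chorded_cycle:
  assumes "W \<subseteq> K" "F \<subseteq> edg W" "{x, y} \<subseteq> W" "W \<subseteq> forced K F {x, y}" "card W < card F"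
  shows False
proof -
  have "card {x, y} \<le> 2" by (simp add: card_insert_if)
  then show False
    using mult_le_forcing[OF fin con noparter assms(1) _ assms(2,3,4)] assms(3,5) mult_cyc by fastforce
qed

text \<open>Multiplicity at least two means that no single zero determines an eigenvector, so one
  zero can be prescribed anywhere.\<close>

lemma nonzero_vanishing:
  obtains f where "f \<in> eig K" "f x = 0" "f \<noteq> (\<lambda>_. 0)"
proof -
  have "\<not> determining K {x}" using mult_le[of "{x}" K] mult_cyc cyclic by auto
  then show ?thesis using that unfolding determining_def by blast
qed

text \<open>Here and in the next two lemmas the zeros are a vertex of degree two in \<open>F\<close>
  and a neighbour of it; they run around the cycles. Adjacencies that are not listed in
  \<open>F\<close> do no harm.\<close>

lemma no_K4_minus_edge:
  assumes "distinct [a, b, x, y]" "{a, b, x, y} \<subseteq> K" "adj a b" "adj a x" "adj b x" "adj a y" "adj b y"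
  shows False
proof (rule no_chorded_cycle[of "{a, b, x, y}" "{{a, b}, {a, x}, {b, x}, {a, y}, {b, y}}" x a])
  let ?F = "{{a, b}, {a, x}, {b, x}, {a, y}, {b, y}}"
  let ?S = "forced K ?F {x, a}"
  have xa: "x \<in> ?S" "a \<in> ?S" by (auto intro: forced.base)
  have b: "b \<in> ?S" by (rule forced.force[of x]) (use assms xa in \<open>auto simp: doubleton_eq_iff\<close>)
  have "y \<in> ?S" by (rule forced.force[of a]) (use assms xa b in \<open>auto simp: doubleton_eq_iff\<close>)
  then show "{a, b, x, y} \<subseteq> ?S" using xa b by blast
qed (use assms adj_sym in \<open>auto simp: edg_iff doubleton_eq_iff\<close>)

lemma no_house:
  assumes "distinct [a, b, x, y, z]" "{a, b, x, y, z} \<subseteq> K"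
    "adj a b" "adj a x" "adj b x" "adj a y" "adj y z" "adj z b"
  shows False
proof (rule no_chorded_cycle[of "{a, b, x, y, z}" "{{a, b}, {a, x}, {b, x}, {a, y}, {y, z}, {z, b}}" x a])
  let ?F = "{{a, b}, {a, x}, {b, x}, {a, y}, {y, z}, {z, b}}"
  let ?S = "forced K ?F {x, a}"
  have xa: "x \<in> ?S" "a \<in> ?S" by (auto intro: forced.base)
  have b: "b \<in> ?S" by (rule forced.force[of x]) (use assms xa in \<open>auto simp: doubleton_eq_iff\<close>)
  have y: "y \<in> ?S" by (rule forced.force[of a]) (use assms xa b in \<open>auto simp: doubleton_eq_iff\<close>)
  have "z \<in> ?S" by (rule forced.force[of y]) (use assms xa b y in \<open>auto simp: doubleton_eq_iff\<close>)
  then show "{a, b, x, y, z} \<subseteq> ?S" using xa b y by blast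
qed (use assms adj_sym in \<open>auto simp: edg_iff doubleton_eq_iff\<close>)

lemma no_chorded_hexagon:
  assumes "distinct [a, b, p, q, y, z]" "{a, b, p, q, y, z} \<subseteq> K"
    "adj a b" "adj a p" "adj p q" "adj q b" "adj a y" "adj y z" "adj z b"
  shows False
proof (rule no_chorded_cycle[of "{a, b, p, q, y, z}"
      "{{a, b}, {a, p}, {p, q}, {q, b}, {a, y}, {y, z}, {z, b}}" p a])
  let ?F = "{{a, b}, {a, p}, {p, q}, {q, b}, {a, y}, {y, z}, {z, b}}"
  let ?S = "forced K ?F {p, a}"
  have xa: "p \<in> ?S" "a \<in> ?S" by (auto intro: forced.base)
  have q: "q \<in> ?S" by (rule forced.force[of p]) (use assms xa in \<open>auto simp: doubleton_eq_iff\<close>)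
  have b: "b \<in> ?S" by (rule forced.force[of q]) (use assms xa q in \<open>auto simp: doubleton_eq_iff\<close>)
  have y: "y \<in> ?S" by (rule forced.force[of a]) (use assms xa b in \<open>auto simp: doubleton_eq_iff\<close>)
  have "z \<in> ?S" by (rule forced.force[of y]) (use assms xa b y in \<open>auto simp: doubleton_eq_iff\<close>)
  then show "{a, b, p, q, y, z} \<subseteq> ?S" using xa b y q by blast
qed (use assms adj_sym in \<open>auto simp: edg_iff doubleton_eq_iff\<close>)

end

section \<open>Components with a triangle or a five-cycle\<close>

context tight
begin

lemma third_index:
  assumes "i < (3::nat)" "j < 3" "i \<noteq> j"
  obtains k where "k < 3" "k \<noteq> i" "k \<noteq> j" "{..<3} = {i, j, k}"
proof -
  have "{..<3} = {i, j, 3 - i - j}" "3 - i - j < 3" "3 - i - j \<noteq> i" "3 - i - j \<noteq> j"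
    using assms by (auto simp: numeral_3_eq_3 less_Suc_eq)
  then show ?thesis using that by blast
qed

lemma other_index: obtains j where "j < (3::nat)" "j \<noteq> i"
  by (cases "i = 0") (use that[of 0] that[of 1] in auto)

lemma determining_le:
  assumes "finite Z" "\<And>f v. f \<in> eig K \<Longrightarrow> (\<And>z. z \<in> Z \<Longrightarrow> f z = 0) \<Longrightarrow> v \<in> K \<Longrightarrow> f v = 0"
  shows "mult K \<le> card Z"
proof (rule mult_le[OF assms(1)])
  show "determining K Z"
    unfolding determining_def
  proof (intro ballI impI ext)
    fix f v assume "f \<in> eig K" "\<forall>z\<in>Z. f z = 0"
    then show "f v = 0" using assms(2)[of f v] eig_outside[of f K v] by blast
  qed
qed

text \<open>Without chorded cycles and induced pairs of edges every further vertex is pendant at one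
  corner. The eigenvalue equations then reduce to the three corners, where two zeros
  suffice.\<close>

lemma triangle_case:
  assumes tri: "{a, b, c} \<subseteq> K" "adj a b" "adj b c" "adj c a"
  shows "mult K = 2 \<and> (\<exists>t. pendant_triangle K t)"
proof -
  define t where "t = (!) [a, b, c]"
  define T where "T = t ` {..<3}"
  have adjt: "adj (t i) (t j)" if "i < 3" "j < 3" "i \<noteq> j" for i j
    using that tri adj_sym unfolding t_def by (auto simp: numeral_3_eq_3 less_Suc_eq)
  have tK: "t i \<in> K" "t i \<in> T" if "i < 3" for i
    using that tri unfolding t_def T_def by (auto simp: numeral_3_eq_3 less_Suc_eq)
  have tneq: "t i \<noteq> t j" if "i < 3" "j < 3" "i \<noteq> j" for i j
    using adjt[OF that] adj_neq by blast
  have TK: "T \<subseteq> K" using tK unfolding T_def by blast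
  \<comment> \<open>A vertex adjacent to two corners would complete a four-cycle with a
    chord.\<close>
  have one: "i = j" if "z \<in> K - T" and i3: "i < 3" and j3: "j < 3" and "adj z (t i)" "adj z (t j)" for z i j
  proof (rule ccontr)
    assume ij: "i \<noteq> j"
    obtain k where k: "k < 3" "k \<noteq> i" "k \<noteq> j" using third_index[OF i3 j3 ij] by blast
    have "distinct [t i, t j, t k, z]" using that ij k tneq tK by auto
    moreover have "{t i, t j, t k, z} \<subseteq> K" using that k tK by blast
    ultimately show False
      using no_K4_minus_edge[of "t i" "t j" "t k" z] adjt that ij k adj_sym by metis
  qed
  have near: "\<exists>i<3. adj z (t i)" if z: "z \<in> K - T" for z
  proof -
    define N where "N = T \<union> {z \<in> K. \<exists>i<3. adj z (t i)}"
    have "N = K"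
    proof (rule ccontr)
      assume "N \<noteq> K"
      moreover have "N \<subseteq> K" "N \<noteq> {}" using TK tK[of 0] unfolding N_def by auto
      ultimately obtain x y where xy: "x \<in> N" "y \<in> K - N" "adj x y"
        using conn_boundary[OF con] by metis
      have "x \<notin> T" using xy unfolding N_def T_def by (auto dest: adj_sym)
      then obtain i where i: "i < 3" "adj x (t i)" "x \<in> K - T" using xy(1) unfolding N_def by blast
      obtain j where j: "j < 3" "j \<noteq> i" using other_index by blast
      obtain k where k: "k < 3" "k \<noteq> i" "k \<noteq> j" using third_index[OF i(1) j(1)] j by metis
      have "\<not> adj x (t j)" "\<not> adj x (t k)" using one[OF i(3)] i j k by blast+
      moreover have "\<not> adj y (t j)" "\<not> adj y (t k)" "y \<in> K" "y \<notin> T"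
        using xy(2) j k unfolding N_def by auto
      moreover have "x \<noteq> t j" "x \<noteq> t k" "y \<noteq> t j" "y \<noteq> t k"
        using i(3) tK j k \<open>y \<notin> T\<close> by auto
      \<comment> \<open>The edge \<open>x y\<close> would form an induced pair with the side
        opposite to the corner \<open>t i\<close>, the only one adjacent to
        \<open>x\<close>.\<close>
      ultimately show False
        using two_edges_meet[of x y "t j" "t k"] i(3) xy(3) adjt[of j k] j k tK by auto
    qed
    then show ?thesis using z unfolding N_def by blast
  qed
  have indep: "\<not> adj x y" if x: "x \<in> K - T" and y: "y \<in> K - T" for x y
  proof
    assume xy: "adj x y"
    obtain i where i: "i < 3" "adj x (t i)" using near[OF x] by blast
    obtain j where j: "j < 3" "adj y (t j)" using near[OF y] by blast
    have nx: "\<not> adj x (t k)" if "k < 3" "k \<noteq> i" for k using one[OF x] i that by blast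
    have ny: "\<not> adj y (t k)" if "k < 3" "k \<noteq> j" for k using one[OF y] j that by blast
    have xt: "x \<noteq> t k" "y \<noteq> t k" if "k < 3" for k using x y tK[OF that] by auto
    show False
    \<comment> \<open>At a common corner, \<open>x y\<close> and the opposite side form an induced
      pair. At different corners the five-cycle \<open>t i, t k, t j, y, x\<close> has the chord
      from \<open>t i\<close> to \<open>t j\<close>.\<close>
    proof (cases "i = j")
      case True
      obtain k where k: "k < 3" "k \<noteq> i" using other_index by blast
      obtain l where l: "l < 3" "l \<noteq> i" "l \<noteq> k" using third_index[OF i(1) k(1)] k by metis
      show False
        using two_edges_meet[of x y "t k" "t l"] x y xy adjt[of k l] k l tK nx ny xt True by auto
    next
      case False
      obtain k where k: "k < 3" "k \<noteq> i" "k \<noteq> j" using third_index[OF i(1) j(1) False] by blast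
      have "distinct [t i, t j, t k, x, y]" using tneq i j k False xt adj_neq[OF xy] by auto
      moreover have "{t i, t j, t k, x, y} \<subseteq> K" using x y i j k tK by auto
      ultimately show False
        using no_house[of "t i" "t j" "t k" x y] adjt i j k False xy adj_sym by metis
    qed
  qed
  have nbz: "\<exists>i<3. nb K z = {t i}" if z: "z \<in> K - T" for z
  proof -
    obtain i where i: "i < 3" "adj z (t i)" using near[OF z] by blast
    have "x = t i" if "x \<in> nb K z" for x
    proof -
      have "x \<in> T" using that indep[OF z] unfolding nb_def by blast
      then obtain j where "j < 3" "x = t j" unfolding T_def by blast
      then show ?thesis using one[OF z i(1)] i that unfolding nb_def by blast
    qed
    then have "nb K z = {t i}" using i tK(1) unfolding nb_def by blast
    then show ?thesis using i(1) by blast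
  qed
  define L where "L i = nb K (t i) - T" for i
  have nbt: "nb K (t i) = {t j, t k} \<union> L i" if "i < 3" "j < 3" "k < 3" "{..<3} = {i, j, k}" "j \<noteq> i" "k \<noteq> i" for i j k
  proof -
    have "T = {t i, t j, t k}" unfolding T_def that(4) by simp
    then show ?thesis using adjt that tK adj_irrefl unfolding L_def nb_def by auto
  qed
  have nbL: "nb K z = {t i}" if "i < 3" "z \<in> L i" for i z
  proof -
    have "z \<in> K - T" "t i \<in> nb K z" using that tK adj_sym unfolding L_def nb_def by blast+
    then show ?thesis using nbz by (metis singletonD)
  qed
  have leaf: "lam * f z = f (t i)" if "f \<in> eig K" "i < 3" "z \<in> L i" for f i z
    using eig_eq[OF that(1), of z] nbL[OF that(2,3)] that(3) unfolding nsum_def L_def nb_def by simp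
  have eqn: "lam * f (t i) = f (t j) + f (t k) + of_nat (card (L i)) * (f (t i) / lam)"
    if f: "f \<in> eig K" and ijk: "i < 3" "j < 3" "k < 3" "{..<3} = {i, j, k}" "j \<noteq> i" "k \<noteq> i" "j \<noteq> k" for f i j k
  proof -
    have dj: "{t j, t k} \<inter> L i = {}" using tK(2)[OF ijk(2)] tK(2)[OF ijk(3)] unfolding L_def by blast
    have finL: "finite (L i)" unfolding L_def using fin by simp
    have "nsum K f (t i) = (\<Sum>z\<in>{t j, t k}. f z) + (\<Sum>z\<in>L i. f z)"
      unfolding nsum_def nbt[OF ijk(1-6)] by (rule sum.union_disjoint) (use finL dj in simp_all)
    also have "(\<Sum>z\<in>{t j, t k}. f z) = f (t j) + f (t k)" using tneq[OF ijk(2,3,7)] by simp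
    also have "(\<Sum>z\<in>L i. f z) = (\<Sum>z\<in>L i. f (t i) / lam)"
    proof (rule sum.cong)
      fix z assume "z \<in> L i"
      then show "f z = f (t i) / lam" using leaf[OF f ijk(1)] lam_nz by (simp add: field_simps)
    qed simp
    finally show ?thesis using eig_eq[OF f tK(1)[OF ijk(1)]] by simp
  qed
  have zero: "f v = 0" if f: "f \<in> eig K" and "\<And>i. i < 3 \<Longrightarrow> f (t i) = 0" and "v \<in> K" for f v
  proof (cases "v \<in> T")
    case False
    then obtain i where "i < 3" "nb K v = {t i}" using nbz \<open>v \<in> K\<close> by blast
    then show ?thesis using eig_eq[OF f \<open>v \<in> K\<close>] that(2) lam_nz unfolding nsum_def by simp
  qed (use that in \<open>auto simp: T_def\<close>)
  have card_L: "of_nat (card (L i)) = lam\<^sup>2 + lam" if i: "i < 3" for i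
  proof -
    obtain j where j: "j < 3" "j \<noteq> i" using other_index by blast
    obtain k where k: "k < 3" "k \<noteq> i" "k \<noteq> j" "{..<3} = {i, j, k}" using third_index[OF i j(1)] j by metis
    \<comment> \<open>With a zero at \<open>t j\<close> the equation there gives opposite values at
      the other two corners, and the equation at \<open>t i\<close> becomes a formula for
      \<open>card (L i)\<close>.\<close>
    obtain f where f: "f \<in> eig K" "f (t j) = 0" "f \<noteq> (\<lambda>_. 0)" using nonzero_vanishing by blast
    have sets: "{..<3} = {j, i, k}" using k(4) by auto
    have "f (t i) + f (t k) = 0" using eqn[OF f(1) j(1) i k(1) sets] j k f(2) by auto
    then have fk: "f (t k) = - f (t i)" by (simp add: add_eq_0_iff)
    have "f (t i) \<noteq> 0"
    proof
      assume "f (t i) = 0"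
      then have "f (t l) = 0" if "l < 3" for l using that k(4) f(2) fk by (metis insertE lessThan_iff minus_zero singletonD)
      then have "f v = 0" for v using zero[OF f(1)] eig_outside[OF f(1)] by blast
      then show False using f(3) by (simp add: fun_eq_iff)
    qed
    moreover have "lam * f (t i) = - f (t i) + of_nat (card (L i)) * (f (t i) / lam)"
      using eqn[OF f(1) i j(1) k(1,4)] j k f(2) fk by simp
    then have "f (t i) * (lam * lam) = f (t i) * (- lam + of_nat (card (L i)))"
      using lam_nz by (simp add: field_simps)
    ultimately have "lam * lam = - lam + of_nat (card (L i))" by simp
    then show ?thesis by (simp add: power2_eq_square)
  qed
  have "mult K \<le> card {t 0, t 1}"
  proof (rule determining_le)
    fix f v assume f: "f \<in> eig K" "\<And>z. z \<in> {t 0, t 1} \<Longrightarrow> f z = 0" and v: "v \<in> K"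
    have f01: "f (t 0) = 0" "f (t 1) = 0" using f(2) by auto
    have "{..<3} = {0, 1, 2::nat}" by auto
    then have "f (t 2) = 0" using eqn[OF f(1), of 0 1 2] f01 by simp
    then have "f (t i) = 0" if "i < 3" for i 
      using that f01 by (auto simp: numeral_3_eq_3 numeral_2_eq_2 less_Suc_eq)
    then show "f v = 0" using zero[OF f(1) _ v] by blast
  qed simp
  also have "\<dots> \<le> 2" by (simp add: card_insert_if)
  finally have "mult K = 2" using mult_cyc cyclic by linarith
  moreover have "inj_on t {..<3}" using tneq unfolding inj_on_def by blast
  then have "pendant_triangle K t"
    unfolding pendant_triangle_def T_def[symmetric]
    using TK adjt nbz card_L unfolding L_def by auto
  ultimately show ?thesis by blast
qed

text \<open>For lack of four-cycles an outside neighbour \<open>y\<close> of \<open>a\<close> is not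
  adjacent to \<open>c\<close> or \<open>d\<close>, so \<open>a y\<close> and \<open>c d\<close>
  would be an induced pair. On the bare cycle a zero at \<open>a\<close> is carried around and
  yields the equation for \<open>lam\<close>.\<close>

lemma five_case:
  assumes no3: "\<And>a b c. {a, b, c} \<subseteq> K \<Longrightarrow> adj a b \<Longrightarrow> adj b c \<Longrightarrow> \<not> adj c a"
    and no4: "\<And>a b c d. {a, b, c, d} \<subseteq> K \<Longrightarrow> adj a b \<Longrightarrow> adj b c \<Longrightarrow> adj c d \<Longrightarrow> adj d a \<Longrightarrow>
      a \<noteq> c \<Longrightarrow> b \<noteq> d \<Longrightarrow> False"
    and C: "{a, b, c, d, e} \<subseteq> K" "adj a b" "adj b c" "adj c d" "adj d e" "adj e a"
      "distinct [a, b, c, d, e]"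
  shows "mult K = 2 \<and> five_cycle K [a, b, c, d, e] \<and> lam\<^sup>2 + lam = 1"
proof -
  have closed: "y \<in> {a, b, c, d, e}" 
    if C: "{a, b, c, d, e} \<subseteq> K" "adj a b" "adj b c" "adj c d" "adj d e" "adj e a"
      "distinct [a, b, c, d, e]" and y: "y \<in> K" "adj a y" for a b c d e y
  proof (rule ccontr)
    assume "y \<notin> {a, b, c, d, e}"
    moreover have "\<not> adj y c" "\<not> adj y d"
      using no4[of y c b a] no4[of y d e a] C y calculation adj_sym by auto
    moreover have "\<not> adj a c" "\<not> adj a d" using no3[of a b c] no3[of a e d] C adj_sym by auto
    ultimately show False using two_edges_meet[of a y c d] C y by auto
  qed
  \<comment> \<open>The cycle is rotated so that each vertex in turn takes the place of
    \<open>a\<close>.\<close>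
  have rot: "{b, c, d, e, a} \<subseteq> K" "distinct [b, c, d, e, a]"
    "{c, d, e, a, b} \<subseteq> K" "distinct [c, d, e, a, b]"
    "{d, e, a, b, c} \<subseteq> K" "distinct [d, e, a, b, c]"
    "{e, a, b, c, d} \<subseteq> K" "distinct [e, a, b, c, d]" using C by auto
  have "K = {a, b, c, d, e}"
  proof (rule ccontr)
    assume "K \<noteq> {a, b, c, d, e}"
    then obtain x y where xy: "x \<in> {a, b, c, d, e}" "y \<in> K - {a, b, c, d, e}" "adj x y"
      using conn_boundary[OF con C(1)] by blast
    then show False
      using closed[OF C] closed[OF rot(1) C(3-6,2) rot(2)] closed[OF rot(3) C(4-6,2,3) rot(4)]
        closed[OF rot(5) C(5,6,2-4) rot(6)] closed[OF rot(7) C(6,2-5) rot(8)] by blast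
  qed
  note Keq = this
  have no: "\<not> adj a c" "\<not> adj b d" "\<not> adj c e" "\<not> adj d a" "\<not> adj e b"
    using no3[of a b c] no3[of b c d] no3[of c d e] no3[of d e a] no3[of e a b] C adj_sym by auto
  have nbs: "nb K a = {b, e}" "nb K b = {c, a}" "nb K c = {d, b}" "nb K d = {e, c}" "nb K e = {a, d}"
  proof -
    note pos = C(2-6) C(2-6)[THEN adj_sym]
    have neg: "\<not> adj c a" "\<not> adj d b" "\<not> adj e c" "\<not> adj a d" "\<not> adj b e"
      using no adj_sym by blast+
    show "nb K a = {b, e}" "nb K b = {c, a}" "nb K c = {d, b}" "nb K d = {e, c}" "nb K e = {a, d}"
      unfolding nb_def Keq using pos neg no adj_irrefl by auto
  qed
  have "nb K ([a, b, c, d, e] ! i) = {[a, b, c, d, e] ! ((i + 1) mod 5), [a, b, c, d, e] ! ((i + 4) mod 5)}"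
    if i5: "i < 5" for i
  proof -
    consider "i = 0" | "i = 1" | "i = 2" | "i = 3" | "i = 4" using i5 by linarith
    then show ?thesis by cases (simp_all add: nbs)
  qed
  then have fc: "five_cycle K [a, b, c, d, e]"
    unfolding five_cycle_def using C(7) Keq[symmetric] by simp
  have eqs: "f b + f e = lam * f a" "f c + f a = lam * f b" "f d + f b = lam * f c"
    "f e + f c = lam * f d" "f a + f d = lam * f e" if "f \<in> eig K" for f
    using eig_eq[OF that, of a] eig_eq[OF that, of b] eig_eq[OF that, of c] eig_eq[OF that, of d]
      eig_eq[OF that, of e] C(1,7) unfolding nsum_def nbs by auto
  have "mult K \<le> card {a, b}"
  proof (rule determining_le)
    fix f v assume f: "f \<in> eig K" "\<And>z. z \<in> {a, b} \<Longrightarrow> f z = 0" and v: "v \<in> K"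
    have "f a = 0" "f b = 0" using f(2) by auto
    then show "f v = 0" using eqs[OF f(1)] v Keq by auto
  qed simp
  also have "\<dots> \<le> 2" by (simp add: card_insert_if)
  finally have "mult K = 2" using mult_cyc cyclic by linarith
  obtain f where f: "f \<in> eig K" "f a = 0" "f \<noteq> (\<lambda>_. 0)" using nonzero_vanishing by blast
  have e: "f e = - f b" "f c = lam * f b" "f d = - (lam * f b)"
    using eqs[OF f(1)] f(2) by (auto simp: add_eq_0_iff)
  have "f b \<noteq> 0"
  proof
    assume "f b = 0"
    then have "f v = 0" for v using e f(2) Keq eig_outside[OF f(1)] by (cases "v \<in> K") auto
    then show False using f(3) by (simp add: fun_eq_iff)
  qed
  moreover have "f b * (lam\<^sup>2 + lam) = f b * 1"
    using eqs(3)[OF f(1)] e by (simp add: power2_eq_square algebra_simps)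
  ultimately have "lam\<^sup>2 + lam = 1" by (simp only: mult_cancel_left) simp
  then show ?thesis using \<open>mult K = 2\<close> fc by blast
qed

end

section \<open>Exclusion of four-cycles\<close>

context tight
begin

definition common :: "'a \<Rightarrow> 'a \<Rightarrow> 'a set" where
  "common x y = {z \<in> K. adj x z \<and> adj y z}"

lemma common_commute: "common x y = common y x"
  unfolding common_def by blast

lemma common_subset: "common x y \<subseteq> K"
  unfolding common_def by blast

lemma finite_common: "finite (common x y)"
  using common_subset fin finite_subset by blast

end

text \<open>A four-cycle through \<open>a\<close> and \<open>c\<close>, opposite vertices chosen with as many common neighbours as
  possible; the maximality serves to show that no further vertex has two neighbours in \<open>B\<close>.\<close>

locale square = tight +
  fixes a c
  assumes no3: "x \<in> K \<Longrightarrow> y \<in> K \<Longrightarrow> z \<in> K \<Longrightarrow> adj x y \<Longrightarrow> adj y z \<Longrightarrow> \<not> adj z x"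
    and ac: "a \<in> K" "c \<in> K" "a \<noteq> c"
    and two: "2 \<le> card (common a c)"
    and maximal: "x \<in> K \<Longrightarrow> y \<in> K \<Longrightarrow> x \<noteq> y \<Longrightarrow> card (common x y) \<le> card (common a c)"
begin

definition B where "B = common a c"
definition S where "S = {a, c} \<union> B"

lemma BD: "b \<in> B \<Longrightarrow> b \<in> K" "b \<in> B \<Longrightarrow> adj a b" "b \<in> B \<Longrightarrow> adj c b"
  "b \<in> B \<Longrightarrow> adj b a" "b \<in> B \<Longrightarrow> adj b c"
  unfolding B_def common_def by (auto intro: adj_sym)

lemma in_B: "x \<in> K \<Longrightarrow> adj x a \<Longrightarrow> adj x c \<Longrightarrow> x \<in> B"
  unfolding B_def common_def by (auto intro: adj_sym)

lemma finite_B: "finite B"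
  unfolding B_def by (rule finite_common)

lemma SK: "S \<subseteq> K"
  unfolding S_def using ac BD by blast

lemma aS: "a \<in> S" "c \<in> S" and BS: "b \<in> B \<Longrightarrow> b \<in> S"
  unfolding S_def by auto

lemma notB: "a \<notin> B" "c \<notin> B"
  using BD adj_irrefl by blast+

lemma other: obtains b' where "b' \<in> B" "b' \<noteq> b"
proof -
  have "\<not> B \<subseteq> {b}"
    using two card_mono[of "{b}" B] unfolding B_def by auto
  then show ?thesis using that by blast
qed

lemma not_adj_ac: "\<not> adj a c" "\<not> adj c a"
proof -
  obtain b where "b \<in> B" using other by blast
  then show "\<not> adj a c" "\<not> adj c a" using no3[of a b c] no3[of c b a] BD ac by blast+
qed

lemma not_adj_BB: "b \<in> B \<Longrightarrow> b' \<in> B \<Longrightarrow> \<not> adj b b'"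
  using no3[of a b b'] BD ac by blast

text \<open>If \<open>B = {b, b'}\<close>, then \<open>r\<close> is a third common neighbour of
  \<open>b\<close> and \<open>b'\<close> besides \<open>a\<close> and \<open>c\<close>, against
  maximality. Otherwise a third vertex \<open>d\<close> of \<open>B\<close> completes the six-cycle
  \<open>a, b, r, b', c, d\<close> with chord \<open>a b'\<close>, up to the order of its vertices:
  the two four-cycles sharing that chord are \<open>a, b, r, b'\<close> and
  \<open>a, d, c, b'\<close>.\<close>

lemma outside_one_B:
  assumes r: "r \<in> K - S" and b: "b \<in> B" "b' \<in> B" "adj r b" "adj r b'"
  shows "b = b'"
proof (rule ccontr)
  assume ne: "b \<noteq> b'"
  have rn: "r \<noteq> a" "r \<noteq> c" "r \<notin> B" using r unfolding S_def by auto
  have bn: "b \<noteq> a" "b \<noteq> c" "b' \<noteq> a" "b' \<noteq> c" using b notB by auto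
  show False
  proof (cases "B \<subseteq> {b, b'}")
    case True
    have "{a, c, r} \<subseteq> common b b'" unfolding common_def using r b BD ac adj_sym by auto
    moreover have "card {a, c, r} = 3" using rn ac by auto
    ultimately have "3 \<le> card (common b b')" using card_mono[OF finite_common] by metis
    moreover have "card B \<le> 2" using card_mono[OF _ True] ne by simp
    ultimately show False using maximal[of b b'] b ne BD unfolding B_def by fastforce
  next
    case False
    then obtain d where d: "d \<in> B" "d \<noteq> b" "d \<noteq> b'" by blast
    have "distinct [a, b', b, r, d, c]" using rn bn ne d notB b ac by auto
    moreover have "{a, b', b, r, d, c} \<subseteq> K" using r b d BD ac by auto
    ultimately show False
      using no_chorded_hexagon[of a b' b r d c] BD[OF b(1)] BD[OF b(2)] BD[OF d(1)] b adj_sym by blast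
  qed
qed

text \<open>Neighbours \<open>a\<close> and \<open>c\<close> would put \<open>r\<close> into
  \<open>B\<close>, one neighbour in \<open>{a, c}\<close> and one in \<open>B\<close> would close a
  triangle, and two in \<open>B\<close> are \<open>outside_one_B\<close>.\<close>

lemma outside_one:
  assumes r: "r \<in> K - S" and s: "s \<in> S" "s' \<in> S" "adj r s" "adj r s'"
  shows "s = s'"
proof -
  have rB: "r \<notin> B" "r \<in> K" using r unfolding S_def by auto
  have not_both: "\<not> (adj r a \<and> adj r c)" using in_B rB by blast
  have mixed: "\<not> (adj r x \<and> adj r b)" if "x \<in> {a, c}" "b \<in> B" for x b
    using no3[of r x b] that ac BD rB adj_sym by blast
  show ?thesis
    using s not_both mixed outside_one_B[OF r] unfolding S_def by blast
qed

lemma edge_avoiding: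
  assumes "s \<in> S"
  obtains p q where "p \<in> S" "q \<in> S" "adj p q" "p \<noteq> s" "q \<noteq> s"
proof -
  obtain b where b: "b \<in> B" "b \<noteq> s" using other by blast
  show ?thesis
  proof (cases "s = a")
    case True
    then show ?thesis using that[of c b] b BD BS aS ac by blast
  next
    case False
    then show ?thesis using that[of a b] b BD BS aS ac by blast
  qed
qed

lemma outside_near:
  assumes "r \<in> K - S"
  shows "\<exists>s\<in>S. adj r s"
proof -
  define N where "N = S \<union> {z \<in> K. \<exists>s\<in>S. adj z s}"
  have "N = K"
  proof (rule ccontr)
    assume "N \<noteq> K"
    moreover have "N \<subseteq> K" "N \<noteq> {}" using SK aS unfolding N_def by auto
    ultimately obtain z y where zy: "z \<in> N" "y \<in> K - N" "adj z y"
      using conn_boundary[OF con] by metis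
    have "z \<notin> S" using zy adj_sym unfolding N_def by blast
    then obtain s where s: "s \<in> S" "adj z s" and z: "z \<in> K - S" using zy(1) SK unfolding N_def by blast
    obtain p q where pq: "p \<in> S" "q \<in> S" "adj p q" "p \<noteq> s" "q \<noteq> s" using edge_avoiding[OF s(1)] .
    have "\<not> adj z p" "\<not> adj z q" using outside_one[OF z s(1) _ s(2)] pq by blast+
    moreover have "\<not> adj y p" "\<not> adj y q" "y \<notin> S" using zy(2) pq unfolding N_def by blast+
    ultimately show False using two_edges_meet[of z y p q] z zy pq SK by blast
  qed
  then show ?thesis using assms unfolding N_def by blast
qed

text \<open>Each end of \<open>r r'\<close> has a single neighbour in \<open>S\<close>, so an edge
  of \<open>S\<close> missing both attachments would be an induced pair with
  \<open>r r'\<close>.\<close>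

lemma outside_edge:
  assumes r: "r \<in> K - S" "r' \<in> K - S" "adj r r'" and s: "s \<in> S" "s' \<in> S" "adj r s" "adj r' s'"
    and pq: "p \<in> S" "q \<in> S" "adj p q"
  shows "p \<in> {s, s'} \<or> q \<in> {s, s'}"
proof (rule ccontr)
  assume no: "\<not> (p \<in> {s, s'} \<or> q \<in> {s, s'})"
  have "\<not> adj r p" "\<not> adj r q" "\<not> adj r' p" "\<not> adj r' q"
    using outside_one[OF r(1) s(1) _ s(3)] outside_one[OF r(2) s(2) _ s(4)] pq no by blast+
  moreover have "r \<noteq> p" "r \<noteq> q" "r' \<noteq> p" "r' \<noteq> q" using r pq by auto
  ultimately show False using two_edges_meet[of r r' p q] r pq SK by blast
qed

text \<open>The edge from the other vertex of \<open>{a, c}\<close> to another vertex of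
  \<open>B\<close> misses both attachments, against \<open>outside_edge\<close>.\<close>

lemma outside_edge_aB:
  assumes "r \<in> K - S" "r' \<in> K - S" "x \<in> {a, c}" "adj r x" "b \<in> B" "adj r' b"
  shows "\<not> adj r r'"
proof
  assume rr: "adj r r'"
  obtain b' where b': "b' \<in> B" "b' \<noteq> b" using other by blast
  obtain y where y: "y \<in> {a, c}" "y \<noteq> x" using ac(3) assms(3) by blast
  have "y \<in> S" "x \<in> S" "adj y b'" using y assms(3) aS BD b' by auto
  then have "y \<in> {x, b} \<or> b' \<in> {x, b}"
    using outside_edge[OF assms(1,2) rr _ BS[OF assms(5)] assms(4,6) _ BS[OF b'(1)]] by blast
  then show False using y b' assms(3,5) notB by auto
qed

lemma outside_edge_same:
  "r \<in> K \<Longrightarrow> r' \<in> K \<Longrightarrow> adj r r' \<Longrightarrow> s \<in> S \<Longrightarrow> adj r s \<Longrightarrow> \<not> adj r' s"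
  using no3[of r r' s] SK adj_sym by blast

lemma square_swap: "square adj lam K c a"
proof unfold_locales
  show "c \<in> K" "a \<in> K" "c \<noteq> a" using ac by simp_all
  show "2 \<le> card (common c a)" using two common_commute[of a c] by simp
  fix x y assume xy: "x \<in> K" "y \<in> K" 
  show "card (common x y) \<le> card (common c a)" if "x \<noteq> y"
    using maximal[OF xy that] common_commute[of a c] by simp
  show "\<not> adj z x" if "z \<in> K" "adj x y" "adj y z" for z
    using no3[OF xy that] .
qed

definition A' where "A' = nb K a - B"
definition C' where "C' = nb K c - B"

lemma A'_outside: "r \<in> A' \<Longrightarrow> r \<in> K - S" "r \<in> A' \<Longrightarrow> adj r a"
  unfolding A'_def nb_def S_def using adj_irrefl not_adj_ac adj_sym by auto

lemma C'_outside: "r \<in> C' \<Longrightarrow> r \<in> K - S" "r \<in> C' \<Longrightarrow> adj r c"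
  unfolding C'_def nb_def S_def using adj_irrefl not_adj_ac adj_sym by auto

lemma in_A': "r \<in> K - S \<Longrightarrow> adj r a \<Longrightarrow> r \<in> A'"
  unfolding A'_def nb_def S_def using adj_sym by auto

lemma in_C': "r \<in> K - S \<Longrightarrow> adj r c \<Longrightarrow> r \<in> C'"
  unfolding C'_def nb_def S_def using adj_sym by auto

text \<open>A neighbour outside \<open>S\<close> cannot attach to \<open>a\<close>, which closes a
  triangle, nor to \<open>B\<close>, so it lies in \<open>C'\<close>. Conversely, if
  \<open>r\<close> missed some \<open>x\<close> in \<open>C'\<close>, then \<open>a r\<close> and
  \<open>c x\<close> would be an induced pair.\<close>

lemma nb_A':
  assumes r: "r \<in> A'"
  shows "nb K r = insert a C'"
proof
  have r': "r \<in> K - S" "adj r a" using A'_outside[OF r] by auto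
  show "nb K r \<subseteq> insert a C'"
  proof
    fix x assume x: "x \<in> nb K r"
    show "x \<in> insert a C'"
    proof (cases "x \<in> S")
      case True
      then show ?thesis using outside_one[OF r'(1) aS(1) True r'(2)] x unfolding nb_def by blast
    next
      case False
      then have xo: "x \<in> K - S" "adj r x" using x unfolding nb_def by auto
      obtain s where s: "s \<in> S" "adj x s" using outside_near[OF xo(1)] by blast
      have "s \<noteq> a" using outside_edge_same[of r x a] r' xo s aS by blast
      moreover have "s \<notin> B" using outside_edge_aB[OF r'(1) xo(1) _ r'(2) _ s(2)] xo(2) by blast
      ultimately have "adj x c" using s unfolding S_def by blast
      then show ?thesis using in_C'[OF xo(1)] by blast
    qed
  qed
  have "adj r x" if x: "x \<in> C'" for x
  proof -
    have x': "x \<in> K - S" "adj x c" using C'_outside[OF x] by auto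
    have "\<not> adj a x" "\<not> adj r c" 
      using outside_one[OF x'(1) aS(1) aS(2) _ x'(2)] outside_one[OF r'(1) aS r'(2)] ac(3) adj_sym by blast+
    moreover have "r \<noteq> x" using calculation r' adj_sym by blast
    ultimately show ?thesis
      using two_edges_meet[of a r c x] ac r' x' not_adj_ac adj_sym aS by blast
  qed
  then show "insert a C' \<subseteq> nb K r" using r' ac C'_outside unfolding nb_def by blast
qed

end

text \<open>An edge between outside neighbours of \<open>B\<close> is the one configuration the
  square leaves open. If it occurs for the diagonal \<open>a c\<close>, then
  \<open>four_case\<close> passes to the other diagonal, where it does not.\<close>

locale square_ne = square +
  assumes ne: "r \<in> K - S \<Longrightarrow> r' \<in> K - S \<Longrightarrow> b \<in> B \<Longrightarrow> b' \<in> B \<Longrightarrow> adj r b \<Longrightarrow> adj r' b' \<Longrightarrow> \<not> adj r r'"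
begin

lemma swap_sets: "square.B adj K c a = B" "square.S adj K c a = S"
  "square.A' adj K c a = C'" "square.C' adj K c a = A'"
proof -
  interpret sw: square adj lam K c a by (rule square_swap)
  show 1: "sw.B = B" unfolding B_def sw.B_def by (rule common_commute)
  show "sw.S = S" "sw.A' = C'" "sw.C' = A'"
    unfolding S_def sw.S_def A'_def C'_def sw.A'_def sw.C'_def 1 by auto
qed

lemma square_ne_swap: "square_ne adj lam K c a"
proof -
  interpret sw: square adj lam K c a by (rule square_swap)
  show ?thesis by unfold_locales (use ne swap_sets in metis)
qed

lemma nb_C': "r \<in> C' \<Longrightarrow> nb K r = insert c A'"
proof -
  interpret sw: square adj lam K c a by (rule square_swap)
  show "r \<in> C' \<Longrightarrow> nb K r = insert c A'" using sw.nb_A' swap_sets by metis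
qed

text \<open>If two vertices \<open>b\<close> and \<open>d\<close> of \<open>B\<close> had outside
  neighbours \<open>r\<close> and \<open>r'\<close>, then \<open>b r\<close> and \<open>d r'\<close>
  would be an induced pair.\<close>

lemma special_vertex:
  obtains b where "b \<in> B" "\<And>d. d \<in> B \<Longrightarrow> d \<noteq> b \<Longrightarrow> nb K d = {a, c}"
proof -
  have nb_B: "nb K b \<subseteq> {a, c} \<union> (nb K b - S)" if "b \<in> B" for b
    using not_adj_BB[OF that] unfolding S_def nb_def by blast
  show ?thesis
  proof (cases "\<exists>b\<in>B. nb K b - S \<noteq> {}")
    case True
    then obtain b r where b: "b \<in> B" "r \<in> K - S" "adj b r" unfolding nb_def by blast
    have "nb K d - S = {}" if d: "d \<in> B" "d \<noteq> b" for d
    proof (rule ccontr)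
      assume "nb K d - S \<noteq> {}"
      then obtain r' where r': "r' \<in> K - S" "adj d r'" unfolding nb_def by blast
      have "\<not> adj r r'" using ne[OF b(2) r'(1) b(1) d(1)] b(3) r'(2) adj_sym by blast
      moreover have "\<not> adj b r'" "\<not> adj r d" 
        using outside_one_B[OF b(2) b(1) d(1)] outside_one_B[OF r'(1) b(1) d(1)] b(3) r'(2) d(2) adj_sym
        by blast+
      moreover have "r \<noteq> r'" using calculation b(3) by blast
      ultimately show False
        using two_edges_meet[of b r d r'] b r' d BD(1) not_adj_BB BS adj_sym by blast
    qed
    then have "nb K d = {a, c}" if "d \<in> B" "d \<noteq> b" for d
      using nb_B[OF that(1)] that BD ac unfolding nb_def by blast
    then show ?thesis using that b(1) by blast
  next
    case False
    obtain b where "b \<in> B" using other by blast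
    moreover have "nb K d = {a, c}" if "d \<in> B" for d
    proof -
      have "nb K d - S = {}" using False that by blast
      then show ?thesis using nb_B[OF that] that BD ac unfolding nb_def by blast
    qed
    ultimately show ?thesis using that by blast
  qed
qed

lemma nsum_a: "nsum K f a = (\<Sum>z\<in>B. f z) + (\<Sum>z\<in>A'. f z)"
proof -
  have "nb K a = B \<union> A'" "B \<inter> A' = {}" unfolding A'_def nb_def using BD by blast+
  moreover have "finite A'" unfolding A'_def using fin by simp
  ultimately show ?thesis unfolding nsum_def using finite_B by (simp add: sum.union_disjoint)
qed

lemma nsum_c: "nsum K f c = (\<Sum>z\<in>B. f z) + (\<Sum>z\<in>C'. f z)"
proof -
  have "nb K c = B \<union> C'" "B \<inter> C' = {}" unfolding C'_def nb_def using BD by blast+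
  moreover have "finite C'" unfolding C'_def using fin by simp
  ultimately show ?thesis unfolding nsum_def using finite_B by (simp add: sum.union_disjoint)
qed

text \<open>Further neighbours of \<open>r\<close> are excluded by \<open>outside_edge_aB\<close>
  and \<open>ne\<close>, so \<open>r\<close> is pendant at \<open>b\<close>.\<close>

lemma pendant_B:
  assumes f: "f \<in> eig K" and r: "r \<in> K - S" "b \<in> B" "adj r b" and "f b = 0"
  shows "f r = 0"
proof -
  have "x = b" if x: "x \<in> K" "adj r x" for x
  proof (cases "x \<in> S")
    case True
    then show ?thesis using outside_one[OF r(1) _ BS[OF r(2)] x(2) r(3)] by blast
  next
    case False
    then have xo: "x \<in> K - S" using x by blast
    obtain s where s: "s \<in> S" "adj x s" using outside_near[OF xo] by blast
    have "s \<notin> {a, c}" using outside_edge_aB[OF xo r(1) _ s(2) r(2,3)] x(2) adj_sym by blast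
    moreover have "s \<notin> B" using ne[OF r(1) xo r(2) _ r(3) s(2)] x(2) by blast
    ultimately show ?thesis using s(1) unfolding S_def by blast
  qed
  then have "nb K r = {b}" using r BD(1) unfolding nb_def by blast
  then show ?thesis using eig_eq[OF f, of r] r(1) \<open>f b = 0\<close> lam_nz unfolding nsum_def by simp
qed

text \<open>The equations at \<open>a\<close> and \<open>c\<close> make the sums over
  \<open>A'\<close> and \<open>C'\<close> vanish, and these are the sums that occur in the equations
  on \<open>C'\<close> and \<open>A'\<close>.\<close>

lemma zero_from_abc:
  assumes f: "f \<in> eig K" "f a = 0" "f c = 0" and B: "\<And>b. b \<in> B \<Longrightarrow> f b = 0" and v: "v \<in> K"
  shows "f v = 0"
proof (cases "v \<in> S")
  case True
  then show ?thesis using f B unfolding S_def by blast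
next
  case False
  have sB: "(\<Sum>z\<in>B. f z) = 0" using B by simp
  have sA: "(\<Sum>z\<in>A'. f z) = 0" using eig_eq[OF f(1) ac(1)] f(2) sB nsum_a[of f] by simp
  have sC: "(\<Sum>z\<in>C'. f z) = 0" using eig_eq[OF f(1) ac(2)] f(3) sB nsum_c[of f] by simp
  have finAC: "finite A'" "finite C'" unfolding A'_def C'_def using fin by simp_all
  have naC: "a \<notin> C'" "c \<notin> A'" using A'_outside C'_outside aS by blast+
  have vo: "v \<in> K - S" using v False by blast
  obtain s where s: "s \<in> S" "adj v s" using outside_near[OF vo] by blast
  consider "s = a" | "s = c" | "s \<in> B" using s(1) unfolding S_def by blast
  then show ?thesis
  proof cases
    case 1
    then have "nb K v = insert a C'" using nb_A' in_A'[OF vo] s(2) by blast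
    then have "nsum K f v = 0" unfolding nsum_def using finAC naC sC f by simp
    then show ?thesis using eig_eq[OF f(1) v] lam_nz by simp
  next
    case 2
    then have "nb K v = insert c A'" using nb_C' in_C'[OF vo] s(2) by blast
    then have "nsum K f v = 0" unfolding nsum_def using finAC naC sA f by simp
    then show ?thesis using eig_eq[OF f(1) v] lam_nz by simp
  next
    case 3
    then show ?thesis using pendant_B[OF f(1) vo _ s(2)] B by blast
  qed
qed

text \<open>With zeros at \<open>a\<close> and at the special vertex \<open>b\<close>, the outside
  neighbours of \<open>b\<close> vanish and the equation at \<open>b\<close> gives zero at
  \<open>c\<close>. The rest of \<open>B\<close> has only \<open>a\<close> and \<open>c\<close> as
  neighbours.\<close>

lemma mult_le_two: "mult K \<le> 2"
proof -
  obtain b where b: "b \<in> B" "\<And>d. d \<in> B \<Longrightarrow> d \<noteq> b \<Longrightarrow> nb K d = {a, c}" using special_vertex by metis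
  have "mult K \<le> card {a, b}"
  proof (rule determining_le)
    fix f v assume f: "f \<in> eig K" "\<And>z. z \<in> {a, b} \<Longrightarrow> f z = 0" and v: "v \<in> K"
    have fab: "f a = 0" "f b = 0" using f(2) by auto
    have bK: "b \<in> K" using b(1) BD by blast
    have "nsum K f b = (\<Sum>z\<in>{c}. f z)"
      unfolding nsum_def
    proof (rule sum.mono_neutral_right)
      show "\<forall>z\<in>nb K b - {c}. f z = 0"
      proof
        fix z assume z: "z \<in> nb K b - {c}"
        show "f z = 0"
        proof (cases "z \<in> S")
          case True
          then have "z = a" using z not_adj_BB[OF b(1)] unfolding S_def nb_def by blast
          then show ?thesis using fab by simp
        next
          case False
          then show ?thesis using pendant_B[OF f(1) _ b(1)] z fab adj_sym unfolding nb_def by blast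
        qed
      qed
    qed (use b(1) BD ac fin in \<open>auto simp: nb_def\<close>)
    then have fc: "f c = 0" using eig_eq[OF f(1) bK] fab by simp
    have "f d = 0" if "d \<in> B" for d
    proof (cases "d = b")
      case False
      then have "nsum K f d = 0" unfolding nsum_def using b(2) that fab fc ac(3) by simp
      then show ?thesis using eig_eq[OF f(1), of d] BD(1)[OF that] lam_nz by simp
    qed (use fab in simp)
    then show "f v = 0" using zero_from_abc[OF f(1) fab(1) fc _ v] by blast
  qed simp
  also have "\<dots> \<le> 2" by (simp add: card_insert_if)
  finally show ?thesis .
qed

text \<open>If \<open>C'\<close> is empty, then a zero at \<open>a\<close> is enough:
  \<open>A'\<close> consists of pendants at \<open>a\<close>, so the equation at \<open>a\<close>
  gives sum zero over \<open>B\<close>, which is the whole neighbour sum at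
  \<open>c\<close>.\<close>

lemma C'_nonempty: "C' \<noteq> {}"
proof
  assume empty: "C' = {}"
  obtain b where b: "b \<in> B" "\<And>d. d \<in> B \<Longrightarrow> d \<noteq> b \<Longrightarrow> nb K d = {a, c}" using special_vertex by metis
  have "mult K \<le> card {a}"
  proof (rule determining_le)
    fix f v assume f: "f \<in> eig K" "\<And>z. z \<in> {a} \<Longrightarrow> f z = 0" and v: "v \<in> K"
    have fa: "f a = 0" using f(2) by auto
    have "f r = 0" if "r \<in> A'" for r
      using eig_eq[OF f(1), of r] A'_outside(1)[OF that] nb_A'[OF that] empty fa lam_nz
      unfolding nsum_def by simp
    then have sB: "(\<Sum>z\<in>B. f z) = 0" using eig_eq[OF f(1) ac(1)] fa nsum_a[of f] by simp
    then have fc: "f c = 0" using eig_eq[OF f(1) ac(2)] nsum_c[of f] empty lam_nz by simp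
    have d: "f d = 0" if "d \<in> B" "d \<noteq> b" for d
    proof -
      have "nsum K f d = 0" unfolding nsum_def using b(2) that fa fc ac(3) by simp
      then show ?thesis using eig_eq[OF f(1), of d] BD(1)[OF that(1)] lam_nz by simp
    qed
    have "(\<Sum>z\<in>B. f z) = f b + (\<Sum>z\<in>B - {b}. f z)" using sum.remove[OF finite_B b(1)] .
    moreover have "(\<Sum>z\<in>B - {b}. f z) = 0" by (rule sum.neutral) (use d in blast)
    ultimately have "f b = 0" using sB by simp
    then show "f v = 0" using zero_from_abc[OF f(1) fa fc _ v] d by blast
  qed simp
  then show False using mult_cyc cyclic by simp
qed

text \<open>As \<open>A'\<close> and \<open>C'\<close> are nonempty, a path
  \<open>a, r, q, c\<close> joins the square: six vertices and seven edges give
  \<open>2 \<le> cyc K\<close>, hence multiplicity at least three.\<close>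

lemma contradiction: False
proof -
  interpret sw: square_ne adj lam K c a by (rule square_ne_swap)
  obtain r where r: "r \<in> A'" using sw.C'_nonempty swap_sets by auto
  obtain q where q: "q \<in> C'" using C'_nonempty by blast
  have rq: "adj r q" "r \<in> K - S" "q \<in> K - S" "adj r a" "adj q c"
    using nb_A'[OF r] q A'_outside[OF r] C'_outside[OF q] unfolding nb_def by auto
  obtain b where b: "b \<in> B" using other by blast
  obtain d where d: "d \<in> B" "d \<noteq> b" using other by blast
  let ?W = "{a, b, c, d, r, q}"
  let ?F = "{{a, b}, {b, c}, {a, d}, {d, c}, {a, r}, {r, q}, {q, c}}"
  have ne: "distinct [a, b, c, d, r, q]" 
    using rq b d ac notB adj_neq[OF rq(1)] unfolding S_def by auto
  have FW: "?F \<subseteq> edg ?W" using rq BD[OF b] BD[OF d(1)] adj_sym by (simp add: edg_iff)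
  have WK: "?W \<subseteq> K" "?W \<noteq> {}" using rq BD(1) b d ac by auto
  have "card ?F = 7" using ne by (auto simp: doubleton_eq_iff card_insert_if)
  moreover have "card ?W = 6" using ne by simp
  ultimately have "2 \<le> cyc K"
    using subgraph_edge_excess[OF fin con WK FW] conn_cyc[OF con] by linarith
  then show False using mult_le_two mult_cyc by linarith
qed

end

context tight
begin

text \<open>If \<open>square_ne\<close> fails for \<open>a\<close> and \<open>c\<close>, then
  \<open>B\<close> has just two vertices, so the other diagonal is maximal as well. For it the
  condition holds, since a violating edge \<open>q q'\<close> would form an induced pair with
  \<open>r r'\<close>.\<close>

lemma four_case:
  assumes no3: "\<And>x y z. x \<in> K \<Longrightarrow> y \<in> K \<Longrightarrow> z \<in> K \<Longrightarrow> adj x y \<Longrightarrow> adj y z \<Longrightarrow> \<not> adj z x"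
    and C: "{p, b, q, d} \<subseteq> K" "adj p b" "adj b q" "adj q d" "adj d p" "p \<noteq> q" "b \<noteq> d"
  shows False
proof -
  define P where "P = (\<lambda>(x, y). card (common x y)) ` {(x, y) \<in> K \<times> K. x \<noteq> y}"
  have "finite {(x, y) \<in> K \<times> K. x \<noteq> y}" by (rule finite_subset[of _ "K \<times> K"]) (use fin in auto)
  then have finP: "finite P" unfolding P_def by simp
  have pq: "card (common p q) \<in> P" unfolding P_def using C by auto
  then have "Max P \<in> P" using Max_in finP by blast
  then obtain a c where ac: "a \<in> K" "c \<in> K" "a \<noteq> c" "card (common a c) = Max P" unfolding P_def by auto
  have max: "card (common x y) \<le> card (common a c)" if "x \<in> K" "y \<in> K" "x \<noteq> y" for x y
  proof -
    have "card (common x y) \<in> P" unfolding P_def using that by auto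
    then show ?thesis using Max_ge finP ac(4) by simp
  qed
  have "{b, d} \<subseteq> common p q" unfolding common_def using C adj_sym by auto
  then have "2 \<le> card (common p q)" using card_mono[OF finite_common, of "{b, d}" p q] C(7) by simp
  then have two: "2 \<le> card (common a c)" using max[of p q] C by fastforce
  interpret square adj lam K a c
    by unfold_locales (use no3 ac two max in blast)+
  show False
  proof (cases "square_ne adj lam K a c")
    case True
    then show False by (rule square_ne.contradiction)
  next
    case False
    then obtain r r' b b' where r: "r \<in> K - S" "r' \<in> K - S" "b \<in> B" "b' \<in> B" "adj r b" "adj r' b'" "adj r r'"
      unfolding square_ne_def square_ne_axioms_def using square_axioms by blast
    have bb: "b \<noteq> b'" using outside_edge_same[of r r' b] r BS by blast
    \<comment> \<open>A third vertex \<open>e\<close> of \<open>B\<close> would give the edge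
      \<open>a e\<close>, which misses both attachments \<open>b\<close> and
      \<open>b'\<close>.\<close>
    have Beq: "B = {b, b'}"
    proof (rule ccontr)
      assume "B \<noteq> {b, b'}"
      then obtain e where e: "e \<in> B" "e \<notin> {b, b'}" using r by blast
      then show False
        using outside_edge[OF r(1,2,7) BS[OF r(3)] BS[OF r(4)] r(5,6) aS(1) BS[OF e(1)]] BD(2)[OF e(1)]
          notB r by auto
    qed
    have cB: "card (common a c) = 2" using Beq bb unfolding B_def by simp
    have sub: "{a, c} \<subseteq> common b b'" unfolding common_def using BD r ac by blast
    have "card (common b b') \<le> 2" using max[of b b'] BD r bb cB by auto
    then have eq: "common b b' = {a, c}" using card_seteq[OF finite_common sub] ac(3) by simp
    have "square adj lam K b b'"
    proof unfold_locales
      show "b \<in> K" "b' \<in> K" "b \<noteq> b'" using BD(1) r bb by simp_all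
      show two': "2 \<le> card (common b b')" using eq ac(3) by simp
      fix x y assume xy: "x \<in> K" "y \<in> K" 
      show "card (common x y) \<le> card (common b b')" if "x \<noteq> y"
        using max[OF xy that] cB two' by linarith
      show "\<not> adj z x" if "z \<in> K" "adj x y" "adj y z" for z
        using no3[OF xy that] .
    qed
    then interpret sq2: square adj lam K b b' .
    have B2: "sq2.B = {a, c}" unfolding sq2.B_def by (rule eq)
    have S2: "sq2.S = S" unfolding sq2.S_def B2 S_def Beq by auto
    have "square_ne adj lam K b b'"
    proof unfold_locales
      fix q q' x x'
      assume "q \<in> K - sq2.S" "q' \<in> K - sq2.S" "x \<in> sq2.B" "x' \<in> sq2.B" and q: "adj q x" "adj q' x'"
      then have qS: "q \<in> K - S" "q' \<in> K - S" and xx: "x \<in> {a, c}" "x' \<in> {a, c}" unfolding B2 S2 by auto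
      show "\<not> adj q q'"
      proof
        assume qq: "adj q q'"
        have no: "\<not> adj q r" "\<not> adj q r'" "\<not> adj q' r" "\<not> adj q' r'"
          using outside_edge_aB[OF qS(1) r(1) xx(1) q(1) r(3,5)] outside_edge_aB[OF qS(1) r(2) xx(1) q(1) r(4,6)]
            outside_edge_aB[OF qS(2) r(1) xx(2) q(2) r(3,5)] outside_edge_aB[OF qS(2) r(2) xx(2) q(2) r(4,6)]
          by blast+
        have "q \<noteq> r" "q \<noteq> r'" "q' \<noteq> r" "q' \<noteq> r'" using no r(7) qq adj_sym by blast+
        then show False using two_edges_meet[of q q' r r'] no qS r qq by blast
      qed
    qed
    then show False by (rule square_ne.contradiction)
  qed
qed

theorem tight_classification:
  "mult K = 2 \<and> ((\<exists>t. pendant_triangle K t) \<or> (\<exists>vs. five_cycle K vs \<and> lam\<^sup>2 + lam = 1))"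
proof (cases "\<exists>a b c. {a, b, c} \<subseteq> K \<and> adj a b \<and> adj b c \<and> adj c a")
  case True
  then show ?thesis using triangle_case by blast
next
  case False
  have no3: "\<not> adj z x" if "x \<in> K" "y \<in> K" "z \<in> K" "adj x y" "adj y z" for x y z
    using False that by (metis empty_subsetI insert_subset)
  have no3': "\<not> adj z x" if "{x, y, z} \<subseteq> K" "adj x y" "adj y z" for x y z
    using no3[of x y z] that by simp
  have no4: False if "{p, b, q, d} \<subseteq> K" "adj p b" "adj b q" "adj q d" "adj d p" "p \<noteq> q" "b \<noteq> d" for p b q d
    by (rule four_case[OF no3 that])
  show ?thesis
  proof (cases rule: short_cycle[OF fin con cyclic imn_lt, case_names three four five])
    case (three a b c)
    then show ?thesis using no3'[OF three(1,2,3)] by blast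
  next
    case (four a b c d)
    from no4[OF four] show ?thesis ..
  next
    case (five a b c d e)
    have "mult K = 2 \<and> five_cycle K [a, b, c, d, e] \<and> lam\<^sup>2 + lam = 1"
    proof (rule five_case[OF _ _ five])
      show "\<not> adj z x" if "{x, y, z} \<subseteq> K" "adj x y" "adj y z" for x y z
        by (rule no3'[OF that])
      show False if "{p, b, q, d} \<subseteq> K" "adj p b" "adj b q" "adj q d" "adj d p" "p \<noteq> q" "b \<noteq> d" for p b q d
        by (rule no4[OF that])
    qed
    then show ?thesis by blast
  qed
qed

end

section \<open>Extremal graphs with a Parter vertex\<close>

context spectral_adj
begin

lemma parter_strict:
  assumes "finite V" "conn V" "parter V w"
  shows "int (mult V) + 1 \<le> int (imn V) + cyc V"
proof -
  have w: "w \<in> V" using assms(3) unfolding parter_def by blast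
  have "int (mult (V - {w})) \<le> int (imn (V - {w})) + cyc (V - {w})"
    using mult_le_imn_cyc assms(1) by blast
  then show ?thesis
    using parter_mult[OF assms(1,3)] cyc_delete_le[OF assms(1,2) w] imn_mono[OF assms(1), of "V - {w}"]
    by fastforce
qed

lemma mult_from_deletion:
  assumes "finite V" "conn V" "2 \<le> imn V" "w \<in> V" "int (mult (V - {w})) = int (imn V) + cyc V"
  shows "int (mult V) = int (imn V) + cyc V - 1"
proof -
  have "int (mult V) \<noteq> int (imn V) + cyc V"
  proof
    assume eq: "int (mult V) = int (imn V) + cyc V"
    \<comment> \<open>Equality excludes Parter vertices, and then \<open>mult_le_cyc\<close>
      contradicts \<open>2 \<le> imn V\<close>.\<close>
    then have "\<not> parter V x" for x using parter_strict[OF assms(1,2)] by fastforce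
    then show False using mult_le_cyc[OF assms(1,2)] eq assms(3) by fastforce
  qed
  then show ?thesis
    using mult_le_imn_cyc[OF assms(1)] mult_delete_le[OF assms(1,4)] assms(5) by linarith
qed

end

context simple_adj
begin

definition nontrivial_comps :: "'a set \<Rightarrow> 'a set set" where
  "nontrivial_comps W = {K \<in> comps W. 2 \<le> card K}"

definition diam_le :: "'a set \<Rightarrow> nat \<Rightarrow> bool" where
  "diam_le W k \<longleftrightarrow> (\<forall>x\<in>W. \<forall>y\<in>W. \<exists>n\<le>k. (x, y) \<in> rel W ^^ n)"

lemma relpow_rel_sym: "(x, y) \<in> rel W ^^ n \<Longrightarrow> (y, x) \<in> rel W ^^ n"
proof (induction n arbitrary: y)
  case (Suc n)
  then obtain z where "(x, z) \<in> rel W ^^ n" "(z, y) \<in> rel W" by auto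
  then show ?case using Suc.IH relpow_Suc_I2 sym_rel symD by metis
qed auto

lemma relpow_rel_mono: "(x, y) \<in> rel A ^^ n \<Longrightarrow> A \<subseteq> B \<Longrightarrow> (x, y) \<in> rel B ^^ n"
proof (induction n arbitrary: y)
  case (Suc n)
  then obtain z where "(x, z) \<in> rel A ^^ n" "(z, y) \<in> rel A" by auto
  then show ?case using Suc.IH[of z] Suc.prems(2) rel_mono[of A B] by auto
qed simp

lemma conn_has_nb:
  assumes "conn K" "2 \<le> card K" "x \<in> K"
  obtains y where "y \<in> K" "adj x y"
proof -
  have "K \<noteq> {x}" using assms(2) by auto
  then show ?thesis using conn_boundary[OF assms(1), of "{x}"] assms(3) that by blast
qed

lemma trivial_comp:
  assumes "finite K" "conn K" "\<not> 2 \<le> card K"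
  obtains x where "K = {x}"
proof -
  have "card K \<noteq> 0" using assms unfolding conn_def by simp
  then have "card K = 1" using assms(3) by linarith
  then show ?thesis using that by (auto simp: card_1_singleton_iff)
qed

lemma singleton_edg: "edg {x} = {}"
  unfolding edg_def using adj_irrefl by blast

lemma singleton_cyc: "cyc {x} = 0"
proof -
  have "conn {x}" unfolding conn_def by simp
  then show ?thesis using conn_cyc singleton_edg by fastforce
qed

end

section \<open>Components of \<open>G - w\<close> in an extremal graph\<close>

locale extremal = spectral_adj +
  fixes V :: "'a set" and w
  assumes fin: "finite V" and con: "conn V" and imn3: "3 \<le> imn V"
    and mult_eq: "int (mult V) = int (imn V) + cyc V - 1" and w: "parter V w"
begin

definition "W = V - {w}"

lemma wV: "w \<in> V"
  using w unfolding parter_def by blast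

lemma finW: "finite W"
  unfolding W_def using fin by simp

text \<open>The chain \<open>mult V + 1 \<le> mult W \<le> imn W + cyc W \<le> imn V + cyc V\<close>
  has equal ends.\<close>

lemma delete_equalities:
  "int (mult W) = int (imn W) + cyc W" "imn W = imn V" "cyc W = cyc V"
proof -
  have "int (mult W) \<le> int (imn W) + cyc W" using mult_le_imn_cyc[OF finW] .
  moreover have "int (mult V) + 1 \<le> int (mult W)" using parter_mult[OF fin w] unfolding W_def by linarith
  moreover have "imn W \<le> imn V" unfolding W_def by (rule imn_mono[OF fin]) blast
  moreover have "cyc W \<le> cyc V" unfolding W_def by (rule cyc_delete_le[OF fin con wV])
  ultimately show "int (mult W) = int (imn W) + cyc W" "imn W = imn V" "cyc W = cyc V"
    using mult_eq by linarith+
qed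

lemma comp_finite: "K \<in> comps W \<Longrightarrow> finite K"
  using comps_subset finW finite_subset by blast

text \<open>Each component contributes a nonnegative defect to the bound, and the defects add up to
  zero.\<close>

lemma comp_equality:
  assumes "K \<in> comps W"
  shows "int (mult K) = int (imn K) + cyc K"
proof -
  have "(\<Sum>K\<in>comps W. int (imn K) + cyc K - int (mult K)) = 0"
    using delete_equalities(1) mult_sum[OF finW] imn_sum[OF finW] cyc_sum[OF finW]
    by (simp add: sum_subtractf sum.distrib)
  then have "int (imn K) + cyc K - int (mult K) = 0"
    using sum_nonneg_eq_0_iff[OF finite_comps[OF finW], of "\<lambda>K. int (imn K) + cyc K - int (mult K)"]
      mult_le_imn_cyc comp_finite assms by simp
  then show ?thesis by simp
qed

lemma nontrivialD:
  assumes "K \<in> nontrivial_comps W"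
  shows "K \<in> comps W" "2 \<le> card K" "finite K" "conn K" "K \<subseteq> W"
  using assms comp_finite comps_conn comps_subset unfolding nontrivial_comps_def by auto

text \<open>Equality in the bound leaves no Parter vertex by \<open>parter_strict\<close>.
  Comparison with \<open>mult_le_cyc\<close> then gives \<open>imn K \<le> 1\<close>, and an edge
  gives the converse.\<close>

lemma nontrivial_props:
  assumes K: "K \<in> nontrivial_comps W"
  shows "\<not> parter K x" "imn K = 1" "int (mult K) = cyc K + 1"
proof -
  note KD = nontrivialD[OF K]
  have np: "\<not> parter K x" for x
    using parter_strict[OF KD(3,4)] comp_equality[OF KD(1)] by fastforce
  obtain a where "a \<in> K" using KD(4) unfolding conn_def by blast
  then obtain b where "b \<in> K" "adj a b" using conn_has_nb[OF KD(4,2)] by blast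
  then have "1 \<le> imn K" using imn_pos[OF KD(3)] \<open>a \<in> K\<close> by blast
  then show "\<not> parter K x" "imn K = 1" "int (mult K) = cyc K + 1"
    using np mult_le_cyc[OF KD(3,4) np] comp_equality[OF KD(1)] by auto
qed

lemma nontrivial_diam: "K \<in> nontrivial_comps W \<Longrightarrow> diam_le K 3"
  unfolding diam_le_def using imn_one_diameter[of K] nontrivialD nontrivial_props(2) by simp

lemma nontrivial_cyclic:
  assumes K: "K \<in> nontrivial_comps W" and "cyc K \<noteq> 0"
  shows "cyc K = 1 \<and> mult K = 2 \<and>
    ((\<exists>t. pendant_triangle K t) \<or> (\<exists>vs. five_cycle K vs \<and> lam\<^sup>2 + lam = 1))"
proof -
  note KD = nontrivialD[OF K] and KP = nontrivial_props[OF K]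
  have "1 \<le> cyc K" using conn_cyc_nonneg[OF KD(3,4)] assms(2) by linarith
  then interpret tight adj lam K
    by unfold_locales (use KD KP in simp_all)
  show ?thesis using tight_classification KP(3) by simp
qed

lemma trivial_comps_props:
  assumes "K \<in> comps W" "K \<notin> nontrivial_comps W"
  shows "imn K = 0" "cyc K = 0"
proof -
  obtain x where "K = {x}"
    using trivial_comp[OF comp_finite comps_conn] assms unfolding nontrivial_comps_def by blast
  then show "imn K = 0" "cyc K = 0" using singleton_edg imn_no_edge singleton_cyc by auto
qed

lemma card_nontrivial: "card (nontrivial_comps W) = imn V"
proof -
  have "int (imn V) = (\<Sum>K\<in>comps W. int (imn K))"
    using imn_sum[OF finW] delete_equalities(2) by simp
  also have "\<dots> = (\<Sum>K\<in>nontrivial_comps W. int (imn K))"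
    by (rule sum.mono_neutral_right)
      (use finite_comps[OF finW] trivial_comps_props in \<open>auto simp: nontrivial_comps_def\<close>)
  also have "\<dots> = (\<Sum>K\<in>nontrivial_comps W. 1)"
    by (rule sum.cong) (use nontrivial_props(2) in simp_all)
  finally show ?thesis by simp
qed

lemma card_cyclic: "int (card {K \<in> nontrivial_comps W. cyc K \<noteq> 0}) = cyc V"
proof -
  have "cyc V = (\<Sum>K\<in>comps W. cyc K)"
    using cyc_sum[OF finW] delete_equalities(3) by simp
  also have "\<dots> = (\<Sum>K\<in>{K \<in> nontrivial_comps W. cyc K \<noteq> 0}. cyc K)"
    by (rule sum.mono_neutral_right)
      (use finite_comps[OF finW] trivial_comps_props in \<open>auto simp: nontrivial_comps_def\<close>)
  also have "\<dots> = (\<Sum>K\<in>{K \<in> nontrivial_comps W. cyc K \<noteq> 0}. 1)"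
    by (rule sum.cong) (use nontrivial_cyclic in auto)
  finally show ?thesis by simp
qed

lemma attachment: "K \<in> comps W \<Longrightarrow> \<exists>u. K \<inter> nb V w = {u}"
  using cyc_delete_eq[OF fin con wV] delete_equalities(3) unfolding W_def by blast

text \<open>Otherwise the edge \<open>w v\<close> together with one edge from every nontrivial component would form an
  induced matching that is too large.\<close>

lemma blocking_component:
  assumes v: "v \<in> nb V w"
  obtains K where "K \<in> nontrivial_comps W"
    "\<And>y z. y \<in> K - nb V w \<Longrightarrow> z \<in> K - nb V w \<Longrightarrow> adj y z \<Longrightarrow> adj v y \<or> adj v z"
proof (rule ccontr)
  assume "\<not> thesis"
  then have "\<forall>K\<in>nontrivial_comps W. \<exists>y z. y \<in> K - nb V w \<and> z \<in> K - nb V w \<and> adj y z \<and> \<not> adj v y \<and> \<not> adj v z"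
    using that by metis
  then obtain y z where yz: "\<And>K. K \<in> nontrivial_comps W \<Longrightarrow> y K \<in> K - nb V w \<and> z K \<in> K - nb V w \<and>
      adj (y K) (z K) \<and> \<not> adj v (y K) \<and> \<not> adj v (z K)" by metis
  let ?e = "\<lambda>K. {y K, z K}"
  let ?M = "insert {w, v} (?e ` nontrivial_comps W)"
  have eK: "x \<in> K \<and> x \<in> V \<and> x \<noteq> w \<and> x \<noteq> v \<and> \<not> adj w x \<and> \<not> adj v x \<and> \<not> adj x w \<and> \<not> adj x v"
    if K: "K \<in> nontrivial_comps W" and x: "x \<in> ?e K" for K x
  proof -
    have xK: "x \<in> K - nb V w" "\<not> adj v x" using yz[OF K] x by auto
    then have xV: "x \<in> V" "x \<noteq> w" using nontrivialD(5)[OF K] unfolding W_def by auto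
    then have "\<not> adj w x" using xK unfolding nb_def by blast
    moreover have "x \<noteq> v" using xK v by blast
    ultimately show ?thesis using xK xV adj_sym by blast
  qed
  have two: "x \<noteq> x' \<and> \<not> adj x x'"
    if "K \<in> nontrivial_comps W" "K' \<in> nontrivial_comps W" "K \<noteq> K'" "x \<in> ?e K" "x' \<in> ?e K'" for K K' x x'
    using comps_nonadj[OF nontrivialD(1)[OF that(1)] nontrivialD(1)[OF that(2)] that(3)] 
      eK[OF that(1,4)] eK[OF that(2,5)] by blast
  have side: "x \<noteq> x' \<and> \<not> adj x x' \<and> \<not> adj x' x"
    if "K \<in> nontrivial_comps W" "x' \<in> ?e K" "x \<in> {w, v}" for K x x'
  proof -
    have "x = w \<or> x = v" using that(3) by simp
    then show ?thesis using eK[OF that(1,2)] by (elim disjE) (simp_all add: eq_commute[of _ x'])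
  qed
  have wv: "adj w v" "v \<in> V" using v unfolding nb_def by auto
  have "imatch V ?M"
    unfolding imatch_def
  proof (intro conjI ballI impI)
    show "?M \<subseteq> edg V"
    proof
      fix e assume "e \<in> ?M"
      then consider "e = {w, v}" | K where "K \<in> nontrivial_comps W" "e = ?e K" by blast
      then show "e \<in> edg V"
      proof cases
        case 1
        then show ?thesis using wv wV by (simp add: edg_iff)
      next
        case 2
        then show ?thesis using eK[OF 2(1)] yz[OF 2(1)] by (simp add: edg_iff)
      qed
    qed
    fix e f x x' assume ef: "e \<in> ?M" "f \<in> ?M" "e \<noteq> f" "x \<in> e" "x' \<in> f"
    have "x \<noteq> x' \<and> \<not> adj x x'"
    proof (cases "e = {w, v}")
      case True
      then obtain K where "K \<in> nontrivial_comps W" "f = ?e K" using ef by blast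
      then show ?thesis using side[of K x' x] ef(4,5) True by simp
    next
      case False
      then obtain K where K: "K \<in> nontrivial_comps W" "e = ?e K" using ef by blast
      show ?thesis
      proof (cases "f = {w, v}")
        case True
        then show ?thesis using side[of K x x'] K ef(4,5) by (simp add: eq_commute[of x])
      next
        case False
        then obtain K' where K': "K' \<in> nontrivial_comps W" "f = ?e K'" using ef by blast
        then have "K \<noteq> K'" using K ef(3) by blast
        moreover have "x \<in> ?e K" "x' \<in> ?e K'" using ef(4,5) unfolding K(2) K'(2) .
        ultimately show ?thesis by (rule two[OF K(1) K'(1)])
      qed
    qed
    then show "x \<noteq> x'" "\<not> adj x x'" by simp_all
  qed
  then have "card ?M \<le> imn V" using imn_ge[OF fin] by blast
  moreover have "inj_on ?e (nontrivial_comps W)"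
  proof (rule inj_onI, rule ccontr)
    fix K K' assume "K \<in> nontrivial_comps W" "K' \<in> nontrivial_comps W" "?e K = ?e K'" "K \<noteq> K'"
    then show False using two[of K K' "y K" "y K"] by blast
  qed
  moreover have "{w, v} \<notin> ?e ` nontrivial_comps W" using eK by blast
  moreover have "finite (nontrivial_comps W)" unfolding nontrivial_comps_def using finite_comps[OF finW] by simp
  ultimately show False using card_nontrivial by (simp add: card_image)
qed

lemma star_at_attachment:
  assumes K: "K \<in> nontrivial_comps W" and u: "K \<inter> nb V w = {u}"
    and no: "\<And>y z. y \<in> K - {u} \<Longrightarrow> z \<in> K - {u} \<Longrightarrow> \<not> adj y z"
  shows "x \<in> K \<Longrightarrow> x \<noteq> u \<Longrightarrow> nb K x = {u}"
proof -
  assume x: "x \<in> K" "x \<noteq> u"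
  obtain y where y: "y \<in> K" "adj x y" using conn_has_nb[OF nontrivialD(4,2)[OF K] x(1)] .
  have "z = u" if "z \<in> nb K x" for z using no[of x z] that x unfolding nb_def by blast
  then show ?thesis using y unfolding nb_def by blast
qed

text \<open>\<open>K\<close> has a vertex besides its attachment, and that vertex is not adjacent to
  \<open>w\<close>. This turns a diameter of at most two into one of exactly two.\<close>

lemma not_diam_one:
  assumes K: "K \<in> nontrivial_comps W" 
  shows "\<not> diam_le (insert w K) 1"
proof
  assume d: "diam_le (insert w K) 1"
  obtain u where u: "K \<inter> nb V w = {u}" using attachment nontrivialD(1)[OF K] by blast
  have "\<not> K \<subseteq> {u}" using nontrivialD(2)[OF K] card_mono[of "{u}" K] by auto
  then obtain x where x: "x \<in> K" "x \<noteq> u" by blast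
  have "x \<in> V" "x \<noteq> w" using x nontrivialD(5)[OF K] unfolding W_def by auto
  then have "\<not> adj w x" using x u unfolding nb_def by blast
  moreover obtain n where n: "n \<le> 1" "(w, x) \<in> rel (insert w K) ^^ n"
    using d x(1) unfolding diam_le_def by blast
  then have "n = 0 \<or> n = 1" by linarith
  then have "w = x \<or> adj w x" using n(2) by (auto simp: rel_iff)
  ultimately show False using \<open>x \<noteq> w\<close> by blast
qed

lemma star_diam_two:
  assumes K: "K \<in> nontrivial_comps W" and u: "K \<inter> nb V w = {u}"
    and no: "\<And>y z. y \<in> K - {u} \<Longrightarrow> z \<in> K - {u} \<Longrightarrow> \<not> adj y z"
  shows "diam_le (insert w K) 2"
  unfolding diam_le_def
proof (intro ballI)
  let ?R = "rel (insert w K)"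
  have uK: "u \<in> K" "adj w u" using u unfolding nb_def by auto
  have nbx: "nb K x = {u}" if "x \<in> K" "x \<noteq> u" for x
    by (rule star_at_attachment[OF K u _ that]) (rule no)
  have near: "x = u \<or> (x, u) \<in> ?R \<and> (u, x) \<in> ?R" if "x \<in> insert w K" for x
  proof (cases "x = w")
    case True
    then show ?thesis using uK adj_sym by (simp add: rel_iff)
  next
    case False
    then have "x \<in> K" using that by blast
    then have "x = u \<or> adj x u" using nbx[of x] unfolding nb_def by blast
    then show ?thesis using \<open>x \<in> K\<close> uK adj_sym by (auto simp: rel_iff)
  qed
  fix x y assume x: "x \<in> insert w K" and y: "y \<in> insert w K"
  consider "x = u" "y = u" | "x = u" "(u, y) \<in> ?R" | "y = u" "(x, u) \<in> ?R" | "(x, u) \<in> ?R" "(u, y) \<in> ?R"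
    using near[OF x] near[OF y] by blast
  then show "\<exists>n\<le>2. (x, y) \<in> ?R ^^ n"
  proof cases
    case 1
    then show ?thesis by (intro exI[of _ 0]) simp
  next
    case 2
    then show ?thesis by (intro exI[of _ 1]) simp
  next
    case 3
    then show ?thesis by (intro exI[of _ 1]) simp
  next
    case 4
    then have "(x, y) \<in> ?R ^^ Suc 1" using relpow_Suc_I[of x u 1 ?R y] by simp
    then show ?thesis by (intro exI[of _ "Suc 1"]) simp
  qed
qed

text \<open>\<open>K\<close> is a star with centre \<open>u\<close>, so its nonzero eigenvalues are
  plus and minus the square root of the number of leaves. What matters later is that
  \<open>lam\<^sup>2\<close> is an integer.\<close>

lemma star_eigenvalue:
  assumes K: "K \<in> nontrivial_comps W" and u: "K \<inter> nb V w = {u}"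
    and no: "\<And>y z. y \<in> K - {u} \<Longrightarrow> z \<in> K - {u} \<Longrightarrow> \<not> adj y z"
  shows "lam\<^sup>2 = of_nat (card (K - {u}))"
proof -
  note KD = nontrivialD[OF K]
  have nbx: "nb K x = {u}" if "x \<in> K" "x \<noteq> u" for x
    by (rule star_at_attachment[OF K u _ that]) (rule no)
  have uK: "u \<in> K" using u by blast
  have "adj u x" if "x \<in> K" "x \<noteq> u" for x
    using nbx[OF that] adj_sym unfolding nb_def by blast
  then have nbu: "nb K u = K - {u}" unfolding nb_def using adj_irrefl by blast
  have "\<not> determining K {}"
    using mult_le[of "{}" K] nontrivial_props(3)[OF K] conn_cyc_nonneg[OF KD(3,4)] by auto
  then obtain f where f: "f \<in> eig K" "f \<noteq> (\<lambda>_. 0)" unfolding determining_def by blast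
  have fx: "f x = f u / lam" if "x \<in> K - {u}" for x
    using eig_eq[OF f(1), of x] nbx[of x] that lam_nz unfolding nsum_def by (simp add: field_simps)
  have "f u \<noteq> 0"
  proof
    assume "f u = 0"
    then have "f x = 0" for x using fx[of x] eig_outside[OF f(1), of x] by (cases "x \<in> K - {u}") auto
    then show False using f(2) by (simp add: fun_eq_iff)
  qed
  moreover have "(\<Sum>x\<in>K - {u}. f x) = of_nat (card (K - {u})) * (f u / lam)" using fx by simp
  then have "f u * lam\<^sup>2 = f u * of_nat (card (K - {u}))"
    using eig_eq[OF f(1) uK] lam_nz unfolding nsum_def nbu by (simp add: field_simps power2_eq_square)
  ultimately show ?thesis by simp
qed

text \<open>The side of the cycle opposite to the attachment \<open>v\<close> is not blocked by
  \<open>w v\<close>, so the blocking component is a different one. As \<open>v\<close> has no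
  neighbours there, it has no edge off its attachment and is a star.\<close>

lemma no_five_cycle:
  assumes K0: "K0 \<in> nontrivial_comps W" and five: "five_cycle K0 vs" and lam1: "lam\<^sup>2 + lam = 1"
  shows False
proof -
  obtain v where v: "K0 \<inter> nb V w = {v}" using attachment nontrivialD(1)[OF K0] by blast
  have vs: "length vs = 5" "distinct vs" "set vs = K0"
    "\<And>i. i < 5 \<Longrightarrow> nb K0 (vs ! i) = {vs ! ((i + 1) mod 5), vs ! ((i + 4) mod 5)}"
    using five unfolding five_cycle_def by auto
  obtain i where i: "i < 5" "v = vs ! i" using v vs(1,3) by (metis Int_iff in_set_conv_nth singletonI)
  \<comment> \<open>The two vertices of the cycle that are neither \<open>v\<close> nor adjacent to
    \<open>v\<close>.\<close>
  let ?p = "vs ! ((i + 2) mod 5)" and ?q = "vs ! ((i + 3) mod 5)"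
  have idx: "(i + k) mod 5 < 5" for k by simp
  have eqs: "vs ! ((i + j) mod 5) = vs ! ((i + k) mod 5) \<longleftrightarrow> (i + j) mod 5 = (i + k) mod 5" for j k
    using vs(1,2) idx by (simp add: nth_eq_iff_index_eq)
  have i0: "(i + 0) mod 5 = i" using i(1) by simp
  have i5: "i = 0 \<or> i = 1 \<or> i = 2 \<or> i = 3 \<or> i = 4" using i(1) by linarith
  have pq: "?p \<in> K0" "?q \<in> K0" using vs idx nth_mem by metis+
  have pqv: "?p \<noteq> v" "?q \<noteq> v"
    unfolding i(2) eqs[of 2 0, unfolded i0] eqs[of 3 0, unfolded i0]
    using i5 by (elim disjE; simp)+
  have "?p \<noteq> vs ! ((i + 1) mod 5)" "?p \<noteq> vs ! ((i + 4) mod 5)"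
    "?q \<noteq> vs ! ((i + 1) mod 5)" "?q \<noteq> vs ! ((i + 4) mod 5)"
    unfolding eqs using i5 by (elim disjE; simp)+
  then have nv: "?p \<notin> nb K0 v" "?q \<notin> nb K0 v"
    unfolding i(2) vs(4)[OF i(1)] by simp_all
  have "((i + 2) mod 5 + 1) mod 5 = (i + 3) mod 5" using i5 by (elim disjE; simp)
  then have "?q \<in> nb K0 ?p" unfolding vs(4)[OF idx] by simp
  then have adjpq: "adj ?p ?q" unfolding nb_def by blast
  have nadj: "\<not> adj v ?p" "\<not> adj v ?q" using nv pq unfolding nb_def by auto
  have "v \<in> nb V w" using v by blast
  then obtain K where K: "K \<in> nontrivial_comps W"
    "\<And>y z. y \<in> K - nb V w \<Longrightarrow> z \<in> K - nb V w \<Longrightarrow> adj y z \<Longrightarrow> adj v y \<or> adj v z"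
    using blocking_component by metis
  have pqn: "?p \<in> K0 - nb V w" "?q \<in> K0 - nb V w" using pq pqv v by blast+
  have "K \<noteq> K0" using K(2)[of ?p ?q] pqn adjpq nadj by blast
  then have nvK: "\<not> adj v y" if "y \<in> K" for y
    using comps_nonadj[OF nontrivialD(1)[OF K0] nontrivialD(1)[OF K(1)]] v that by blast
  obtain u where u: "K \<inter> nb V w = {u}" using attachment nontrivialD(1)[OF K(1)] by blast
  have "\<not> adj y z" if "y \<in> K - {u}" "z \<in> K - {u}" for y z
    using K(2)[of y z] nvK u that by blast
  then have "lam\<^sup>2 = of_nat (card (K - {u}))" by (rule star_eigenvalue[OF K(1) u])
  then obtain k :: int where k: "lam\<^sup>2 = of_int k" by (metis of_int_of_nat_eq)
  then have lam: "lam = of_int (1 - k)" using lam1 by (simp add: algebra_simps)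
  then have "of_int ((1 - k)\<^sup>2) = (of_int k :: complex)" using k by simp
  then have "(1 - k)\<^sup>2 = k" using of_int_eq_iff by blast
  \<comment> \<open>With \<open>k = lam\<^sup>2\<close> this is
    \<open>k\<^sup>2 - 3 * k + 1 = 0\<close>, so \<open>k\<close> divides one.\<close>
  then have *: "k * (3 - k) = 1" by (simp add: power2_eq_square algebra_simps)
  then have "k dvd 1" by (metis dvd_triv_left)
  then have "k = 1 \<or> k = -1" by auto
  then show False using * by auto
qed

text \<open>If no component has diameter two with \<open>w\<close>, every nontrivial one has an edge
  off its attachment. Then the edge from \<open>w\<close> to \<open>v\<close> can be blocked only by
  the component of \<open>v\<close> itself, which excludes isolated vertices and vertices at
  distance four from \<open>w\<close>.\<close>

lemma diameter_condition:
  "(\<exists>K\<in>nontrivial_comps W. diam_le (insert w K) 2 \<and> \<not> diam_le (insert w K) 1) \<or>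
   ((\<forall>K\<in>comps W. 2 \<le> card K) \<and>
    (\<forall>K\<in>nontrivial_comps W. diam_le (insert w K) 3 \<and> \<not> diam_le (insert w K) 2))"
proof (rule disjCI)
  assume "\<not> ((\<forall>K\<in>comps W. 2 \<le> card K) \<and>
    (\<forall>K\<in>nontrivial_comps W. diam_le (insert w K) 3 \<and> \<not> diam_le (insert w K) 2))"
  moreover have False if none: "\<not> (\<exists>K\<in>nontrivial_comps W. diam_le (insert w K) 2 \<and> \<not> diam_le (insert w K) 1)"
    and case2: "\<not> ((\<forall>K\<in>comps W. 2 \<le> card K) \<and>
      (\<forall>K\<in>nontrivial_comps W. diam_le (insert w K) 3 \<and> \<not> diam_le (insert w K) 2))"
  proof -
    have not2: "\<not> diam_le (insert w K) 2" if "K \<in> nontrivial_comps W" for K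
      using none not_diam_one that by blast
    \<comment> \<open>Without such an edge \<open>K\<close> would be a star at its attachment,
      covered by \<open>star_diam_two\<close>.\<close>
    have edge: "\<exists>y z. y \<in> K - nb V w \<and> z \<in> K - nb V w \<and> adj y z" if K: "K \<in> nontrivial_comps W" for K
    proof (rule ccontr)
      assume no: "\<not> (\<exists>y z. y \<in> K - nb V w \<and> z \<in> K - nb V w \<and> adj y z)"
      obtain u where u: "K \<inter> nb V w = {u}" using attachment nontrivialD(1)[OF K] by blast
      have "\<not> adj y z" if "y \<in> K - {u}" "z \<in> K - {u}" for y z using no u that by blast
      then show False using star_diam_two[OF K u] not2[OF K] by blast
    qed
    \<comment> \<open>The hypothesis on \<open>L\<close> says that \<open>L\<close> does not block
      \<open>w v\<close>. In any other component \<open>v\<close> has no neighbours, so the edge off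
      its attachment is not blocked either.\<close>
    have nosep: False 
      if v: "v \<in> nb V w" "v \<in> L" "L \<in> comps W" 
        and L: "L \<in> nontrivial_comps W \<Longrightarrow> \<exists>y z. y \<in> L - nb V w \<and> z \<in> L - nb V w \<and> adj y z \<and> \<not> adj v y \<and> \<not> adj v z"
      for v L
    proof -
      obtain K where K: "K \<in> nontrivial_comps W"
        "\<And>y z. y \<in> K - nb V w \<Longrightarrow> z \<in> K - nb V w \<Longrightarrow> adj y z \<Longrightarrow> adj v y \<or> adj v z"
        using blocking_component[OF v(1)] by metis
      have "K \<noteq> L" using K L by blast
      then have "\<not> adj v y" if "y \<in> K" for y
        using comps_nonadj[OF v(3) nontrivialD(1)[OF K(1)]] v(2) that by blast
      then show False using edge[OF K(1)] K(2) by blast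
    qed
    have all: "2 \<le> card K" if K: "K \<in> comps W" for K
    proof (rule ccontr)
      assume "\<not> 2 \<le> card K"
      moreover obtain u where u: "K \<inter> nb V w = {u}" using attachment[OF K] by blast
      ultimately show False using nosep[of u K] K unfolding nontrivial_comps_def by blast
    qed
    obtain K where K: "K \<in> nontrivial_comps W" "\<not> diam_le (insert w K) 3"
      using case2 all not2 by blast
    let ?R = "rel (insert w K)"
    obtain u where u: "K \<inter> nb V w = {u}" using attachment nontrivialD(1)[OF K(1)] by blast
    have uK: "u \<in> K" "u \<in> nb V w" "adj w u" using u unfolding nb_def by auto
    obtain x y where xy: "x \<in> insert w K" "y \<in> insert w K" "\<And>n. n \<le> 3 \<Longrightarrow> (x, y) \<notin> ?R ^^ n"
      using K(2) unfolding diam_le_def by blast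
    have sub: "rel K ^^ n \<subseteq> ?R ^^ n" for n using relpow_rel_mono[OF _ subset_insertI] by auto
    \<comment> \<open>Distances inside \<open>K\<close> are at most three, so a pair that is further
      apart contains \<open>w\<close>.\<close>
    have "\<not> (x \<in> K \<and> y \<in> K)" using nontrivial_diam[OF K(1)] xy(3) sub unfolding diam_le_def by blast
    moreover have "x \<noteq> y" using xy(3)[of 0] by auto
    ultimately obtain z where z: "z \<in> K" "\<And>n. n \<le> 3 \<Longrightarrow> (w, z) \<notin> ?R ^^ n"
      using xy relpow_rel_sym by (metis insertE)
    have wu: "(w, u) \<in> ?R" using uK by (simp add: rel_iff)
    have uz: "(u, z) \<notin> ?R ^^ n" if "n \<le> 2" for n
    proof
      assume "(u, z) \<in> ?R ^^ n"
      then have "(w, z) \<in> ?R ^^ Suc n" using wu relpow_Suc_I2 by metis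
      then show False using z(2)[of "Suc n"] that by simp
    qed
    obtain n where n: "n \<le> 3" "(u, z) \<in> rel K ^^ n"
      using nontrivial_diam[OF K(1)] uK(1) z(1) unfolding diam_le_def by blast
    have "\<not> n \<le> 2" using uz n(2) sub by blast
    then have "n = Suc (Suc (Suc 0))" using n(1) by linarith
    then obtain p q where pq: "(u, p) \<in> rel K" "(p, q) \<in> rel K" "(q, z) \<in> rel K" using n(2) by auto
    \<comment> \<open>The last edge \<open>q z\<close> of the walk avoids \<open>u\<close> and its
      neighbours, so \<open>nosep\<close> applies at \<open>u\<close>.\<close>
    have qK: "q \<in> K" "adj q z" using pq by (auto simp: rel_iff)
    have qzR: "(q, z) \<in> ?R" using qK z(1) by (simp add: rel_iff)
    have "z \<noteq> u" using uz[of 0] by auto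
    moreover have "\<not> adj u z" using uz[of 1] uK(1) z(1) by (auto simp: rel_iff)
    moreover have "q \<noteq> u" using uz[of 1] qzR by auto
    moreover have "\<not> adj u q"
    proof
      assume "adj u q"
      then have "(u, q) \<in> ?R" using uK(1) qK(1) by (simp add: rel_iff)
      then have "(u, z) \<in> ?R ^^ Suc 1" using qzR relpow_Suc_I[of u q 1 ?R z] by simp
      then show False using uz[of "Suc 1"] by simp
    qed
    ultimately show False 
      using nosep[OF uK(2,1) nontrivialD(1)[OF K(1)]] qK z(1) u by blast
  qed
  ultimately show "\<exists>K\<in>nontrivial_comps W. diam_le (insert w K) 2 \<and> \<not> diam_le (insert w K) 1" by blast
qed

lemma nontrivial_classification:
  assumes K: "K \<in> nontrivial_comps W"
  shows "cyc K \<noteq> 0 \<and> mult K = 2 \<and> (\<exists>t. pendant_triangle K t) \<or> cyc K = 0 \<and> mult K = 1"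
  using nontrivial_cyclic[OF K] nontrivial_props(3)[OF K] no_five_cycle[OF K] by fastforce

end

context spectral_adj
begin

theorem extremal_exists:
  assumes "finite V" "conn V" "3 \<le> imn V" "int (mult V) = int (imn V) + cyc V - 1"
  shows "\<exists>w. extremal adj lam V w"
proof -
  have "\<exists>w. parter V w"
  proof (rule ccontr)
    assume "\<not> (\<exists>w. parter V w)"
    then show False using mult_le_cyc[OF assms(1,2)] assms(3,4) by fastforce
  qed
  then obtain w where "parter V w" by blast
  then have "extremal adj lam V w" by unfold_locales (use assms in simp_all)
  then show ?thesis by blast
qed

end

section \<open>Multiplicity as order of the characteristic polynomial\<close>

lemma conjugate_mult_mat_vec_real:
  fixes X :: "complex mat"
  assumes X: "X \<in> carrier_mat n n" and real: "\<And>i j. i < n \<Longrightarrow> j < n \<Longrightarrow> cnj (X $$ (i, j)) = X $$ (i, j)"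
    and v: "v \<in> carrier_vec n"
  shows "conjugate (X *\<^sub>v v) = X *\<^sub>v conjugate v"
proof (rule eq_vecI)
  fix i assume "i < dim_vec (X *\<^sub>v conjugate v)"
  then have i: "i < n" using X by simp
  have "conjugate (X *\<^sub>v v) $ i = cnj (\<Sum>j\<in>{0..<n}. X $$ (i, j) * v $ j)"
    using i X v by (simp add: scalar_prod_def)
  also have "\<dots> = (\<Sum>j\<in>{0..<n}. X $$ (i, j) * cnj (v $ j))"
    using i real by simp
  also have "\<dots> = (X *\<^sub>v conjugate v) $ i"
    using i X v by (simp add: scalar_prod_def)
  finally show "conjugate (X *\<^sub>v v) $ i = (X *\<^sub>v conjugate v) $ i" .
qed (use X v in simp)

text \<open>For \<open>u = X v\<close>, symmetry moves one \<open>X\<close> across the scalar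
  product of \<open>u\<close> with its conjugate, and realness turns \<open>X u = 0\<close> into
  \<open>X (conjugate u) = 0\<close>; hence \<open>u\<close> has norm zero.\<close>

lemma mat_kernel_square_real_symmetric:
  fixes X :: "complex mat"
  assumes X: "X \<in> carrier_mat n n" and real: "\<And>i j. i < n \<Longrightarrow> j < n \<Longrightarrow> cnj (X $$ (i, j)) = X $$ (i, j)"
    and sym: "transpose_mat X = X"
  shows "mat_kernel (X * X) = mat_kernel X"
proof
  show "mat_kernel X \<subseteq> mat_kernel (X * X)" by (rule mat_kernel_mult_subset[OF X X])
  show "mat_kernel (X * X) \<subseteq> mat_kernel X"
  proof
    fix v assume "v \<in> mat_kernel (X * X)"
    then have v: "v \<in> carrier_vec n" and XXv: "X * X *\<^sub>v v = 0\<^sub>v n"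
      using mat_kernelD[of "X * X" n n v] X by auto
    define u where "u = X *\<^sub>v v"
    have u: "u \<in> carrier_vec n" "conjugate u \<in> carrier_vec n" unfolding u_def using X v by auto
    have "X *\<^sub>v u = 0\<^sub>v n" unfolding u_def using XXv X v by simp
    then have "conjugate (X *\<^sub>v u) = 0\<^sub>v n" by simp
    then have Xcu: "X *\<^sub>v conjugate u = 0\<^sub>v n"
      using conjugate_mult_mat_vec_real[OF X real u(1)] by simp
    have "u \<bullet>c u = (transpose_mat X *\<^sub>v v) \<bullet> conjugate u" unfolding sym u_def ..
    also have "\<dots> = v \<bullet> (X *\<^sub>v conjugate u)" by (rule transpose_vec_mult_scalar[OF X u(2) v])
    also have "\<dots> = 0" unfolding Xcu using v by simp
    finally have "u = 0\<^sub>v n" using conjugate_square_eq_0_vec[OF u(1)] by simp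
    then show "v \<in> mat_kernel X" unfolding u_def using mat_kernelI[OF X v] by blast
  qed
qed

text \<open>For the Jordan block sizes of one eigenvalue these sums are the kernel dimensions of the
  second and the first power; if they agree, no block is larger than one.\<close>

lemma sum_list_min_one_two:
  "(\<Sum>n\<leftarrow>ns. min 2 n) = (\<Sum>n\<leftarrow>ns. min 1 n) \<Longrightarrow> sum_list ns = (\<Sum>n\<leftarrow>ns. min 1 (n::nat))"
proof (induction ns)
  case (Cons n ns)
  have le: "(\<Sum>n\<leftarrow>ns. min 1 n) \<le> (\<Sum>n\<leftarrow>ns. min 2 n)" by (rule sum_list_mono) simp
  have "min 2 n + (\<Sum>n\<leftarrow>ns. min 2 n) = min 1 n + (\<Sum>n\<leftarrow>ns. min 1 n)" using Cons.prems by simp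
  then have "(\<Sum>n\<leftarrow>ns. min 2 n) = (\<Sum>n\<leftarrow>ns. min 1 n)" "min 2 n = min 1 n"
    using le by (simp_all add: min_def split: if_splits)
  then show ?case using Cons.IH by (simp add: min_def split: if_splits)
qed simp

text \<open>All Jordan blocks of a real symmetric matrix have size one.\<close>

lemma order_char_poly_real_symmetric:
  fixes C :: "complex mat"
  assumes C: "C \<in> carrier_mat n n" and real: "\<And>i j. i < n \<Longrightarrow> j < n \<Longrightarrow> cnj (C $$ (i, j)) = C $$ (i, j)"
    and sym: "transpose_mat C = C" and ev: "cnj ev = ev"
  shows "Polynomial.order ev (char_poly C) = kernel_dim (char_matrix C ev)"
proof -
  let ?X = "char_matrix C ev"
  have X: "?X \<in> carrier_mat n n" using C unfolding char_matrix_def by simp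
  have "cnj (?X $$ (i, j)) = ?X $$ (i, j)" if "i < n" "j < n" for i j
    using that C real ev unfolding char_matrix_def by auto
  moreover have "transpose_mat ?X = ?X"
  proof (rule eq_matI)
    fix i j assume "i < dim_row ?X" "j < dim_col ?X"
    then have ij: "i < n" "j < n" using X by auto
    have "C $$ (i, j) = C $$ (j, i)" using arg_cong[OF sym, of "\<lambda>M. M $$ (i, j)"] C ij by simp
    then show "transpose_mat ?X $$ (i, j) = ?X $$ (i, j)" using C ij unfolding char_matrix_def by auto
  qed (use X in auto)
  ultimately have ker: "mat_kernel (?X * ?X) = mat_kernel ?X"
    using mat_kernel_square_real_symmetric[OF X] by blast
  obtain as where "char_poly C = (\<Prod>a\<leftarrow>as. [:- a, 1:])" using char_poly_factorized[OF C] by blast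
  then obtain n_as where jnf: "jordan_nf C n_as" using jordan_nf_exists[OF C] by blast
  let ?ns = "map fst (filter (\<lambda>(n, e). e = ev) n_as)"
  have pow: "?X ^\<^sub>m 1 = ?X" "?X ^\<^sub>m 2 = ?X * ?X" using X by (auto simp: numeral_2_eq_2)
  have "dim_gen_eigenspace C ev 2 = dim_gen_eigenspace C ev 1"
    unfolding dim_gen_eigenspace_def pow kernel_dim_def ker using X by simp
  then have "sum_list ?ns = (\<Sum>n\<leftarrow>?ns. min 1 n)"
    using sum_list_min_one_two unfolding dim_gen_eigenspace[OF jnf] by blast
  also have "\<dots> = kernel_dim ?X"
    using dim_gen_eigenspace[OF jnf, of ev 1] unfolding dim_gen_eigenspace_def pow by simp
  finally show ?thesis
    unfolding jordan_nf_order[OF jnf] by (simp add: case_prod_unfold)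
qed

context spectral_adj
begin

text \<open>Listing values along \<open>vs\<close> is the map \<open>\<phi>\<close>; it identifies
  \<open>eig W\<close> with the kernel and sends the dual basis of a minimal determining set to a
  basis of the kernel.\<close>

lemma kernel_dim_eq_mult:
  fixes vs :: "'a list"
  assumes vs: "distinct vs" "set vs = W" and n: "n = length vs"
    and X: "X = mat n n (\<lambda>(i, j). (if adj (vs ! i) (vs ! j) then 1 else 0) - (if i = j then lam else 0))"
  shows "kernel_dim X = mult W"
proof -
  define \<phi> where "\<phi> f = vec n (\<lambda>i. f (vs ! i))" for f :: "'a \<Rightarrow> complex"
  have Xc: "X \<in> carrier_mat n n" unfolding X by simp
  interpret kernel n n X by unfold_locales (rule Xc)
  have W: "W = (!) vs ` {0..<n}" using vs n by (auto simp: set_conv_nth)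
  have inj: "inj_on ((!) vs) {0..<n}" using vs(1) n by (simp add: inj_on_def nth_eq_iff_index_eq)
  have finW: "finite W" using vs(2) by auto
  have vsW: "vs ! i \<in> W" if "i < n" for i using that vs n by auto
  have X\<phi>: "(X *\<^sub>v \<phi> f) $ i = nsum W f (vs ! i) - lam * f (vs ! i)" if i: "i < n" for f i
  proof -
    have "nsum W f (vs ! i) = (\<Sum>u\<in>W. if adj (vs ! i) u then f u else 0)"
      unfolding nsum_def nb_def by (rule sum.inter_filter[OF finW])
    also have "\<dots> = (\<Sum>j\<in>{0..<n}. if adj (vs ! i) (vs ! j) then f (vs ! j) else 0)"
      unfolding W using sum.reindex[OF inj] by (simp add: o_def)
    finally have ns: "nsum W f (vs ! i) = (\<Sum>j\<in>{0..<n}. if adj (vs ! i) (vs ! j) then f (vs ! j) else 0)" .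
    have "(X *\<^sub>v \<phi> f) $ i = (\<Sum>j\<in>{0..<n}. X $$ (i, j) * f (vs ! j))"
      using i Xc unfolding \<phi>_def by (simp add: scalar_prod_def)
    also have "\<dots> = (\<Sum>j\<in>{0..<n}. (if adj (vs ! i) (vs ! j) then f (vs ! j) else 0)
        - (if j = i then lam * f (vs ! i) else 0))"
      by (rule sum.cong) (use i in \<open>auto simp: X algebra_simps\<close>)
    also have "\<dots> = nsum W f (vs ! i) - lam * f (vs ! i)"
      unfolding ns using i by (simp add: sum_subtractf)
    finally show ?thesis .
  qed
  have \<phi>_ker: "\<phi> f \<in> mat_kernel X" if f: "f \<in> eig W" for f
  proof (rule mat_kernelI[OF Xc])
    show "X *\<^sub>v \<phi> f = 0\<^sub>v n"
      by (rule eq_vecI) (use Xc X\<phi> eig_eq[OF f] vsW in auto)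
  qed (simp add: \<phi>_def)
  have ker_\<phi>: "\<exists>f\<in>eig W. v = \<phi> f" if v: "v \<in> mat_kernel X" for v
  proof -
    have vc: "v \<in> carrier_vec n" "X *\<^sub>v v = 0\<^sub>v n" using mat_kernelD[OF Xc v] by auto
    define f where "f w = (if w \<in> W then v $ (inv_into {0..<n} ((!) vs) w) else 0)" for w
    have fv: "f (vs ! i) = v $ i" if "i < n" for i
      using that vsW inv_into_f_f[OF inj, of i] unfolding f_def by simp
    then have v\<phi>: "v = \<phi> f" unfolding \<phi>_def using vc by (intro eq_vecI) auto
    have "f \<in> eig W"
    proof (rule eigI)
      fix w assume "w \<in> W"
      then obtain i where i: "i < n" "w = vs ! i" unfolding W by auto
      have "(X *\<^sub>v \<phi> f) $ i = 0" using vc(2) v\<phi> i by simp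
      then show "nsum W f w = lam * f w" using X\<phi>[OF i(1)] i(2) by simp
    qed (simp add: f_def)
    then show ?thesis using v\<phi> by blast
  qed
  obtain Z where Z: "Z \<subseteq> W" "determining W Z" "card Z = mult W" using mult_ex by blast
  have finZ: "finite Z" using Z(1) finW finite_subset by blast
  obtain b where b: "\<And>z. z \<in> Z \<Longrightarrow> b z \<in> eig W"
    "\<And>z y. z \<in> Z \<Longrightarrow> y \<in> Z \<Longrightarrow> b z y = (if y = z then 1 else 0)"
    "\<And>f. f \<in> eig W \<Longrightarrow> f = (\<lambda>v. \<Sum>z\<in>Z. f z * b z v)"
    using dual_basis[OF finW Z] by blast
  let ?B = "(\<lambda>z. \<phi> (b z)) ` Z"
  have sub: "?B \<subseteq> mat_kernel X" using \<phi>_ker b(1) by blast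
  have at: "\<phi> f $ i = f (vs ! i)" if "i < n" for f i using that unfolding \<phi>_def by simp
  have index: "\<exists>i<n. vs ! i = y" if "y \<in> Z" for y
  proof -
    have "y \<in> (!) vs ` {0..<n}" using that Z(1) W by blast
    then show ?thesis by auto
  qed
  have injB: "inj_on (\<lambda>z. \<phi> (b z)) Z"
  proof (rule inj_onI)
    fix y z assume y: "y \<in> Z" and z: "z \<in> Z" and eq: "\<phi> (b y) = \<phi> (b z)"
    obtain i where i: "i < n" "vs ! i = y" using index[OF y] by blast
    have "b y y = b z y" using arg_cong[OF eq, of "\<lambda>v. v $ i"] at[OF i(1)] i(2) by simp
    then show "y = z" using b(2)[OF y y] b(2)[OF z y] by (simp split: if_splits)
  qed
  have lc: "lincomb a ?B $ i = (\<Sum>z\<in>Z. a (\<phi> (b z)) * b z (vs ! i))" if i: "i < n" for a i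
  proof -
    have "lincomb a ?B $ i = (\<Sum>v\<in>?B. a v * v $ i)" by (rule lincomb_index[OF i sub])
    also have "\<dots> = (\<Sum>z\<in>Z. a (\<phi> (b z)) * \<phi> (b z) $ i)" by (simp add: sum.reindex[OF injB])
    finally show ?thesis using at[OF i] by simp
  qed
  have finB: "finite ?B" using finZ by simp
  have "basis ?B"
    unfolding Ker.basis_def
  proof (intro conjI)
    show "\<not> lin_dep ?B"
    proof (rule Ker.finite_lin_indpt2[OF finB sub])
      fix a assume zero: "lincomb a ?B = 0\<^sub>v n"
      show "\<forall>v\<in>?B. a v = 0"
      proof
        fix v assume "v \<in> ?B"
        then obtain y where y: "y \<in> Z" "v = \<phi> (b y)" by blast
        obtain i where i: "i < n" "vs ! i = y" using index[OF y(1)] by blast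
        have "(\<Sum>z\<in>Z. a (\<phi> (b z)) * b z y) = 0" using lc[OF i(1), of a] zero i by simp
        moreover have "(\<Sum>z\<in>Z. a (\<phi> (b z)) * b z y) = (\<Sum>z\<in>Z. if z = y then a (\<phi> (b z)) else 0)"
          by (rule sum.cong) (use b(2) y(1) in auto)
        ultimately show "a v = 0" using y finZ by simp
      qed
    qed
    show "span ?B = mat_kernel X"
    proof
      show "span ?B \<subseteq> mat_kernel X" using sub by (rule Ker.span_is_subset2)
      show "mat_kernel X \<subseteq> span ?B"
      proof
        fix v assume v: "v \<in> mat_kernel X"
        then obtain f where f: "f \<in> eig W" "v = \<phi> f" using ker_\<phi> by blast
        define a where "a u = f (inv_into Z (\<lambda>z. \<phi> (b z)) u)" for u
        have a: "a (\<phi> (b z)) = f z" if "z \<in> Z" for z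
          unfolding a_def using inv_into_f_f[OF injB that] by simp
        have dim: "dim_vec (lincomb a ?B) = n"
          using Ker.lincomb_closed[OF sub] Xc unfolding mat_kernel_def by auto
        have "v = lincomb a ?B"
        proof (rule eq_vecI)
          fix i assume "i < dim_vec (lincomb a ?B)"
          then have i: "i < n" using dim by simp
          have "lincomb a ?B $ i = (\<Sum>z\<in>Z. f z * b z (vs ! i))" unfolding lc[OF i] using a by simp
          also have "\<dots> = f (vs ! i)" using fun_cong[OF b(3)[OF f(1)], of "vs ! i"] by simp
          finally show "v $ i = lincomb a ?B $ i" using f(2) at[OF i] by simp
        qed (use dim f(2) in \<open>simp add: \<phi>_def\<close>)
        then show "v \<in> span ?B" unfolding Ker.span_def using finB by auto
      qed
    qed
    show "?B \<subseteq> mat_kernel X" by (rule sub)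
  qed
  then have "dim = card ?B" using Ker.dim_basis[OF finB] by blast
  then show ?thesis using Z(3) card_image[OF injB] by simp
qed

theorem order_char_poly_eq_mult:
  fixes vs :: "'a list"
  assumes vs: "distinct vs" "set vs = W" and n: "n = length vs" and lam: "lam = complex_of_real \<theta>"
    and A: "A = mat n n (\<lambda>(i, j). if adj (vs ! i) (vs ! j) then 1 else (0::real))"
  shows "Polynomial.order \<theta> (char_poly A) = mult W"
proof -
  let ?C = "map_mat complex_of_real A"
  have Ac: "A \<in> carrier_mat n n" unfolding A by simp
  have C: "?C \<in> carrier_mat n n" using Ac by simp
  interpret of_real_poly: map_poly_inj_idom_divide_hom complex_of_real ..
  have "Polynomial.order \<theta> (char_poly A) = Polynomial.order lam (map_poly complex_of_real (char_poly A))"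
    unfolding lam by (rule of_real_poly.order_hom[symmetric])
  also have "\<dots> = Polynomial.order lam (char_poly ?C)"
    by (simp add: of_real_hom.char_poly_hom[OF Ac])
  also have "\<dots> = kernel_dim (char_matrix ?C lam)"
  proof (rule order_char_poly_real_symmetric[OF C])
    show "transpose_mat ?C = ?C" by (rule eq_matI) (auto simp: A adj_comm)
  qed (use Ac in \<open>auto simp: lam\<close>)
  also have "char_matrix ?C lam =
    mat n n (\<lambda>(i, j). (if adj (vs ! i) (vs ! j) then 1 else 0) - (if i = j then lam else 0))"
    by (rule eq_matI) (auto simp: char_matrix_def A)
  also have "kernel_dim \<dots> = mult W"
    by (rule kernel_dim_eq_mult[OF vs n refl])
  finally show ?thesis .
qed

end

section \<open>Induced subgraphs of digraphs\<close>

context simple_adj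
begin

text \<open>This is the form in which \<open>pre_digraph.sccs\<close> describes components: as
  maximal connected induced subgraphs.\<close>

lemma comps_iff_maximal:
  "K \<in> comps U \<longleftrightarrow> K \<subseteq> U \<and> conn K \<and> \<not> (\<exists>K'\<subseteq>U. conn K' \<and> K \<subset> K')"
proof
  assume K: "K \<in> comps U"
  have "K' \<subseteq> K" if K': "K' \<subseteq> U" "conn K'" "K \<subset> K'" for K'
  proof (rule ccontr)
    assume "\<not> K' \<subseteq> K"
    then have "K \<noteq> K'" "K \<noteq> {}" "K \<subseteq> K'" using comps_conn[OF K] K'(3) unfolding conn_def by auto
    then obtain u v where "u \<in> K" "v \<in> K' - K" "adj u v" using conn_boundary[OF K'(2)] by metis
    then show False using comps_step[OF K] K'(1) by blast
  qed
  then show "K \<subseteq> U \<and> conn K \<and> \<not> (\<exists>K'\<subseteq>U. conn K' \<and> K \<subset> K')"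
    using comps_subset[OF K] comps_conn[OF K] by blast
next
  assume K: "K \<subseteq> U \<and> conn K \<and> \<not> (\<exists>K'\<subseteq>U. conn K' \<and> K \<subset> K')"
  then obtain v where v: "v \<in> K" unfolding conn_def by blast
  then have vU: "v \<in> U" using K by blast
  have "K \<subseteq> comp_of U v"
  proof
    fix x assume x: "x \<in> K"
    then have "(v, x) \<in> (rel K)\<^sup>*" using K v unfolding conn_def by blast
    then have "(v, x) \<in> (rel U)\<^sup>*" using rtrancl_mono[OF rel_mono[of K U]] K by blast
    then show "x \<in> comp_of U v" using x K unfolding comp_of_def by blast
  qed
  then have "K = comp_of U v" using K conn_comp_of[OF vU] comp_of_subset[of U v] by blast
  then show "K \<in> comps U" unfolding comps_def using vU by blast
qed

text \<open>The closed walk \<open>u, q, u\<close> would use one edge twice, hence the condition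
  \<open>qs \<noteq> []\<close>.\<close>

lemma card_wedges_cycle:
  assumes "distinct (u # q # qs)" "qs \<noteq> []"
  shows "card (wedges u (q # qs) u) = length qs + 2"
proof -
  have "{u, q} \<notin> wedges q qs u"
  proof
    assume "{u, q} \<in> wedges q qs u"
    then have "{q, u} \<in> wedges q qs u" by (simp add: insert_commute)
    then have "u = hd (qs @ [u])" using wedges_start assms(1) by auto
    then show False using assms by (cases qs) auto
  qed
  then show ?thesis using card_wedges[of q qs u] assms(1) finite_wedges by auto
qed

text \<open>A cycle has as many edges as vertices, whereas a connected graph with
  \<open>cyc K = 0\<close> has one edge fewer; this contradicts monotonicity of the edge
  excess.\<close>

lemma cycle_cyc:
  assumes "finite K" "conn K" "distinct (u # qs)" "2 \<le> length qs" "wedges u qs u \<subseteq> edg K"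
  shows "1 \<le> cyc K"
proof -
  obtain q qs' where qs: "qs = q # qs'" "qs' \<noteq> []"
    using assms(4) by (cases qs; cases "tl qs") auto
  have sub: "\<Union> (wedges x ys b) = insert x (insert b (set ys))" for x ys b
    by (induction ys arbitrary: x) auto
  have K: "set (u # qs) \<subseteq> K" 
    using sub[of u qs u] assms(5) edg_subset_Pow[of K] by auto
  have "wedges u qs u \<subseteq> edg (set (u # qs))"
  proof
    fix e assume e: "e \<in> wedges u qs u"
    then obtain x y where "e = {x, y}" "adj x y" using assms(5) edgE by (metis subsetD)
    then show "e \<in> edg (set (u # qs))" using wedges_subset[OF e] by (simp add: edg_iff)
  qed
  then have "int (card (wedges u qs u)) - int (card (set (u # qs))) \<le> int (card (edg K)) - int (card K)"
    using subgraph_edge_excess[OF assms(1,2) K] by simp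
  moreover have "card (wedges u qs u) = length qs + 1"
    using card_wedges_cycle[of u q qs'] assms(3) qs by simp
  moreover have "card (set (u # qs)) = length qs + 1" using distinct_card[OF assms(3)] by simp
  ultimately show ?thesis using conn_cyc[OF assms(2)] by simp
qed

end

text \<open>The corner \<open>t i\<close> goes to \<open>(i, 0)\<close>, and its pendants are
  numbered from \<open>1\<close> to \<open>a\<close> by an arbitrary bijection
  \<open>e i\<close>.\<close>

lemma (in spectral_adj) pendant_triangle_coordinates:
  assumes K: "finite K" and tri: "pendant_triangle K t" and a: "of_nat a = lam\<^sup>2 + lam"
  shows "\<exists>f. inj_on f K \<and> f ` K = pverts (C3_pendant a) \<and>
    (\<lambda>(u, v). (f u, f v)) ` rel K = parcs (C3_pendant a)"
proof -
  define T where "T = t ` {..<3}"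
  define L where "L i = nb K (t i) - T" for i
  have t: "T \<subseteq> K" "inj_on t {..<3}" "\<And>i j. i < 3 \<Longrightarrow> j < 3 \<Longrightarrow> i \<noteq> j \<Longrightarrow> adj (t i) (t j)"
    "\<And>z. z \<in> K - T \<Longrightarrow> \<exists>i<3. nb K z = {t i}"
    and cardL: "\<And>i. i < 3 \<Longrightarrow> card (L i) = a"
    using tri of_nat_eq_iff[where 'a = complex] unfolding pendant_triangle_def T_def[symmetric] L_def a[symmetric]
    by auto
  have tT: "t i \<in> T" if "i < 3" for i using that unfolding T_def by blast
  have tinj: "t i = t j \<longleftrightarrow> i = j" if "i < 3" "j < 3" for i j
    using t(2) that by (auto dest: inj_onD)
  have finL: "finite (L i)" for i unfolding L_def using K by simp
  have "\<exists>e. bij_betw e (L i) {1..a}" if "i < 3" for i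
    using finite_same_card_bij[OF finL, of "{1..a}"] cardL[OF that] by simp
  then obtain e where e: "\<And>i. i < 3 \<Longrightarrow> bij_betw (e i) (L i) {1..a}" by metis
  have LK: "z \<in> K - T" "adj (t i) z" "adj z (t i)" "nb K z = {t i}" if i: "i < 3" and z: "z \<in> L i" for i z
  proof -
    show zKT: "z \<in> K - T" and az: "adj (t i) z" using z unfolding L_def nb_def by auto
    show "adj z (t i)" using az by (rule adj_sym)
    then have "t i \<in> nb K z" using tT[OF i] t(1) unfolding nb_def by blast
    then show "nb K z = {t i}" using t(4)[OF zKT] by auto
  qed
  have leaf: "\<exists>i<3. z \<in> L i" if z: "z \<in> K - T" for z
  proof -
    obtain i where i: "i < 3" "nb K z = {t i}" using t(4)[OF z] by blast
    then have "adj z (t i)" unfolding nb_def by blast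
    then have "z \<in> L i" using z adj_sym unfolding L_def nb_def by blast
    then show ?thesis using i(1) by blast
  qed
  have Ldisj: "i = j" if "i < 3" "j < 3" "z \<in> L i" "z \<in> L j" for i j z
    using LK(4)[OF that(1,3)] LK(4)[OF that(2,4)] tinj[OF that(1,2)] by simp
  \<comment> \<open>The corner of a pendant vertex; it is unique because the sets \<open>L i\<close>
    are disjoint.\<close>
  define own where "own z = (THE i. i < 3 \<and> z \<in> L i)" for z
  have own: "own z = i" if "i < 3" "z \<in> L i" for i z
    unfolding own_def using that Ldisj by (intro the_equality) blast+
  define f where "f z = (if z \<in> T then (inv_into {..<3} t z, 0) else (own z, e (own z) z))" for z
  have ft: "f (t i) = (i, 0)" if "i < 3" for i
    using tT[OF that] inv_into_f_f[OF t(2)] that unfolding f_def by simp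
  have fL: "f z = (i, e i z)" if "i < 3" "z \<in> L i" for i z
    using LK(1)[OF that] own[OF that] unfolding f_def by simp
  have eL: "e i z \<in> {1..a}" if "i < 3" "z \<in> L i" for i z
    using bij_betwE[OF e[OF that(1)]] that(2) by blast
  have cases: thesis
    if "z \<in> K" "\<And>i. i < 3 \<Longrightarrow> z = t i \<Longrightarrow> thesis" "\<And>i. i < 3 \<Longrightarrow> z \<in> L i \<Longrightarrow> thesis" for z thesis
    using that leaf[of z] unfolding T_def by blast
  have "inj_on f K"
  proof (rule inj_onI)
    fix y z assume y: "y \<in> K" and z: "z \<in> K" and eq: "f y = f z"
    show "y = z"
    proof (rule cases[OF y]; rule cases[OF z])
      fix i j assume "i < 3" "y = t i" "j < 3" "z = t j"
      then show ?thesis using eq ft by simp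
    next
      fix i j assume "i < 3" "y = t i" "j < 3" "z \<in> L j"
      then show ?thesis using eq ft fL[of j z] eL[of j z] by simp
    next
      fix i j assume "i < 3" "y \<in> L i" "j < 3" "z = t j"
      then show ?thesis using eq ft[of j] fL[of i y] eL[of i y] by auto
    next
      fix i j assume ij: "i < 3" "y \<in> L i" "j < 3" "z \<in> L j"
      then have "i = j" "e i y = e i z" using eq fL[of i y] fL[of j z] by auto
      then show ?thesis using bij_betw_imp_inj_on[OF e[OF ij(1)]] ij by (auto dest: inj_onD)
    qed
  qed
  moreover have "f ` K = pverts (C3_pendant a)"
  proof
    show "f ` K \<subseteq> pverts (C3_pendant a)"
    proof
      fix p assume "p \<in> f ` K"
      then obtain z where z: "z \<in> K" "p = f z" by blast
      show "p \<in> pverts (C3_pendant a)"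
      proof (rule cases[OF z(1)])
        fix i assume "i < 3" "z = t i"
        then show ?thesis using z ft by (simp add: C3_pendant_def)
      next
        fix i assume "i < 3" "z \<in> L i"
        then show ?thesis using z fL[of i z] eL[of i z] by (simp add: C3_pendant_def)
      qed
    qed
    show "pverts (C3_pendant a) \<subseteq> f ` K"
    proof
      fix p assume "p \<in> pverts (C3_pendant a)"
      then obtain i k where p: "p = (i, k)" "i < 3" "k \<le> a" by (auto simp: C3_pendant_def)
      show "p \<in> f ` K"
      proof (cases "k = 0")
        case True
        then show ?thesis using p ft[OF p(2)] tT[OF p(2)] t(1) by force
      next
        case False
        then have "k \<in> e i ` L i" using bij_betw_imp_surj_on[OF e[OF p(2)]] p(3) by simp
        then obtain z where "z \<in> L i" "k = e i z" by blast
        then show ?thesis using p fL[OF p(2)] LK(1)[OF p(2)] by force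
      qed
    qed
  qed
  moreover have "(\<lambda>(u, v). (f u, f v)) ` rel K = parcs (C3_pendant a)"
  proof
    show "(\<lambda>(u, v). (f u, f v)) ` rel K \<subseteq> parcs (C3_pendant a)"
    proof
      fix p assume "p \<in> (\<lambda>(u, v). (f u, f v)) ` rel K"
      then obtain u v where uv: "u \<in> K" "v \<in> K" "adj u v" "p = (f u, f v)" by (auto simp: rel_iff)
      show "p \<in> parcs (C3_pendant a)"
      proof (rule cases[OF uv(1)]; rule cases[OF uv(2)])
        fix i j assume "i < 3" "u = t i" "j < 3" "v = t j"
        then show ?thesis using uv ft adj_irrefl by (auto simp: C3_pendant_def)
      next
        fix i j assume ij: "i < 3" "u = t i" "j < 3" "v \<in> L j"
        then have "u \<in> nb K v" using uv adj_sym unfolding nb_def by blast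
        then have "i = j" using ij LK(4)[OF ij(3,4)] tinj by simp
        then show ?thesis using uv ij ft[of i] fL[of j v] eL[of j v] by (auto simp: C3_pendant_def)
      next
        fix i j assume ij: "i < 3" "u \<in> L i" "j < 3" "v = t j"
        then have "v \<in> nb K u" using uv unfolding nb_def by blast
        then have "i = j" using ij LK(4)[OF ij(1,2)] tinj by simp
        then show ?thesis using uv ij ft[of j] fL[of i u] eL[of i u] by (auto simp: C3_pendant_def)
      next
        fix i j assume ij: "i < 3" "u \<in> L i" "j < 3" "v \<in> L j"
        then have "v \<in> nb K u" using uv unfolding nb_def by blast
        then have "v = t i" using LK(4)[OF ij(1,2)] by simp
        then show ?thesis using LK(1)[OF ij(3,4)] tT[OF ij(1)] by simp
      qed
    qed
    show "parcs (C3_pendant a) \<subseteq> (\<lambda>(u, v). (f u, f v)) ` rel K"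
    proof
      fix p assume "p \<in> parcs (C3_pendant a)"
      then consider i j where "p = ((i, 0), (j, 0))" "i < 3" "j < 3" "i \<noteq> j"
        | i k where "p = ((i, 0), (i, k))" "i < 3" "1 \<le> k" "k \<le> a"
        | i k where "p = ((i, k), (i, 0))" "i < 3" "1 \<le> k" "k \<le> a"
        by (auto simp: C3_pendant_def)
      then show "p \<in> (\<lambda>(u, v). (f u, f v)) ` rel K"
      proof cases
        case 1
        then have "(t i, t j) \<in> rel K" "p = (f (t i), f (t j))"
          using t(1,3) tT ft by (auto simp: rel_iff)
        then show ?thesis by force
      next
        case 2
        then have "k \<in> e i ` L i" using bij_betw_imp_surj_on[OF e[of i]] by simp
        then obtain z where z: "z \<in> L i" "k = e i z" by blast
        then have "(t i, z) \<in> rel K" "p = (f (t i), f z)"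
          using 2 t(1) tT[of i] ft[of i] fL[of i z] LK[of i z] by (auto simp: rel_iff)
        then show ?thesis by force
      next
        case 3
        then have "k \<in> e i ` L i" using bij_betw_imp_surj_on[OF e[of i]] by simp
        then obtain z where z: "z \<in> L i" "k = e i z" by blast
        then have "(z, t i) \<in> rel K" "p = (f z, f (t i))"
          using 3 t(1) tT[of i] ft[of i] fL[of i z] LK[of i z] by (auto simp: rel_iff)
        then show ?thesis by force
      qed
    qed
  qed
  ultimately show ?thesis by blast
qed

text \<open>This numbers the components so that the \<open>c(G)\<close> cyclic ones come
  first.\<close>

lemma bij_betw_prefix:
  assumes "finite N" "P \<subseteq> N"
  obtains h where "bij_betw h {1..card N} N" "\<And>i. i \<in> {1..card N} \<Longrightarrow> h i \<in> P \<longleftrightarrow> i \<le> card P"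
proof -
  have finP: "finite P" using assms finite_subset by blast
  obtain f where f: "bij_betw f {1..card P} P" using ex_bij_betw_nat_finite_1[OF finP] by blast
  obtain g where g: "bij_betw g {1..card (N - P)} (N - P)"
    using ex_bij_betw_nat_finite_1[of "N - P"] assms(1) by blast
  have cN: "card N = card P + card (N - P)"
    using card_Diff_subset[OF finP assms(2)] card_mono[OF assms] by simp
  define h where "h i = (if i \<le> card P then f i else g (i - card P))" for i
  have "bij_betw h {1..card P} P"
    using f by (rule bij_betw_cong[THEN iffD1, rotated]) (simp add: h_def)
  moreover have "bij_betw (\<lambda>i. i - card P) {card P + 1..card N} {1..card (N - P)}"
    by (rule bij_betw_byWitness[where f' = "\<lambda>i. i + card P"]) (use cN in auto)
  then have "bij_betw (g \<circ> (\<lambda>i. i - card P)) {card P + 1..card N} (N - P)"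
    using g by (rule bij_betw_trans)
  then have "bij_betw h {card P + 1..card N} (N - P)"
    by (rule bij_betw_cong[THEN iffD1, rotated]) (simp add: h_def)
  ultimately have "bij_betw h ({1..card P} \<union> {card P + 1..card N}) (P \<union> (N - P))"
    by (rule bij_betw_combine) blast
  moreover have "{1..card P} \<union> {card P + 1..card N} = {1..card N}" using cN by auto
  moreover have "P \<union> (N - P) = N" using assms(2) by blast
  ultimately have "bij_betw h {1..card N} N" by simp
  moreover have "h i \<in> P \<longleftrightarrow> i \<le> card P" if "i \<in> {1..card N}" for i
  proof (cases "i \<le> card P")
    case True
    then show ?thesis using that \<open>bij_betw h {1..card P} P\<close> by (auto dest: bij_betwE)
  next
    case False
    then have "i \<in> {card P + 1..card N}" using that by simp
    then have "h i \<in> N - P" using \<open>bij_betw h {card P + 1..card N} (N - P)\<close> bij_betwE by blast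
    then show ?thesis using False by blast
  qed
  ultimately show ?thesis using that by blast
qed

section \<open>Walks, distances and induced subgraphs of digraphs\<close>

lemma (in wf_digraph) relpow_awalk:
  "(\<exists>p. awalk u p v \<and> length p = n) \<longleftrightarrow> u \<in> verts G \<and> (u, v) \<in> arcs_ends G ^^ n"
proof (induction n arbitrary: u)
  case 0
  show ?case by (auto simp: awalk_Nil_iff)
next
  case (Suc n)
  show ?case
  proof
    assume "\<exists>p. awalk u p v \<and> length p = Suc n"
    then obtain e es where e: "e \<in> arcs G" "u = tail G e" "awalk (head G e) es v" "length es = n"
      by (metis awalk_Cons_iff length_Suc_conv)
    then have "(head G e, v) \<in> arcs_ends G ^^ n" using Suc.IH by blast
    moreover have "(u, head G e) \<in> arcs_ends G" using e by (auto simp: arcs_ends_conv)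
    ultimately have "(u, v) \<in> arcs_ends G ^^ Suc n" by (rule relpow_Suc_I2[rotated])
    then show "u \<in> verts G \<and> (u, v) \<in> arcs_ends G ^^ Suc n" using tail_in_verts[OF e(1)] e(2) by blast
  next
    assume "u \<in> verts G \<and> (u, v) \<in> arcs_ends G ^^ Suc n"
    then obtain x where x: "(u, x) \<in> arcs_ends G" "(x, v) \<in> arcs_ends G ^^ n" by (meson relpow_Suc_E2)
    then obtain e where e: "e \<in> arcs G" "tail G e = u" "head G e = x" by blast
    then obtain p where "awalk x p v" "length p = n" using Suc.IH x(2) head_in_verts by blast
    then show "\<exists>p. awalk u p v \<and> length p = Suc n"
      using e by (intro exI[of _ "e # p"]) (simp add: awalk_Cons_iff)
  qed
qed

lemma (in wf_digraph) awalk_cost_one: "awalk_cost (\<lambda>_. 1) p = real (length p)"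
  by (induction p) auto

lemma (in wf_digraph) \<mu>_one_le_iff:
  assumes "u \<in> verts G"
  shows "\<mu> (\<lambda>_. 1) u v \<le> ereal (real k) \<longleftrightarrow> (\<exists>n\<le>k. (u, v) \<in> arcs_ends G ^^ n)"
proof
  assume le: "\<mu> (\<lambda>_. 1) u v \<le> ereal (real k)"
  show "\<exists>n\<le>k. (u, v) \<in> arcs_ends G ^^ n"
  proof (rule ccontr)
    assume no: "\<not> (\<exists>n\<le>k. (u, v) \<in> arcs_ends G ^^ n)"
    \<comment> \<open>Walk lengths are integers, so all of them are at least \<open>k + 1\<close>
      and so is their infimum.\<close>
    have "ereal (real (Suc k)) \<le> \<mu> (\<lambda>_. 1) u v"
      unfolding \<mu>_def
    proof (rule INF_greatest)
      fix p assume "p \<in> {p. awalk u p v}"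
      then have "(u, v) \<in> arcs_ends G ^^ length p" using relpow_awalk by blast
      then have "\<not> length p \<le> k" using no by blast
      then show "ereal (real (Suc k)) \<le> ereal (awalk_cost (\<lambda>_. 1) p)" by (simp add: awalk_cost_one)
    qed
    then have "ereal (real (Suc k)) \<le> ereal (real k)" using le by (rule order_trans)
    then show False by simp
  qed
next
  assume "\<exists>n\<le>k. (u, v) \<in> arcs_ends G ^^ n"
  then obtain n where n: "n \<le> k" "(u, v) \<in> arcs_ends G ^^ n" by blast
  then obtain p where p: "awalk u p v" "length p = n" using relpow_awalk assms by blast
  have "\<mu> (\<lambda>_. 1) u v \<le> ereal (awalk_cost (\<lambda>_. 1) p)" by (rule min_cost_le_walk_cost[OF p(1)])
  also have "\<dots> \<le> ereal (real k)" using p(2) n(1) by (simp add: awalk_cost_one)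
  finally show "\<mu> (\<lambda>_. 1) u v \<le> ereal (real k)" .
qed

sublocale graph \<subseteq> und: simple_adj "\<lambda>u v. u \<rightarrow>\<^bsub>G\<^esub> v"
proof
  show "u \<rightarrow>\<^bsub>G\<^esub> v \<Longrightarrow> v \<rightarrow>\<^bsub>G\<^esub> u" for u v by (rule graph_symmetric)
  show "\<not> u \<rightarrow>\<^bsub>G\<^esub> u" for u using adj_not_same by blast
qed

context graph
begin

lemma arcs_ends_induce:
  "arcs_ends (G \<restriction> K) = und.rel K"
proof -
  have "(u, v) \<in> arcs_ends (G \<restriction> K) \<longleftrightarrow> (u, v) \<in> arcs_ends G \<and> u \<in> K \<and> v \<in> K" for u v
    unfolding arcs_ends_conv by auto
  then have "(u, v) \<in> arcs_ends (G \<restriction> K) \<longleftrightarrow> (u, v) \<in> und.rel K" for u v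
    unfolding und.rel_iff by blast
  then show ?thesis by (metis subrelI subset_antisym)
qed

lemma wf_induce: "wf_digraph (G \<restriction> K)"
  by (rule wellformed_induce_subgraph)

lemma induce_verts: "G \<restriction> verts G = G"
  by (rule pre_digraph.equality) (auto simp: induce_subgraph_def)

lemma del_vert_induce: "del_vert w = G \<restriction> (verts G - {w})"
  unfolding del_vert_def induce_subgraph_def by auto

lemma edges_eq: "edges G = und.edg (verts G)"
  unfolding edges_def und.edg_def using adj_in_verts by blast

lemma induced_matching_number_eq: "induced_matching_number G = und.imn (verts G)"
proof -
  have "induced_matching G M \<longleftrightarrow> und.imatch (verts G) M" for M
    unfolding induced_matching_def matching_def und.imatch_def edges_eq by blast
  then have "{M. induced_matching G M} = {M. und.imatch (verts G) M}" by blast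
  then show ?thesis unfolding induced_matching_number_def und.imn_def by (simp only:)
qed

lemma strongly_connected_induce:
  assumes "K \<subseteq> verts G"
  shows "strongly_connected (G \<restriction> K) \<longleftrightarrow> und.conn K"
proof -
  interpret D: wf_digraph "G \<restriction> K" by (rule wf_induce)
  show ?thesis
    unfolding strongly_connected_def und.conn_def D.reachable_conv arcs_ends_induce by auto
qed

lemma symmetric_induce: "symmetric (G \<restriction> K)"
  using sym_arcs unfolding symmetric_conv by fastforce

lemma connected_induce:
  assumes "K \<subseteq> verts G"
  shows "connected (G \<restriction> K) \<longleftrightarrow> und.conn K"
proof -
  interpret D: wf_digraph "G \<restriction> K" by (rule wf_induce)
  have "connected (G \<restriction> K) \<longleftrightarrow> strongly_connected (G \<restriction> K)"
    unfolding connected_def strongly_connected_def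
    using D.reachable_mk_symmetric_eq[OF symmetric_induce] by simp
  then show ?thesis using strongly_connected_induce[OF assms] by simp
qed

lemma induced_subgraph_induce:
  assumes "U \<subseteq> verts G"
  shows "induced_subgraph C (G \<restriction> U) \<longleftrightarrow> verts C \<subseteq> U \<and> C = G \<restriction> verts C"
proof
  assume "induced_subgraph C (G \<restriction> U)"
  then show "verts C \<subseteq> U \<and> C = G \<restriction> verts C"
    unfolding induced_subgraph_def subgraph_def compatible_def
    by (auto intro!: pre_digraph.equality)
next
  assume C: "verts C \<subseteq> U \<and> C = G \<restriction> verts C"
  then have "wf_digraph C" "tail C = tail G" "head C = head G"
    "arcs C = {e \<in> arcs G. tail G e \<in> verts C \<and> head G e \<in> verts C}"
    using wf_induce induce_subgraph_tail induce_subgraph_head induce_subgraph_arcs by metis+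
  then show "induced_subgraph C (G \<restriction> U)"
    using C wf_induce[of U] unfolding induced_subgraph_def subgraph_def compatible_def by auto
qed

lemma sccs_induce:
  assumes "U \<subseteq> verts G"
  shows "pre_digraph.sccs (G \<restriction> U) = (\<lambda>K. G \<restriction> K) ` und.comps U"
proof -
  have max: "(\<exists>C'. induced_subgraph C' (G \<restriction> U) \<and> strongly_connected C' \<and> K \<subset> verts C') \<longleftrightarrow>
      (\<exists>K'\<subseteq>U. und.conn K' \<and> K \<subset> K')" for K
  proof
    assume "\<exists>C'. induced_subgraph C' (G \<restriction> U) \<and> strongly_connected C' \<and> K \<subset> verts C'"
    then show "\<exists>K'\<subseteq>U. und.conn K' \<and> K \<subset> K'"
      using induced_subgraph_induce[OF assms] strongly_connected_induce assms by (metis order_trans)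
  next
    assume "\<exists>K'\<subseteq>U. und.conn K' \<and> K \<subset> K'"
    then obtain K' where K': "K' \<subseteq> U" "und.conn K'" "K \<subset> K'" by blast
    then show "\<exists>C'. induced_subgraph C' (G \<restriction> U) \<and> strongly_connected C' \<and> K \<subset> verts C'"
      using induced_subgraph_induce[OF assms, of "G \<restriction> K'"] strongly_connected_induce[of K'] assms
      by (intro exI[of _ "G \<restriction> K'"]) auto
  qed
  have "C \<in> pre_digraph.sccs (G \<restriction> U) \<longleftrightarrow> C = G \<restriction> verts C \<and> verts C \<in> und.comps U" for C
  proof -
    have "C \<in> pre_digraph.sccs (G \<restriction> U) \<longleftrightarrow> verts C \<subseteq> U \<and> C = G \<restriction> verts C \<and> strongly_connected C \<and>
      \<not> (\<exists>K'\<subseteq>U. und.conn K' \<and> verts C \<subset> K')"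
      unfolding pre_digraph.sccs_def using max induced_subgraph_induce[OF assms] by auto
    also have "\<dots> \<longleftrightarrow> C = G \<restriction> verts C \<and> verts C \<in> und.comps U"
      unfolding und.comps_iff_maximal using strongly_connected_induce[of "verts C"] assms by auto
    finally show ?thesis .
  qed
  note mem = this
  show ?thesis
  proof (intro subset_antisym subsetI)
    fix C assume "C \<in> pre_digraph.sccs (G \<restriction> U)"
    then have "C = G \<restriction> verts C" "verts C \<in> und.comps U" using mem by blast+
    then show "C \<in> (\<lambda>K. G \<restriction> K) ` und.comps U" by (rule image_eqI)
  next
    fix C assume "C \<in> (\<lambda>K. G \<restriction> K) ` und.comps U"
    then obtain K where K: "K \<in> und.comps U" "C = G \<restriction> K" by blast
    then have "verts C = K" by simp
    then show "C \<in> pre_digraph.sccs (G \<restriction> U)" using mem[of C] K by simp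
  qed
qed

lemma inj_induce: "inj_on (\<lambda>K. G \<restriction> K) \<K>"
  by (rule inj_onI) (metis induce_subgraph_verts)

lemma cyclomatic_eq: "cyclomatic G = und.cyc (verts G)"
proof -
  have "card (pre_digraph.sccs G) = card (und.comps (verts G))"
    using sccs_induce[OF subset_refl] card_image[OF inj_induce] by (simp add: induce_verts)
  then show ?thesis unfolding cyclomatic_def und.cyc_def edges_eq by simp
qed

lemma nontrivial_sccs:
  assumes "U \<subseteq> verts G"
  shows "{C \<in> pre_digraph.sccs (G \<restriction> U). card (verts C) \<ge> 2}
    = (\<lambda>K. G \<restriction> K) ` und.nontrivial_comps U"
  unfolding sccs_induce[OF assms] und.nontrivial_comps_def by auto

lemma diameter_le_iff:
  assumes "K \<subseteq> verts G"
  shows "graph_diameter (G \<restriction> K) \<le> ereal (real k) \<longleftrightarrow> und.diam_le K k"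
proof -
  interpret D: wf_digraph "G \<restriction> K" by (rule wf_induce)
  show ?thesis
    unfolding graph_diameter_def SUP_le_iff und.diam_le_def
    using D.\<mu>_one_le_iff unfolding arcs_ends_induce by auto
qed

lemma diameter_eq:
  assumes K: "K \<subseteq> verts G"
    and le: "und.diam_le K (Suc k)" and ge: "\<not> und.diam_le K k"
  shows "graph_diameter (G \<restriction> K) = ereal (real (Suc k))"
proof (rule antisym)
  interpret D: wf_digraph "G \<restriction> K" by (rule wf_induce)
  show "graph_diameter (G \<restriction> K) \<le> ereal (real (Suc k))" using diameter_le_iff[OF K] le by blast
  obtain x y where xy: "x \<in> K" "y \<in> K" "\<not> (\<exists>n\<le>k. (x, y) \<in> und.rel K ^^ n)" using ge unfolding und.diam_le_def by blast
  have "ereal (real (Suc k)) \<le> D.\<mu> (\<lambda>_. 1) x y"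
    unfolding D.\<mu>_def
  proof (rule INF_greatest)
    fix p assume "p \<in> {p. D.awalk x p y}"
    then have "(x, y) \<in> und.rel K ^^ length p"
      using D.relpow_awalk arcs_ends_induce by (metis mem_Collect_eq)
    then have "\<not> length p \<le> k" using xy(3) by blast
    then show "ereal (real (Suc k)) \<le> ereal (D.awalk_cost (\<lambda>_. 1) p)" by (simp add: D.awalk_cost_one)
  qed
  also have "\<dots> \<le> (SUP v\<in>K. D.\<mu> (\<lambda>_. 1) x v)" using xy(2) by (rule SUP_upper)
  also have "\<dots> \<le> graph_diameter (G \<restriction> K)"
    unfolding graph_diameter_def induce_subgraph_verts using xy(1) by (rule SUP_upper)
  finally show "ereal (real (Suc k)) \<le> graph_diameter (G \<restriction> K)" .
qed

text \<open>The vertices of a digraph cycle of length at least three are distinct, so its arcs span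
  a cycle to which \<open>cycle_cyc\<close> applies.\<close>

lemma undirected_tree_induce:
  assumes K: "K \<subseteq> verts G" "und.conn K" "und.cyc K = 0"
  shows "undirected_tree (G \<restriction> K)"
proof -
  interpret D: wf_digraph "G \<restriction> K" by (rule wf_induce)
  have walk: "und.wedges u (butlast (map (head G) p)) v \<subseteq> und.edg K"
    if "D.awalk u p v" "p \<noteq> []" for u p v
    using that
  proof (induction p arbitrary: u)
    case (Cons e es)
    have e: "e \<in> arcs (G \<restriction> K)" "u = tail G e" "D.awalk (head G e) es v"
      using Cons.prems(1) by (auto simp: D.awalk_Cons_iff)
    have "(u, head G e) \<in> arcs_ends (G \<restriction> K)" using e by (auto simp: arcs_ends_conv)
    then have edge: "{u, head G e} \<in> und.edg K"
      using arcs_ends_induce by (simp add: und.rel_iff und.edg_iff)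
    show ?case
    proof (cases es)
      case Nil
      then have "head G e = v" using e(3) by (simp add: D.awalk_Nil_iff)
      then show ?thesis using Nil edge by simp
    next
      case (Cons f fs)
      then show ?thesis using Cons.IH[OF e(3)] edge by simp
    qed
  qed simp
  have "\<not> (\<exists>p. D.cycle p \<and> 3 \<le> length p)"
  proof
    assume "\<exists>p. D.cycle p \<and> 3 \<le> length p"
    then obtain u p where p: "D.awalk u p u" "distinct (tl (D.awalk_verts u p))" "p \<noteq> []" "3 \<le> length p"
      unfolding D.cycle_def by blast
    \<comment> \<open>The arc heads of the closed walk end in \<open>u\<close>; without this last
      entry they are the inner vertices expected by \<open>wedges\<close>.\<close>
    define qs where "qs = butlast (map (head G) p)"
    have cas: "D.cas u p u" using p(1) by blast
    have vs: "tl (D.awalk_verts u p) = map (head G) p"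
      using D.awalk_verts_conv'[OF cas] p(3) by simp
    have "last (D.awalk_verts u p) = u" using p(1) by blast
    then have "last (map (head G) p) = u"
      using D.awalk_verts_conv'[OF cas] p(3) by (simp split: if_splits)
    then have split: "map (head G) p = qs @ [u]" unfolding qs_def using p(3) by (metis append_butlast_last_id map_is_Nil_conv)
    then have "distinct (u # qs)" using p(2) vs by auto
    moreover have "length qs = length p - 1" unfolding qs_def by simp
    then have "2 \<le> length qs" using p(4) by simp
    moreover have "und.wedges u qs u \<subseteq> und.edg K" unfolding qs_def using walk p(1,3) by blast
    moreover have "finite K" using K(1) finite_verts finite_subset by blast
    ultimately show False using und.cycle_cyc[OF _ K(2)] K(3) by fastforce
  qed
  then show ?thesis unfolding undirected_tree_def using connected_induce[OF K(1)] K(2) by blast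
qed

lemma isolated_verts_induce:
  assumes "U \<subseteq> verts G" "\<forall>K\<in>und.comps U. 2 \<le> card K"
  shows "isolated_verts (G \<restriction> U) = {}"
proof -
  have "\<exists>u. v \<rightarrow>\<^bsub>G \<restriction> U\<^esub> u" if v: "v \<in> U" for v
  proof -
    let ?K = "und.comp_of U v"
    have K: "?K \<in> und.comps U" unfolding und.comps_def using v by blast
    have "?K \<noteq> {v}" using assms(2) K by force
    then obtain y where "y \<in> ?K - {v}" "v \<rightarrow>\<^bsub>G\<^esub> y"
      using und.conn_boundary[OF und.comps_conn[OF K], of "{v}"] und.comp_of_self[OF v] by blast
    then have "(v, y) \<in> und.rel U" using v und.comp_of_subset[of U v] by (auto simp: und.rel_iff)
    then show ?thesis unfolding arcs_ends_induce by blast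
  qed
  then show ?thesis unfolding isolated_verts_def by auto
qed

text \<open>Arcs of \<open>G\<close> have arbitrary names, so an arc is sent to the pair of images
  of its ends; this is injective because there are no parallel arcs.\<close>

lemma digraph_iso_induce:
  assumes K: "K \<subseteq> verts G" and f: "inj_on f K" "f ` K = pverts H"
    "(\<lambda>(u, v). (f u, f v)) ` und.rel K = parcs H"
  shows "digraph_iso (G \<restriction> K) (with_proj H)"
proof -
  define hom where "hom = \<lparr>iso_verts = f, iso_arcs = (\<lambda>e. (f (tail G e), f (head G e))),
    iso_head = snd, iso_tail = fst\<rparr>"
  have "inj_on (iso_arcs hom) (arcs (G \<restriction> K))"
  proof (rule inj_onI)
    fix e e' assume e: "e \<in> arcs (G \<restriction> K)" "e' \<in> arcs (G \<restriction> K)" "iso_arcs hom e = iso_arcs hom e'"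
    then have "tail G e = tail G e'" "head G e = head G e'"
      using f(1) unfolding hom_def by (auto dest: inj_onD)
    then show "e = e'" using e no_multi_arcs[of e e'] by (simp add: arc_to_ends_def)
  qed
  then have "pre_digraph.digraph_isomorphism (G \<restriction> K) hom"
    unfolding pre_digraph.digraph_isomorphism_def using wf_induce f(1) by (simp add: hom_def)
  moreover have "with_proj H = app_iso hom (G \<restriction> K)"
  proof (rule pre_digraph.equality)
    have "iso_arcs hom ` arcs (G \<restriction> K) = (\<lambda>(u, v). (f u, f v)) ` arcs_ends (G \<restriction> K)"
      unfolding arcs_ends_conv image_image by (simp add: hom_def)
    then show "arcs (with_proj H) = arcs (app_iso hom (G \<restriction> K))"
      using f(3) arcs_ends_induce by simp
  qed (use f(2) in \<open>simp_all add: hom_def\<close>)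
  ultimately show ?thesis unfolding digraph_iso_def by blast
qed

lemma eigenvalue_mult_induce:
  assumes "K \<subseteq> verts G" "spectral_adj (\<lambda>u v. u \<rightarrow>\<^bsub>G\<^esub> v) (complex_of_real \<theta>)"
  shows "eigenvalue_mult (G \<restriction> K) \<theta> = spectral_adj.mult (\<lambda>u v. u \<rightarrow>\<^bsub>G\<^esub> v) (complex_of_real \<theta>) K"
proof -
  interpret spectral_adj "\<lambda>u v. u \<rightarrow>\<^bsub>G\<^esub> v" "complex_of_real \<theta>" by (rule assms(2))
  have finK: "finite K" using assms(1) finite_verts finite_subset by blast
  define vs where "vs = vertex_list (G \<restriction> K)"
  have vs: "distinct vs" "set vs = K"
    using someI_ex[of "\<lambda>vs. distinct vs \<and> set vs = verts (G \<restriction> K)"] finite_distinct_list[OF finK]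
    unfolding vs_def vertex_list_def by auto
  have n: "card K = length vs" using distinct_card[OF vs(1)] vs(2) by simp
  have "adjacency_matrix (G \<restriction> K) =
    mat (card K) (card K) (\<lambda>(i, j). if vs ! i \<rightarrow>\<^bsub>G\<^esub> vs ! j then 1 else (0::real))"
    unfolding adjacency_matrix_def vs_def[symmetric] arcs_ends_induce
    by (rule eq_matI) (use vs n in \<open>auto simp: und.rel_iff\<close>)
  from order_char_poly_eq_mult[OF vs n refl this] show ?thesis unfolding eigenvalue_mult_def .
qed

end

theorem theorem3p2:
  fixes G :: "('a, 'b) pre_digraph" and \<theta> :: real
  assumes "graph G"
    and "Digraph_Component.connected G"
    and "graph_diameter G \<ge> 4"
    and "induced_matching_number G \<ge> 3"
    and "eigenvalue (adjacency_matrix G) \<theta>"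
    and "\<theta> \<noteq> 0"
  shows "int (eigenvalue_mult G \<theta>) = int (induced_matching_number G) + cyclomatic G - 1 \<longleftrightarrow>
    (\<exists>w\<in>verts G. \<exists>(s::nat) (H :: nat \<Rightarrow> ('a, 'b) pre_digraph) (I :: 'a set).
       s = induced_matching_number G \<and> s \<ge> 3 \<and> cyclomatic G \<le> int s \<and>
       I = isolated_verts (pre_digraph.del_vert G w) \<and>
       bij_betw H {1..s} {C \<in> pre_digraph.sccs (pre_digraph.del_vert G w). card (verts C) \<ge> 2} \<and>
       (\<exists>a::nat. \<forall>i\<in>{1..s}. int i \<le> cyclomatic G \<longrightarrow>
          digraph_iso (H i) (with_proj (C3_pendant a)) \<and> eigenvalue_mult (H i) \<theta> = 2) \<and>
       (\<forall>j\<in>{1..s}. cyclomatic G + 1 \<le> int j \<longrightarrow>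
          undirected_tree (H j) \<and> graph_diameter (H j) \<le> 3 \<and> eigenvalue_mult (H j) \<theta> = 1) \<and>
       ((\<exists>i\<in>{1..s}. graph_diameter (G \<restriction> insert w (verts (H i))) = 2) \<or>
        (I = {} \<and> (\<forall>i\<in>{1..s}. graph_diameter (G \<restriction> insert w (verts (H i))) = 3))))"
proof (rule iffI, goal_cases)
  interpret graph G by (rule assms(1))
  interpret sp: spectral_adj "\<lambda>u v. u \<rightarrow>\<^bsub>G\<^esub> v" "complex_of_real \<theta>"
    by unfold_locales (use assms(6) in simp)
  note mult_induce = eigenvalue_mult_induce[OF _ sp.spectral_adj_axioms]
  define V where "V = verts G"
  have V: "V \<subseteq> verts G" and finV: "finite V" unfolding V_def by simp_all
  have conV: "und.conn V" using connected_induce[OF V] assms(2) unfolding V_def by (simp add: induce_verts)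
  have mult_G: "eigenvalue_mult G \<theta> = sp.mult V"
    using mult_induce[OF V] unfolding V_def by (simp add: induce_verts)
  have imn_G: "induced_matching_number G = und.imn V" and cyc_G: "cyclomatic G = und.cyc V"
    unfolding V_def by (rule induced_matching_number_eq) (rule cyclomatic_eq)
  have imn3: "3 \<le> und.imn V" using assms(4) imn_G by simp
  have sccs: "{C \<in> pre_digraph.sccs (del_vert w). card (verts C) \<ge> 2}
      = (\<lambda>K. G \<restriction> K) ` und.nontrivial_comps (V - {w})" for w
    unfolding del_vert_induce V_def[symmetric]
    by (rule nontrivial_sccs) (use V in blast)
  have comp_V: "K \<subseteq> verts G" if "K \<in> und.nontrivial_comps (V - {w})" for K w
    using und.comps_subset[of K "V - {w}"] that V unfolding und.nontrivial_comps_def by blast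
  {
    case 1
    then have "int (sp.mult V) = int (und.imn V) + und.cyc V - 1" unfolding mult_G imn_G cyc_G .
    then obtain w where "extremal (\<lambda>u v. u \<rightarrow>\<^bsub>G\<^esub> v) (complex_of_real \<theta>) V w"
      using sp.extremal_exists[OF finV conV imn3] by blast
    then interpret ex: extremal "\<lambda>u v. u \<rightarrow>\<^bsub>G\<^esub> v" "complex_of_real \<theta>" V w .
    define N where "N = und.nontrivial_comps (V - {w})"
    define P where "P = {K \<in> N. und.cyc K \<noteq> 0}"
    have NW: "N = und.nontrivial_comps ex.W" unfolding N_def ex.W_def ..
    have finN: "finite N" unfolding NW und.nontrivial_comps_def using und.finite_comps[OF ex.finW] by simp
    have PN: "P \<subseteq> N" unfolding P_def by blast
    obtain h where h: "bij_betw h {1..card N} N" "\<And>i. i \<in> {1..card N} \<Longrightarrow> h i \<in> P \<longleftrightarrow> i \<le> card P"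
      using bij_betw_prefix[OF finN PN] by blast
    have cardN: "card N = und.imn V" unfolding NW by (rule ex.card_nontrivial)
    have cardP: "int (card P) = und.cyc V" unfolding P_def NW by (rule ex.card_cyclic)
    have hN: "h i \<in> N" if "i \<in> {1..card N}" for i using h(1) that bij_betwE by blast
    have NV: "K \<subseteq> verts G" "insert w K \<subseteq> verts G" "und.conn K" if "K \<in> N" for K
    proof -
      show K: "K \<subseteq> verts G" using comp_V that unfolding N_def .
      then show "insert w K \<subseteq> verts G" using ex.wV V by blast
      show "und.conn K" using ex.nontrivialD(4) that unfolding NW .
    qed
    let ?H = "\<lambda>i. G \<restriction> h i"
    have bij: "bij_betw ?H {1..card N} {C \<in> pre_digraph.sccs (del_vert w). card (verts C) \<ge> 2}"
      unfolding sccs N_def[symmetric]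
      using bij_betw_trans[OF h(1) bij_betw_imageI[OF inj_induce refl]] by (simp add: o_def)
    have PK: "sp.mult K = 2 \<and> (\<exists>t. sp.pendant_triangle K t)" if "K \<in> P" for K
      using ex.nontrivial_classification[of K] that unfolding P_def NW by auto
    have NP: "und.cyc K = 0 \<and> sp.mult K = 1" if "K \<in> N" "K \<notin> P" for K
      using ex.nontrivial_classification[of K] that unfolding P_def NW by auto
    have "\<exists>a::nat. \<forall>K\<in>P. digraph_iso (G \<restriction> K) (with_proj (C3_pendant a))"
    proof (cases "P = {}")
      case False
      \<comment> \<open>One triangle component supplies \<open>a\<close>; as \<open>lam\<close>
        fixes the number, it fits all others.\<close>
      then obtain K t where "K \<in> P" "sp.pendant_triangle K t" using PK by blast
      then obtain a :: nat where a: "of_nat a = (complex_of_real \<theta>)\<^sup>2 + complex_of_real \<theta>"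
        unfolding sp.pendant_triangle_def by (metis zero_less_numeral)
      have "digraph_iso (G \<restriction> K) (with_proj (C3_pendant a))" if KP: "K \<in> P" for K
      proof -
        have K: "K \<subseteq> verts G" using NV(1) KP PN by blast
        obtain t where "sp.pendant_triangle K t" using PK KP by blast
        from sp.pendant_triangle_coordinates[OF finite_subset[OF K finite_verts] this a]
        show ?thesis using digraph_iso_induce[OF K] by blast
      qed
      then show ?thesis by blast
    qed simp
    then obtain a :: nat where a: "\<And>K. K \<in> P \<Longrightarrow> digraph_iso (G \<restriction> K) (with_proj (C3_pendant a))" by blast
    have i_ii: "digraph_iso (?H i) (with_proj (C3_pendant a)) \<and> eigenvalue_mult (?H i) \<theta> = 2"
      if i: "i \<in> {1..card N}" "int i \<le> und.cyc V" for i
    proof -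
      have "h i \<in> P" using h(2)[OF i(1)] i(2) cardP by simp
      then show ?thesis using a PK mult_induce[OF NV(1)[OF hN[OF i(1)]]] by simp
    qed
    have tree: "undirected_tree (?H j) \<and> graph_diameter (?H j) \<le> 3 \<and> eigenvalue_mult (?H j) \<theta> = 1"
      if j: "j \<in> {1..card N}" "und.cyc V + 1 \<le> int j" for j
    proof -
      have K: "h j \<in> N" "h j \<notin> P" using h(2)[OF j(1)] j(2) cardP hN[OF j(1)] by auto
      have "und.diam_le (h j) 3" using ex.nontrivial_diam K(1) unfolding NW by blast
      then have "graph_diameter (?H j) \<le> ereal (real 3)"
        using diameter_le_iff[OF NV(1)[OF K(1)]] by blast
      then show ?thesis
        using undirected_tree_induce[OF NV(1,3)[OF K(1)]] NP[OF K] mult_induce[OF NV(1)[OF K(1)]] by simp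
    qed
    have diam: "graph_diameter (G \<restriction> insert w K) = ereal (real (Suc k))"
      if "K \<in> N" "und.diam_le (insert w K) (Suc k)" "\<not> und.diam_le (insert w K) k" for K k
      using diameter_eq[OF NV(2)[OF that(1)] that(2,3)] .
    have image: "\<exists>i\<in>{1..card N}. h i = K" if "K \<in> N" for K
    proof -
      have "K \<in> h ` {1..card N}" unfolding bij_betw_imp_surj_on[OF h(1)] by (rule that)
      then show ?thesis by blast
    qed
    have iii: "(\<exists>i\<in>{1..card N}. graph_diameter (G \<restriction> insert w (verts (?H i))) = 2) \<or>
      (isolated_verts (del_vert w) = {} \<and>
        (\<forall>i\<in>{1..card N}. graph_diameter (G \<restriction> insert w (verts (?H i))) = 3))"
      using ex.diameter_condition
    proof
      assume "\<exists>K\<in>und.nontrivial_comps ex.W. und.diam_le (insert w K) 2 \<and> \<not> und.diam_le (insert w K) 1"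
      then obtain K where K: "K \<in> N" "und.diam_le (insert w K) (Suc 1)" "\<not> und.diam_le (insert w K) 1"
        unfolding NW by (auto simp: numeral_2_eq_2)
      have "graph_diameter (G \<restriction> insert w K) = 2" using diam[OF K] by simp
      then show ?thesis using image[OF K(1)] by auto
    next
      assume *: "(\<forall>K\<in>und.comps ex.W. 2 \<le> card K) \<and>
        (\<forall>K\<in>und.nontrivial_comps ex.W. und.diam_le (insert w K) 3 \<and> \<not> und.diam_le (insert w K) 2)"
      have "isolated_verts (del_vert w) = {}"
        unfolding del_vert_induce
      proof (rule isolated_verts_induce)
        show "\<forall>K\<in>und.comps (verts G - {w}). 2 \<le> card K" using * unfolding ex.W_def V_def[symmetric] by blast
      qed blast
      moreover have "graph_diameter (G \<restriction> insert w (verts (?H i))) = 3" if "i \<in> {1..card N}" for i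
        using diam[OF hN[OF that], of 2] * hN[OF that] unfolding NW by simp
      ultimately show ?thesis by blast
    qed
    have "und.cyc V \<le> int (card N)" using cardP card_mono[OF finN PN] by simp
    then show ?case
      unfolding imn_G cyc_G cardN[symmetric]
      using ex.wV V imn3 cardN bij i_ii tree iii
      by (intro bexI[of _ w] exI[of _ "card N"] exI[of _ ?H] exI[of _ "isolated_verts (del_vert w)"] conjI
          exI[of _ a] ballI impI) (simp_all only:, auto)
  }
  {
    case 2
    then obtain w H where w: "w \<in> verts G" and le: "und.cyc V \<le> int (und.imn V)"
      and bij: "bij_betw H {1..und.imn V} ((\<lambda>K. G \<restriction> K) ` und.nontrivial_comps (V - {w}))"
      and two: "\<And>i. i \<in> {1..und.imn V} \<Longrightarrow> int i \<le> und.cyc V \<Longrightarrow> eigenvalue_mult (H i) \<theta> = 2"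
      and one: "\<And>i. i \<in> {1..und.imn V} \<Longrightarrow> und.cyc V + 1 \<le> int i \<Longrightarrow> eigenvalue_mult (H i) \<theta> = 1"
      unfolding imn_G cyc_G sccs by blast
    define W where "W = V - {w}"
    define s where "s = und.imn V"
    have finW: "finite W" unfolding W_def using finV by simp
    obtain c where c: "und.cyc V = int c" using und.conn_cyc_nonneg[OF finV conV] nonneg_int_cases by metis
    have cs: "c \<le> s" using le c unfolding s_def by simp
    have trivial: "sp.mult K = 0" if K: "K \<in> und.comps W" "K \<notin> und.nontrivial_comps W" for K
    proof -
      have "finite K" using und.comps_subset[OF K(1)] finW finite_subset by blast
      then obtain x where "K = {x}"
        using und.trivial_comp[of K] und.comps_conn K unfolding und.nontrivial_comps_def by blast
      then show ?thesis using sp.mult_no_edge[OF und.singleton_edg] by simp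
    qed
    have "int (sp.mult W) = (\<Sum>K\<in>und.comps W. int (sp.mult K))" by (rule sp.mult_sum[OF finW])
    also have "\<dots> = (\<Sum>K\<in>und.nontrivial_comps W. int (sp.mult K))"
      by (rule sum.mono_neutral_right)
        (use und.finite_comps[OF finW] trivial in \<open>auto simp: und.nontrivial_comps_def\<close>)
    also have "\<dots> = (\<Sum>K\<in>und.nontrivial_comps W. int (eigenvalue_mult (G \<restriction> K) \<theta>))"
      by (rule sum.cong) (use mult_induce comp_V in \<open>auto simp: W_def\<close>)
    also have "\<dots> = (\<Sum>C\<in>(\<lambda>K. G \<restriction> K) ` und.nontrivial_comps W. int (eigenvalue_mult C \<theta>))"
      by (simp add: sum.reindex[OF inj_induce])
    also have "\<dots> = (\<Sum>i\<in>{1..s}. int (eigenvalue_mult (H i) \<theta>))"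
      by (rule sum.reindex_bij_betw[symmetric]) (use bij in \<open>simp add: W_def s_def\<close>)
    \<comment> \<open>The first \<open>c\<close> components contribute two each and the others one,
      altogether \<open>s + c\<close>.\<close>
    also have "\<dots> = (\<Sum>i\<in>{1..s}. 1 + (if i \<le> c then 1 else 0))"
      by (rule sum.cong) (use two one c in \<open>auto simp: s_def\<close>)
    also have "\<dots> = int s + (\<Sum>i\<in>{1..s}. if i \<le> c then 1 else 0)"
      by (simp add: sum.distrib)
    also have "(\<Sum>i\<in>{1..s}. if i \<le> c then 1 else 0) = (\<Sum>i\<in>{i \<in> {1..s}. i \<le> c}. (1::int))"
      by (rule sum.inter_filter[symmetric]) simp
    also have "{i \<in> {1..s}. i \<le> c} = {1..c}" using cs by auto
    finally have "int (sp.mult (V - {w})) = int (und.imn V) + und.cyc V" unfolding W_def s_def c by simp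
    then show ?case
      unfolding mult_G imn_G cyc_G
      using sp.mult_from_deletion[OF finV conV _ _] imn3 w V_def by simp
  }
qed

end
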